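(* Let $\eta$ be a real quadratic irrationality and let $a,b$ be real numbers with $0<a<b<1$. For a positive integer $N$, let $J_{5,2}(N)$ denote the number of ordered $5$-tuples of primes $(p_1,\dots,p_5)$ with $$p_1^2+p_2^2+p_3^2+p_4^2+p_5^2=N$$ such that $a<\{\eta p_i^2\}<b$ for every $i=1,\dots,5$, and let $I_{5,2}(N)$ denote the number of ordered $5$-tuples of primes $(p_1,\dots,p_5)$ (with no further restriction) satisfying $p_1^2+\dots+p_5^2=N$. Put $$\sigma(N,a,b)=\sum_{m=-\infty}^{\infty} e^{2\pi i m(\eta N-2.5(a+b))}\,\frac{\sin^5 (\pi m (b-a))}{\pi^5 m^5},$$ where the term with $m=0$ is interpreted as its limiting value $(b-a)^5$. Then, as $N\to\infty$, $$J_{5,2}(N)=I_{5,2}(N)\,\sigma(N,a,b)+O\bigl(N^{3/2-0.00002}\bigr),$$ where the implied constant may depend on $\eta$, $a$, $b$.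
   Context: $\{x\}$ denotes the fractional part of the real number $x$. A quadratic irrationality is an irrational real number that is a root of a quadratic polynomial with integer coefficients. *)

theory Defs
  imports "HOL-Analysis.Analysis" "HOL-Library.Landau_Symbols"
    "HOL-Computational_Algebra.Primes"
begin

definition quadratic_irrationality :: "real \<Rightarrow> bool" where
  "quadratic_irrationality x \<longleftrightarrow>
     x \<notin> \<rat> \<and>
     (\<exists>u v w :: int. u \<noteq> 0 \<and> of_int u * x ^ 2 + of_int v * x + of_int w = 0)"

text \<open>Ordered 5-tuples are represented by lists of length 5.\<close>

definition prime_square_reps :: "nat \<Rightarrow> nat list set" where
  "prime_square_reps N =
     {ps. length ps = 5 \<and> (\<forall>p\<in>set ps. prime p) \<and> (\<Sum>p\<leftarrow>ps. p ^ 2) = N}"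

definition I_5_2 :: "nat \<Rightarrow> nat" where
  "I_5_2 N = card (prime_square_reps N)"

definition J_5_2 :: "real \<Rightarrow> real \<Rightarrow> real \<Rightarrow> nat \<Rightarrow> nat" where
  "J_5_2 \<eta> a b N =
     card {ps \<in> prime_square_reps N.
             \<forall>p\<in>set ps. a < frac (\<eta> * real (p ^ 2)) \<and> frac (\<eta> * real (p ^ 2)) < b}"

definition sigma_term :: "real \<Rightarrow> real \<Rightarrow> real \<Rightarrow> nat \<Rightarrow> int \<Rightarrow> complex" where
  "sigma_term \<eta> a b N m =
     (if m = 0 then of_real ((b - a) ^ 5)
      else exp (2 * of_real pi * \<i> * of_int m * of_real (\<eta> * real N - 2.5 * (a + b)))
           * of_real (sin (pi * of_int m * (b - a)) ^ 5 / (pi ^ 5 * of_int m ^ 5)))"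

definition sigma_series :: "real \<Rightarrow> real \<Rightarrow> real \<Rightarrow> nat \<Rightarrow> complex" where
  "sigma_series \<eta> a b N = (\<Sum>\<^sub>\<infinity>m\<in>UNIV. sigma_term \<eta> a b N m)"

text \<open>The cardinalities and the infinite sum above are never the default value 0 of
  \<^const>\<open>card\<close> on infinite sets or of \<^const>\<open>infsum\<close> on non-summable families.\<close>

lemma finite_prime_square_reps: "finite (prime_square_reps N)"
proof (rule finite_subset)
  show "prime_square_reps N \<subseteq> {ps. set ps \<subseteq> {..N} \<and> length ps = 5}"
  proof (clarsimp simp: prime_square_reps_def)
    fix ps :: "nat list" and p assume "p \<in> set ps"
    then have "p ^ 2 \<le> (\<Sum>p\<leftarrow>ps. p ^ 2)"
      by (intro member_le_sum_list) auto
    moreover have "p \<le> p ^ 2" by (simp add: power2_eq_square)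
    ultimately show "p \<le> (\<Sum>p\<leftarrow>ps. p ^ 2)" by linarith
  qed
qed (rule finite_lists_length_eq, simp)

lemma norm_sigma_term_le:
  assumes "m \<noteq> 0"
  shows "norm (sigma_term \<eta> a b N m) \<le> 1 / real (nat \<bar>m\<bar>) ^ 2"
proof -
  have e: "norm (exp (2 * of_real pi * \<i> * of_int m * of_real t) :: complex) = 1" for t
    by (simp add: norm_exp_eq_Re)
  have m1: "1 \<le> \<bar>real_of_int m\<bar>" using assms by linarith
  have "\<bar>sin (pi * of_int m * (b - a))\<bar> ^ 5 \<le> 1"
    by (intro power_le_one) auto
  moreover have "1 * \<bar>real_of_int m\<bar> ^ 2 \<le> pi ^ 5 * \<bar>real_of_int m\<bar> ^ 5"
    using m1 pi_gt3 by (intro mult_mono power_increasing one_le_power) auto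
  ultimately have "\<bar>sin (pi * of_int m * (b - a))\<bar> ^ 5 / (pi ^ 5 * \<bar>real_of_int m\<bar> ^ 5)
      \<le> 1 / \<bar>real_of_int m\<bar> ^ 2"
    using m1 by (intro frac_le) auto
  moreover have "norm (sigma_term \<eta> a b N m) =
      \<bar>sin (pi * of_int m * (b - a))\<bar> ^ 5 / (pi ^ 5 * \<bar>real_of_int m\<bar> ^ 5)"
    using assms unfolding sigma_term_def
    by (simp only: if_False norm_mult e norm_of_real abs_divide abs_mult power_abs) simp
  moreover have "real (nat \<bar>m\<bar>) = \<bar>real_of_int m\<bar>" by simp
  ultimately show ?thesis by simp
qed

lemma summable_on_sigma_term: "sigma_term \<eta> a b N summable_on UNIV"
proof -
  let ?f = "\<lambda>m. norm (sigma_term \<eta> a b N m)"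
  have s: "(\<lambda>n. 1 / real n ^ 2) summable_on UNIV"
    using inverse_power_summable[of 2, where ?'a = real]
    by (intro norm_summable_imp_summable_on) (simp add: field_simps)
  have half: "?f summable_on (h ` {1..})" if h: "h = int \<or> h = (\<lambda>n. - int n)" for h
  proof -
    have inj: "inj_on h {1..}" using h by (auto simp: inj_on_def)
    have "(?f \<circ> h) summable_on {1..}"
    proof (rule summable_on_comparison_test)
      show "(\<lambda>n. 1 / real n ^ 2) summable_on {1..}"
        using s summable_on_subset_banach by blast
      show "(?f \<circ> h) n \<le> 1 / real n ^ 2" if "n \<in> {1..}" for n
        using norm_sigma_term_le[of "h n" \<eta> a b N] that h by auto
    qed auto
    then show ?thesis using summable_on_reindex[OF inj] by blast
  qed
  have U: "(UNIV :: int set) = {0} \<union> (int ` {1..} \<union> (\<lambda>n. - int n) ` {1..})"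
  proof (intro set_eqI iffI UNIV_I)
    fix m :: int
    consider "m = 0" | "m = int (nat m)" "nat m \<ge> 1" | "m = - int (nat (- m))" "nat (- m) \<ge> 1"
      by linarith
    then show "m \<in> {0} \<union> (int ` {1..} \<union> (\<lambda>n. - int n) ` {1..})"
      by cases (blast intro: atLeast_iff[THEN iffD2])+
  qed
  have "?f summable_on UNIV"
    unfolding U using half
    by (intro summable_on_union) auto
  then show ?thesis by (rule abs_summable_summable)
qed

end

(* Expanding smoothed indicators of (a, b) in Fourier series turns J into a combination of the
   sums R(m_1, ..., m_5) of e(eta (m_1 p_1^2 + ... + m_5 p_5^2)) over the representations of N,
   where e(t) = exp(2 pi i t). If all m_i equal m, then R is e(m eta N) I(N), and these terms make
   up the main term. Otherwise R is an average over alpha of e(-N alpha) times the product of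
   S(alpha + m_i eta), where S is the exponential sum over squares of primes up to sqrt N. Since
   eta is badly approximable, two distinct shifts of alpha cannot both be close to fractions with
   small denominator, so one of the factors S saves a power of N (Vaughan's identity and Weyl
   differencing); the other four factors are controlled by the number of solutions of
   a^2 + b^2 = c^2 + d^2.
   Fejer's kernel supplies both the smoothing and the majorant for the p with eta p^2 near an
   endpoint of the arc. *)

theory Submission
  imports Defs "HOL-Number_Theory.Prime_Powers" "HOL-Computational_Algebra.Squarefree"
begin

section \<open>Exponential sums\<close>

text \<open>The diagonal tuples reproduce I(N) as it stands, so the whole burden is to make every
  off-diagonal R(m_1, ..., m_5) small. A power must then be saved at each \<alpha>, also at those
  near fractions with small denominator, where a single S can be large; hence two distinct shifts
  are played against each other. With x the integer part of sqrt N, one factor S costs x^0.987 and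
  the fourth moment of the others x^2.0001, so R is at most about x^2.9871, against the bound
  x^3.0001 for I(N). This gap of 0.013 pays for the number of frequencies: kernels of orders H =
  x^0.0004 and K = H^3 lead to about K^5 = x^0.006 tuples. The final exponent comes from the
  endpoints: they cost I(N) / H, about x^2.9997 = N^1.49985, just below the required N^1.49998.
  Convolution with Fejer's kernel keeps the Fourier coefficients of the arc up to weights 1 - |m| /
  K, so the diagonal sum of their fifth powers is a truncated sigma with relative loss O(1 /
  K).\<close>

definition ee :: "real \<Rightarrow> complex" where
  "ee t = cis (2 * pi * t)"

definition nid :: "real \<Rightarrow> real" where
  "nid t = \<bar>t - of_int (round t)\<bar>"

text \<open>This is \<open>min Y (1 / nid t)\<close>, written without the junk value of division by \<open>nid t = 0\<close>.\<close>
definition cap :: "real \<Rightarrow> real \<Rightarrow> real" where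
  "cap Y t = Y / max 1 (Y * nid t)"

lemma norm_ee [simp]: "norm (ee t) = 1"
  by (simp add: ee_def)

lemma ee_0 [simp]: "ee 0 = 1"
  by (simp add: ee_def)

lemma ee_add: "ee (s + t) = ee s * ee t"
  by (simp add: ee_def cis_mult algebra_simps)

lemma cnj_ee: "cnj (ee t) = ee (- t)"
  by (simp add: ee_def cis_cnj)

lemma ee_minus_mult: "ee (- t) * ee t = 1"
  using ee_add[of "-t" t] by simp

lemma ee_of_int [simp]: "ee (of_int n) = 1"
  unfolding ee_def by (metis cis_multiple_2pi Ints_of_int mult.commute mult.left_commute)

lemma ee_add_int: "ee (t + of_int n) = ee t"
  by (simp add: ee_add)

lemma nid_nonneg [simp]: "0 \<le> nid t"
  by (simp add: nid_def)

lemma nid_le: "nid t \<le> \<bar>t - of_int k\<bar>"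
  unfolding nid_def by (rule round_diff_minimal)

lemma nid_geI: "(\<And>k. d \<le> \<bar>t - of_int k\<bar>) \<Longrightarrow> d \<le> nid t"
  by (simp add: nid_def)

lemma nid_minus [simp]: "nid (- t) = nid t"
proof -
  have *: "nid (- t) \<le> nid t" for t
    using nid_le[of "-t" "- round t"] by (simp add: nid_def[of t])
  show ?thesis using *[of t] *[of "-t"] by simp
qed

lemma nid_add_int [simp]: "nid (t + of_int k) = nid t"
proof -
  have *: "nid (t + of_int k) \<le> nid t" for t k
    using nid_le[of "t + of_int k" "round t + k"] by (simp add: nid_def[of t])
  show ?thesis using *[of t k] *[of "t + of_int k" "-k"] by simp
qed

lemma nid_lipschitz: "nid s \<le> nid t + \<bar>s - t\<bar>"
  using nid_le[of s "round t"] by (simp add: nid_def[of t])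

lemma nid_le_half: "nid t \<le> 1/2"
  unfolding nid_def using of_int_round_abs_le[of t] by (simp add: abs_minus_commute)

text \<open>Up to pi / 3 the derivative of sine is at least 1/2; beyond that, sine is at least sqrt
  3 / 2 > 4/5, and x / 2 is at most pi / 4 < 4/5. The slope 1/2 is enough for
  \<open>nid_le_norm_1_minus_ee\<close>, where it gives pi times the distance, which is then rounded
  down.\<close>

lemma half_le_sin:
  fixes x :: real
  assumes "0 \<le> x" "x \<le> pi / 2"
  shows "x / 2 \<le> sin x"
proof (cases "x \<le> pi / 3")
  case True
  show ?thesis
  proof (cases "x = 0")
    case False
    then obtain z where z: "0 < z" "z < x" "sin x - sin 0 = (x - 0) * cos z"
      using MVT2[of 0 x sin cos] assms by (auto intro: derivative_eq_intros)
    have "cos (pi / 3) \<le> cos z"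
      using z True pi_gt_zero by (intro cos_monotone_0_pi_le) auto
    then have "x * (1 / 2) \<le> x * cos z"
      using assms by (intro mult_left_mono) (auto simp: cos_60)
    then show ?thesis using z by simp
  qed simp
next
  case False
  have "sin (pi / 3) \<le> sin x"
    using False assms pi_gt_zero by (intro sin_monotone_2pi_le) auto
  moreover have "(8/5) / 2 \<le> sqrt 3 / 2"
    by (intro divide_right_mono real_le_rsqrt) (auto simp: power2_eq_square)
  ultimately have "4/5 \<le> sin x" by (simp add: sin_60)
  moreover have "pi \<le> 16/5" using pi_approx by simp
  ultimately show ?thesis using assms by simp
qed

lemma nid_le_norm_1_minus_ee: "2 * nid t \<le> norm (1 - ee t)"
proof -
  define s where "s = t - of_int (round t)"
  have "ee t = ee s"
    using ee_add_int[of s "round t"] by (simp add: s_def)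
  also have "ee s = ee (s / 2) * ee (s / 2)"
    by (simp flip: ee_add)
  finally have "1 - ee t = ee (s / 2) * (ee (- (s / 2)) - ee (s / 2))"
    using ee_minus_mult[of "s / 2"] by (simp add: algebra_simps)
  then have "norm (1 - ee t) = norm (ee (- (s / 2)) - ee (s / 2))"
    by (simp add: norm_mult)
  also have "ee (- (s / 2)) - ee (s / 2) = - 2 * \<i> * of_real (sin (pi * s))"
    by (simp add: ee_def complex_eq_iff)
  also have "norm \<dots> = 2 * \<bar>sin (pi * s)\<bar>"
    by (simp add: norm_mult)
  finally have 1: "norm (1 - ee t) = 2 * \<bar>sin (pi * s)\<bar>" .
  have "\<bar>sin (pi * s)\<bar> = \<bar>sin (pi * \<bar>s\<bar>)\<bar>"
    by (cases "s \<ge> 0") auto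
  moreover have "\<bar>s\<bar> \<le> 1 / 2" using nid_le_half[of t] by (simp add: nid_def s_def)
  then have "pi * \<bar>s\<bar> \<le> pi * (1 / 2)"
    by (intro mult_left_mono) auto
  then have "pi * \<bar>s\<bar> / 2 \<le> sin (pi * \<bar>s\<bar>)"
    by (intro half_le_sin) auto
  moreover have "2 * \<bar>s\<bar> \<le> pi * \<bar>s\<bar>"
    using pi_gt3 by (intro mult_right_mono) auto
  ultimately show ?thesis using 1 unfolding nid_def s_def[symmetric] by linarith
qed

text \<open>Kept in product form so that it also holds when \<open>\<phi>\<close> is an integer and
  the geometric sum has no closed form.\<close>

lemma nid_mult_geometric_le:
  "nid \<phi> * norm (\<Sum>c=A..<B. ee (\<phi> * real c)) \<le> 1"
proof (cases "A \<le> B")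
  case True
  have "(1 - ee \<phi>) * (\<Sum>c=A..<B. ee (\<phi> * real c)) = ee (\<phi> * real A) - ee (\<phi> * real B)"
    using True
  proof (induction B rule: dec_induct)
    case (step n)
    define S where "S = (\<Sum>c=A..<n. ee (\<phi> * real c))"
    have e: "ee (\<phi> * real (Suc n)) = ee \<phi> * ee (\<phi> * real n)"
      by (simp add: algebra_simps flip: ee_add)
    have IH: "(1 - ee \<phi>) * S = ee (\<phi> * real A) - ee (\<phi> * real n)"
      unfolding S_def by (rule step.IH)
    have "(1 - ee \<phi>) * (S + ee (\<phi> * real n)) =
        (1 - ee \<phi>) * S + (ee (\<phi> * real n) - ee \<phi> * ee (\<phi> * real n))"
      by (simp only: distrib_left left_diff_distrib mult_1_left)
    also have "\<dots> = ee (\<phi> * real A) - ee (\<phi> * real (Suc n))"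
      unfolding IH e by simp
    finally have "(1 - ee \<phi>) * (S + ee (\<phi> * real n)) = ee (\<phi> * real A) - ee (\<phi> * real (Suc n))" .
    then show ?case
      using step.hyps unfolding S_def by (simp only: sum.atLeastLessThan_Suc)
  qed simp
  then have "norm (1 - ee \<phi>) * norm (\<Sum>c=A..<B. ee (\<phi> * real c)) =
      norm (ee (\<phi> * real A) - ee (\<phi> * real B))"
    by (simp only: norm_mult[symmetric])
  also have "\<dots> \<le> 1 + 1"
    by (intro norm_triangle_le_diff) simp
  finally have "norm (1 - ee \<phi>) * norm (\<Sum>c=A..<B. ee (\<phi> * real c)) \<le> 2" by simp
  moreover have "2 * nid \<phi> * norm (\<Sum>c=A..<B. ee (\<phi> * real c))
      \<le> norm (1 - ee \<phi>) * norm (\<Sum>c=A..<B. ee (\<phi> * real c))"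
    by (intro mult_right_mono nid_le_norm_1_minus_ee) auto
  ultimately show ?thesis by linarith
qed simp

lemma cap_nonneg: "0 \<le> Y \<Longrightarrow> 0 \<le> cap Y t"
  by (simp add: cap_def)

lemma cap_le: "0 \<le> Y \<Longrightarrow> cap Y t \<le> Y"
  unfolding cap_def by (simp add: divide_le_eq max_def mult_le_cancel_left1)

lemma cap_mult_nid_le: "0 \<le> Y \<Longrightarrow> cap Y t * nid t \<le> 1"
  unfolding cap_def by (simp add: divide_le_eq max_def)

lemma le_cap:
  assumes "0 \<le> s" "s \<le> Y" "s * nid t \<le> 1"
  shows "s \<le> cap Y t"
proof -
  have "s * (Y * nid t) \<le> Y * 1"
    using assms mult_left_mono[of "s * nid t" 1 Y] by (simp add: mult_ac)
  then have "s * max 1 (Y * nid t) \<le> Y" using assms by (simp add: max_def)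
  moreover have "0 < max 1 (Y * nid t)" by simp
  ultimately show ?thesis unfolding cap_def by (simp only: pos_le_divide_eq)
qed

lemma cap_mono: "0 \<le> Y \<Longrightarrow> Y \<le> Y' \<Longrightarrow> cap Y t \<le> cap Y' t"
  using cap_le[of Y t] cap_mult_nid_le[of Y t] by (intro le_cap cap_nonneg) auto

lemma cap_le_inverse:
  assumes "0 \<le> Y" "0 < d" "d \<le> nid t"
  shows "cap Y t \<le> 1 / d"
proof -
  have "cap Y t * d \<le> cap Y t * nid t"
    using assms by (intro mult_left_mono cap_nonneg)
  then have "cap Y t * d \<le> 1" using cap_mult_nid_le[of Y t] assms by linarith
  then show ?thesis using assms by (simp add: le_divide_eq)
qed

lemma cap_minus [simp]: "cap Y (- t) = cap Y t"
  by (simp add: cap_def)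

lemma geometric_le_cap:
  assumes "B - A \<le> L"
  shows "norm (\<Sum>c=A..<B. ee (\<phi> * real c)) \<le> cap (real L) \<phi>"
proof (rule le_cap)
  have "norm (\<Sum>c=A..<B. ee (\<phi> * real c)) \<le> (\<Sum>c=A..<B. 1)"
    by (intro sum_norm_le) auto
  then show "norm (\<Sum>c=A..<B. ee (\<phi> * real c)) \<le> real L" using assms by simp
  show "norm (\<Sum>c=A..<B. ee (\<phi> * real c)) * nid \<phi> \<le> 1"
    using nid_mult_geometric_le[of \<phi> A B] by (simp add: mult.commute)
qed auto

section \<open>Sums of \<open>cap\<close> along the multiples of a well approximated
  frequency\<close>

lemma sum_inverse_le_ln:
  assumes "q > 0"
  shows "(\<Sum>s\<in>{1..<q}. 1 / real s) \<le> 1 + ln (real q)"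
proof -
  have "(\<Sum>s\<in>{1..<q}. 1 / real s) \<le> (\<Sum>s\<in>{1..q}. 1 / real s)"
    by (intro sum_mono2) auto
  also have "\<dots> \<le> 1 + ln (real q)"
    using assms
  proof (induction q rule: nat_induct_non_zero)
    case (Suc n)
    have "ln (1 + - 1 / real (Suc n)) \<le> - 1 / real (Suc n)"
      using Suc.hyps by (intro ln_add_one_self_le_self2) (auto simp: field_simps)
    moreover have "1 + - 1 / real (Suc n) = real n / real (Suc n)"
      by (simp add: field_simps)
    moreover have "ln (real n / real (Suc n)) = ln (real n) - ln (real (Suc n))"
      using Suc.hyps by (subst ln_div) auto
    ultimately have "1 / real (Suc n) \<le> ln (real (Suc n)) - ln (real n)"
      by (simp only:)
    then show ?case using Suc.IH by simp
  qed simp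
  finally show ?thesis .
qed

lemma nid_fraction_ge:
  assumes "s < q"
  shows "min (real s) (real q - real s) / real q \<le> nid (real s / real q)"
proof (rule nid_geI)
  fix k :: int
  have q: "real q > 0" using assms by simp
  have "min (real s) (real q - real s) \<le> \<bar>real s - real q * of_int k\<bar>"
  proof (cases "k \<le> 0")
    case True
    then have "real q * of_int k \<le> 0" by (simp add: mult_nonneg_nonpos)
    then show ?thesis by simp
  next
    case False
    then have "real q * 1 \<le> real q * of_int k" by (intro mult_left_mono) auto
    then show ?thesis by simp
  qed
  then have "min (real s) (real q - real s) / real q \<le> \<bar>real s - real q * of_int k\<bar> / real q"
    using q by (intro divide_right_mono) auto
  also have "\<dots> = \<bar>(real s - real q * of_int k) / real q\<bar>" by simp
  also have "(real s - real q * of_int k) / real q = real s / real q - of_int k"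
    using q by (simp add: field_simps)
  finally show "min (real s) (real q - real s) / real q \<le> \<bar>real s / real q - of_int k\<bar>" .
qed

text \<open>Up to an error \<open>2 / q\<close>, the points \<open>\<alpha> (n0 + r)\<close> with \<open>r < q\<close> are a permutation of the
  fractions \<open>s / q\<close> modulo 1.\<close>
lemma cap_block:
  fixes q n0 :: nat and a :: int
  assumes q: "q > 0" and cop: "coprime a (int q)"
    and appr: "\<bar>\<alpha> - of_int a / real q\<bar> \<le> 1 / real q ^ 2" and Y: "0 \<le> Y"
  shows "(\<Sum>r<q. cap Y (\<alpha> * real (n0 + r))) \<le> 5 * Y + 6 * real q * (1 + ln (real q))"
proof -
  define u where "u = \<lfloor>real q * \<alpha> * real n0\<rfloor>"
  define s where "s = (\<lambda>r. nat ((u + a * int r) mod int q))"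
  \<comment> \<open>At most five residues lie within 2 of 0 modulo q; there the error 2 / q leaves
    only the trivial bound \<open>Y\<close>. For the others t - 2 is at least t / 3, so a third of
    the distance of s / q survives, and the two harmonic terms cover approach from either
    side.\<close>
  define g where "g = (\<lambda>s. (if s \<le> 2 \<or> q - s \<le> 2 then Y else 0) +
      (if s = 0 then 0 else 3 * real q / real s + 3 * real q / (real q - real s)))"
  have sq: "s r < q" for r unfolding s_def using q by (simp add: nat_less_iff)
  have inj: "inj_on s {..<q}"
  proof (rule inj_onI)
    fix r r' assume r: "r \<in> {..<q}" "r' \<in> {..<q}" "s r = s r'"
    then have "(u + a * int r) mod int q = (u + a * int r') mod int q"
      unfolding s_def using q by (simp add: nat_eq_iff)
    then have "int q dvd a * (int r - int r')"
      by (simp add: mod_eq_dvd_iff algebra_simps)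
    then have "int q dvd int r - int r'"
      using cop by (metis coprime_commute coprime_dvd_mult_right_iff)
    moreover have "\<bar>int r - int r'\<bar> < int q" using r by auto
    ultimately have "int r - int r' = 0" using dvd_imp_le_int[of "int r - int r'" "int q"] by linarith
    then show "r = r'" by simp
  qed
  have pt: "cap Y (\<alpha> * real (n0 + r)) \<le> g (s r)" if r: "r < q" for r
  proof -
    have gpos: "0 \<le> (if s r = 0 then 0 else 3 * real q / real (s r) + 3 * real q / (real q - real (s r)))"
      using sq[of r] by auto
    show ?thesis
    proof (cases "s r \<le> 2 \<or> q - s r \<le> 2")
      case True
      then have "Y \<le> g (s r)" unfolding g_def using gpos by simp
      then show ?thesis using cap_le[OF Y] order_trans by blast
    next
      case False
      then have s3: "s r \<ge> 3" "q - s r \<ge> 3" by auto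
      define t where "t = min (real (s r)) (real q - real (s r))"
      have t3: "t \<ge> 3" unfolding t_def using s3 by auto
      define k where "k = (u + a * int r) div int q"
      have "u + a * int r = int q * k + int (s r)"
        unfolding k_def s_def using q by simp
      then have "real_of_int (u + a * int r) = real_of_int (int q * k + int (s r))"
        by (rule arg_cong)
      then have eq: "of_int u + of_int a * real r = real q * of_int k + real (s r)" by simp
      define E where "E = (\<alpha> * real n0 - of_int u / real q) + real r * (\<alpha> - of_int a / real q)"
      have e1: "\<alpha> * real (n0 + r) = real (s r) / real q + of_int k + E"
      proof -
        have "of_int u / real q + real r * (of_int a / real q) = (of_int u + of_int a * real r) / real q"
          by (simp add: add_divide_distrib mult.commute)
        also have "\<dots> = of_int k + real (s r) / real q"
          unfolding eq using q by (simp add: add_divide_distrib)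
        finally have "of_int u / real q + real r * (of_int a / real q) = of_int k + real (s r) / real q" .
        moreover have "\<alpha> * real (n0 + r) = \<alpha> * real n0 + real r * \<alpha>"
          by (simp add: algebra_simps)
        ultimately show ?thesis unfolding E_def right_diff_distrib by linarith
      qed
      have "\<bar>\<alpha> * real n0 - of_int u / real q\<bar> \<le> 1 / real q"
      proof -
        have "\<bar>real q * \<alpha> * real n0 - of_int u\<bar> \<le> 1" unfolding u_def by linarith
        then have "\<bar>real q * \<alpha> * real n0 - of_int u\<bar> / real q \<le> 1 / real q"
          by (intro divide_right_mono) auto
        moreover have "\<bar>real q * \<alpha> * real n0 - of_int u\<bar> / real q = \<bar>(real q * \<alpha> * real n0 - of_int u) / real q\<bar>"
          by simp
        moreover have "(real q * \<alpha> * real n0 - of_int u) / real q = \<alpha> * real n0 - of_int u / real q"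
          using q by (simp add: field_simps)
        ultimately show ?thesis by simp
      qed
      moreover have "\<bar>real r * (\<alpha> - of_int a / real q)\<bar> \<le> 1 / real q"
      proof -
        have "\<bar>real r * (\<alpha> - of_int a / real q)\<bar> \<le> real q * (1 / real q ^ 2)"
          unfolding abs_mult using appr r by (intro mult_mono) auto
        then show ?thesis using q by (simp add: power2_eq_square)
      qed
      ultimately have E: "\<bar>E\<bar> \<le> 2 / real q" unfolding E_def by (simp add: field_simps)
      have "t / real q \<le> nid (real (s r) / real q)"
        unfolding t_def by (rule nid_fraction_ge[OF sq])
      also have "\<dots> = nid (real (s r) / real q + of_int k)" by simp
      also have "\<dots> \<le> nid (\<alpha> * real (n0 + r)) + \<bar>E\<bar>"
        using nid_lipschitz[of "real (s r) / real q + of_int k" "\<alpha> * real (n0 + r)"] e1 by simp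
      finally have "t / real q - 2 / real q \<le> nid (\<alpha> * real (n0 + r))" using E by linarith
      moreover have "t / (3 * real q) \<le> t / real q - 2 / real q"
        using t3 q by (simp add: field_simps)
      ultimately have "cap Y (\<alpha> * real (n0 + r)) \<le> 1 / (t / (3 * real q))"
        using Y t3 q by (intro cap_le_inverse) auto
      also have "\<dots> = 3 * real q / t" by simp
      also have "\<dots> \<le> 3 * real q / real (s r) + 3 * real q / (real q - real (s r))"
        unfolding t_def using s3 by (auto simp: min_def)
      also have "\<dots> \<le> g (s r)" unfolding g_def using Y s3 by auto
      finally show ?thesis .
    qed
  qed
  have "(\<Sum>r<q. cap Y (\<alpha> * real (n0 + r))) \<le> (\<Sum>r<q. g (s r))"
    by (intro sum_mono pt) auto
  also have "\<dots> = (\<Sum>x\<in>s ` {..<q}. g x)"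
    using sum.reindex[OF inj, of g] by simp
  also have "\<dots> \<le> (\<Sum>x<q. g x)"
    using sq Y by (intro sum_mono2) (auto simp: g_def)
  also have "\<dots> = (\<Sum>x<q. if x \<le> 2 \<or> q - x \<le> 2 then Y else 0) +
      (\<Sum>x<q. if x = 0 then 0 else 3 * real q / real x + 3 * real q / (real q - real x))"
    unfolding g_def by (rule sum.distrib)
  also have "(\<Sum>x<q. if x \<le> 2 \<or> q - x \<le> 2 then Y else 0) =
      real (card {x. x < q \<and> (x \<le> 2 \<or> q - x \<le> 2)}) * Y"
    by (subst sum.If_cases) (auto simp: Int_def)
  also have "\<dots> \<le> 5 * Y"
  proof -
    have "{x. x < q \<and> (x \<le> 2 \<or> q - x \<le> 2)} \<subseteq> {0, 1, 2, q - 1, q - 2}" by auto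
    then have "card {x. x < q \<and> (x \<le> 2 \<or> q - x \<le> 2)} \<le> card {0, 1, 2, q - 1, q - 2}"
      by (intro card_mono) auto
    also have "\<dots> \<le> 5" by (intro card_insert_le_m1) auto
    finally show ?thesis using Y by (intro mult_right_mono) auto
  qed
  also have "(\<Sum>x<q. if x = 0 then 0 else 3 * real q / real x + 3 * real q / (real q - real x)) =
      (\<Sum>x\<in>{1..<q}. 3 * real q / real x + 3 * real q / (real q - real x))"
    by (intro sum.mono_neutral_cong_right) auto
  also have "\<dots> = 3 * real q * (\<Sum>x\<in>{1..<q}. 1 / real x) + 3 * real q * (\<Sum>x\<in>{1..<q}. 1 / (real q - real x))"
    by (simp add: sum.distrib sum_distrib_left)
  also have "(\<Sum>x\<in>{1..<q}. 1 / (real q - real x)) = (\<Sum>x\<in>{1..<q}. 1 / real x)"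
    by (rule sum.reindex_bij_witness[of _ "\<lambda>x. q - x" "\<lambda>x. q - x"]) (auto simp: of_nat_diff)
  also have "3 * real q * (\<Sum>x\<in>{1..<q}. 1 / real x) + 3 * real q * (\<Sum>x\<in>{1..<q}. 1 / real x)
      \<le> 3 * real q * (1 + ln (real q)) + 3 * real q * (1 + ln (real q))"
    using q by (intro add_mono mult_left_mono sum_inverse_le_ln) auto
  finally show ?thesis by (simp add: algebra_simps)
qed

text \<open>The first factor bounds the number of blocks of q consecutive integers needed to cover
  0..X, the second is the cost of one block by \<open>cap_block\<close>.\<close>

definition cap_sum_bound :: "nat \<Rightarrow> real \<Rightarrow> real \<Rightarrow> real" where
  "cap_sum_bound q X Y = (X / real q + 1) * (5 * Y + 6 * real q * (1 + ln (real q)))"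

lemma cap_sum_le:
  fixes q X :: nat and a :: int
  assumes q: "q > 0" and cop: "coprime a (int q)"
    and appr: "\<bar>\<alpha> - of_int a / real q\<bar> \<le> 1 / real q ^ 2" and Y: "0 \<le> Y"
  shows "(\<Sum>n=1..X. cap Y (\<alpha> * real n)) \<le> cap_sum_bound q (real X) Y"
proof -
  define K where "K = X div q + 1"
  define B where "B = 5 * Y + 6 * real q * (1 + ln (real q))"
  have B: "B \<ge> 0" unfolding B_def using Y q by simp
  have XK: "X < K * q"
    unfolding K_def using dividend_less_times_div[OF q, of X] by (simp add: algebra_simps)
  have "(\<Sum>n=1..X. cap Y (\<alpha> * real n)) \<le> (\<Sum>n<K * q. cap Y (\<alpha> * real n))"
    using XK Y by (intro sum_mono2) (auto intro: cap_nonneg)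
  also have "\<dots> = (\<Sum>m<K. \<Sum>n=m * q..<m * q + q. cap Y (\<alpha> * real n))"
    by (rule sum.nat_group[symmetric])
  also have "\<dots> = (\<Sum>m<K. \<Sum>r<q. cap Y (\<alpha> * real (m * q + r)))"
    using sum.shift_bounds_nat_ivl[of "\<lambda>n. cap Y (\<alpha> * real n)" 0 "m * q" q for m]
    by (simp add: add.commute lessThan_atLeast0)
  also have "\<dots> \<le> (\<Sum>m<K. B)"
    unfolding B_def by (intro sum_mono cap_block[OF q cop appr Y])
  also have "\<dots> = real K * B" by simp
  also have "\<dots> \<le> (real X / real q + 1) * B"
    unfolding K_def using B of_nat_div_le_of_nat[of X q, where ?'a = real] by (intro mult_right_mono) auto
  finally show ?thesis unfolding cap_sum_bound_def B_def .
qed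

section \<open>Weyl differencing\<close>

text \<open>Sorting the off-diagonal products by the difference h of the indices serves twice: for
  differencing quadratic phases and for the Fourier expansion of Fejer's kernel.\<close>

lemma norm_sum_square:
  fixes z :: "nat \<Rightarrow> complex"
  shows "norm (\<Sum>c<L. z c) ^ 2 =
    (\<Sum>c<L. norm (z c) ^ 2) + 2 * Re (\<Sum>h=1..<L. \<Sum>c<L - h. z (c + h) * cnj (z c))"
proof (induction L)
  case (Suc L)
  define S where "S = (\<Sum>c<L. z c)"
  have "norm (S + z L) ^ 2 = norm S ^ 2 + norm (z L) ^ 2 + 2 * Re (z L * cnj S)"
    unfolding cmod_power2 by (simp add: power2_eq_square algebra_simps)
  moreover have "(\<Sum>h=1..<Suc L. \<Sum>c<Suc L - h. z (c + h) * cnj (z c)) =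
      (\<Sum>h=1..<L. \<Sum>c<L - h. z (c + h) * cnj (z c)) + z L * cnj S"
  proof -
    have "(\<Sum>h=1..<Suc L. \<Sum>c<Suc L - h. z (c + h) * cnj (z c)) =
        (\<Sum>h=1..<Suc L. (\<Sum>c<L - h. z (c + h) * cnj (z c)) + z L * cnj (z (L - h)))"
      by (intro sum.cong refl) (simp add: Suc_diff_le)
    also have "\<dots> = (\<Sum>h=1..<Suc L. \<Sum>c<L - h. z (c + h) * cnj (z c)) +
        (\<Sum>h=1..<Suc L. z L * cnj (z (L - h)))"
      by (rule sum.distrib)
    also have "(\<Sum>h=1..<Suc L. z L * cnj (z (L - h))) = (\<Sum>c<L. z L * cnj (z c))"
      by (rule sum.reindex_bij_witness[of _ "\<lambda>c. L - c" "\<lambda>h. L - h"]) auto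
    also have "\<dots> = z L * cnj S" by (simp add: S_def sum_distrib_left)
    also have "(\<Sum>h=1..<Suc L. \<Sum>c<L - h. z (c + h) * cnj (z c)) =
        (\<Sum>h=1..<L. \<Sum>c<L - h. z (c + h) * cnj (z c))"
      by (rule sum.mono_neutral_right) auto
    finally show ?thesis .
  qed
  ultimately show ?case using Suc by (simp add: S_def)
qed simp

text \<open>For a fixed difference h the quadratic phases of c + h and c differ by a linear phase of
  slope 2 h \<open>\<theta>\<close>, so each inner sum is geometric.\<close>

lemma weyl_square:
  "norm (\<Sum>c=A..<A + L. ee (\<theta> * real c ^ 2)) ^ 2 \<le>
    real L + 2 * (\<Sum>h=1..L. cap (real L) (\<theta> * real (2 * h)))"
proof -
  define z where "z = (\<lambda>c. ee (\<theta> * real (A + c) ^ 2))"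
  have inner: "norm (\<Sum>c<L - h. z (c + h) * cnj (z c)) \<le> cap (real L) (\<theta> * real (2 * h))" for h
  proof -
    have "z (c + h) * cnj (z c) = ee (\<theta> * (real h ^ 2 + 2 * real A * real h)) * ee (\<theta> * real (2 * h) * real c)" for c
      unfolding z_def cnj_ee ee_add[symmetric]
      by (rule arg_cong[where f = ee]) (simp add: algebra_simps power2_eq_square)
    then have "(\<Sum>c<L - h. z (c + h) * cnj (z c)) =
        ee (\<theta> * (real h ^ 2 + 2 * real A * real h)) * (\<Sum>c=0..<L - h. ee (\<theta> * real (2 * h) * real c))"
      unfolding sum_distrib_left lessThan_atLeast0 by (rule sum.cong[OF refl])
    then have "norm (\<Sum>c<L - h. z (c + h) * cnj (z c)) = norm (\<Sum>c=0..<L - h. ee (\<theta> * real (2 * h) * real c))"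
      by (simp only: norm_mult norm_ee mult_1_left)
    also have "\<dots> \<le> cap (real L) (\<theta> * real (2 * h))"
      by (rule geometric_le_cap) simp
    finally show ?thesis .
  qed
  have eq: "(\<Sum>c=A..<A + L. ee (\<theta> * real c ^ 2)) = (\<Sum>c<L. z c)"
    using sum.shift_bounds_nat_ivl[of "\<lambda>c. ee (\<theta> * real c ^ 2)" 0 A L]
    unfolding z_def by (simp only: add_0 add_0_right add.commute[of _ A] lessThan_atLeast0)
  have "norm (\<Sum>c<L. z c) ^ 2 = (\<Sum>c<L. norm (z c) ^ 2) +
      2 * Re (\<Sum>h=1..<L. \<Sum>c<L - h. z (c + h) * cnj (z c))"
    by (rule norm_sum_square)
  moreover have "(\<Sum>c<L. norm (z c) ^ 2) = real L" by (simp add: z_def)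
  moreover have "Re (\<Sum>h=1..<L. \<Sum>c<L - h. z (c + h) * cnj (z c)) \<le> (\<Sum>h=1..L. cap (real L) (\<theta> * real (2 * h)))"
  proof -
    have "Re (\<Sum>h=1..<L. \<Sum>c<L - h. z (c + h) * cnj (z c)) \<le> norm (\<Sum>h=1..<L. \<Sum>c<L - h. z (c + h) * cnj (z c))"
      by (rule complex_Re_le_cmod)
    also have "\<dots> \<le> (\<Sum>h=1..<L. cap (real L) (\<theta> * real (2 * h)))"
      by (intro sum_norm_le inner)
    also have "\<dots> \<le> (\<Sum>h=1..L. cap (real L) (\<theta> * real (2 * h)))"
      by (intro sum_mono2) (auto intro: cap_nonneg)
    finally show ?thesis .
  qed
  ultimately show ?thesis unfolding eq by linarith
qed

section \<open>Divisors and the Vaughan identity\<close>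

lemma card_divisors_prime_power_mult_le:
  fixes p k m :: nat
  assumes p: "prime p" and m: "m > 0"
  shows "card {d. d dvd p ^ k * m} \<le> (k + 1) * card {d. d dvd m}"
proof -
  have "{d. d dvd p ^ k * m} \<subseteq> (\<lambda>(i, e). p ^ i * e) ` ({..k} \<times> {d. d dvd m})"
  proof
    fix d assume "d \<in> {d. d dvd p ^ k * m}"
    then obtain x y where d: "d = x * y" "x dvd p ^ k" "y dvd m"
      by (auto elim: dvd_productE)
    then obtain i where "i \<le> k" "x = p ^ i" using divides_primepow_nat[OF p] by blast
    then show "d \<in> (\<lambda>(i, e). p ^ i * e) ` ({..k} \<times> {d. d dvd m})"
      using d by force
  qed
  then have "card {d. d dvd p ^ k * m} \<le> card ({..k} \<times> {d. d dvd m})"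
    using m by (intro surj_card_le) (auto simp: finite_divisors_nat)
  then show ?thesis by (simp add: card_cartesian_product)
qed

text \<open>A prime power p^k in n contributes a factor k + 1. Once p \<ge> 2 powr (1 / \<epsilon>)
  this is at most 2^k and hence at most p powr (k \<epsilon>). Each of the fewer than
  \<open>P\<close> smaller primes costs an extra constant \<open>A\<close>, so \<open>A ^ P\<close>
  absorbs them all. The induction removes one full prime power at a time.\<close>

lemma divisor_bound:
  fixes \<epsilon> :: real
  assumes \<epsilon>: "\<epsilon> > 0"
  obtains C where "C \<ge> 1" "\<And>n. n > 0 \<Longrightarrow> real (card {d. d dvd n}) \<le> C * real n powr \<epsilon>"
proof -
  \<comment> \<open>This is the least \<open>A \<ge> 1\<close> with
    \<open>A * \<epsilon> * ln 2 \<ge> 1\<close>, so that k + 1 \<le> A (1 + k \<epsilon> ln 2), and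
    the bracket is at most 2 powr (k \<epsilon>) by convexity of exp.\<close>
  define A where "A = max 1 (1 / (\<epsilon> * ln 2))"
  define P where "P = nat \<lceil>2 powr (1 / \<epsilon>)\<rceil>"
  have A1: "A \<ge> 1" by (simp add: A_def)
  have A: "real k + 1 \<le> A * 2 powr (real k * \<epsilon>)" for k
  proof -
    have "1 \<le> A * (\<epsilon> * ln 2)"
    proof -
      have "1 / (\<epsilon> * ln 2) * (\<epsilon> * ln 2) \<le> A * (\<epsilon> * ln 2)"
        unfolding A_def using \<epsilon> by (intro mult_right_mono) auto
      then show ?thesis using \<epsilon> by simp
    qed
    then have "real k * 1 \<le> real k * (A * (\<epsilon> * ln 2))" by (intro mult_left_mono) auto
    then have "real k + 1 \<le> A * (1 + real k * \<epsilon> * ln 2)" using A1 by (simp add: algebra_simps)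
    also have "\<dots> \<le> A * 2 powr (real k * \<epsilon>)"
      using A1 exp_ge_add_one_self[of "real k * \<epsilon> * ln 2"]
      by (intro mult_left_mono) (auto simp: powr_def)
    finally show ?thesis .
  qed
  have large: "real k + 1 \<le> real p powr (real k * \<epsilon>)" if "p \<ge> P" for p k
  proof -
    have "2 powr (1 / \<epsilon>) \<le> real p" using that unfolding P_def by linarith
    then have "(2 powr (1 / \<epsilon>)) powr (real k * \<epsilon>) \<le> real p powr (real k * \<epsilon>)"
      using \<epsilon> by (intro powr_mono2) auto
    moreover have "(2 powr (1 / \<epsilon>)) powr (real k * \<epsilon>) = 2 ^ k"
      using \<epsilon> by (simp add: powr_powr powr_realpow)
    moreover have "real k + 1 \<le> 2 ^ k"
      by (induction k) auto
    ultimately show ?thesis by linarith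
  qed
  define s where "s = (\<lambda>n. {p. prime p \<and> p dvd n \<and> p < P})"
  have fin: "finite (s n)" for n unfolding s_def by (rule finite_subset[of _ "{..<P}"]) auto
  have main: "real (card {d. d dvd n}) \<le> A ^ card (s n) * real n powr \<epsilon>" if "n > 0" for n :: nat
    using that
  proof (induction n rule: less_induct)
    case (less n)
    show ?case
    proof (cases "n = 1")
      case True
      then show ?thesis using A1 by simp
    next
      case False
      then obtain p where p: "prime p" "p dvd n" using prime_factor_nat by blast
      define k where "k = multiplicity p n"
      obtain m where m: "n = p ^ k * m" "\<not> p dvd m"
        unfolding k_def using multiplicity_decompose'[of n p] less.prems p
        by (metis not_prime_unit neq0_conv)
      have k: "k > 0" unfolding k_def using p less.prems by (simp add: prime_multiplicity_gt_zero_iff)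
      have m0: "m > 0" using m less.prems by (cases m) auto
      have "p ^ 1 \<le> p ^ k" using k p prime_gt_0_nat by (intro power_increasing) (auto simp: Suc_leI)
      then have "p ^ k > 1" using prime_gt_1_nat[OF p(1)] by simp
      then have mn: "m < n" using m m0 by simp
      have kp: "(real k + 1) * A ^ card (s m) \<le> real p powr (real k * \<epsilon>) * A ^ card (s n)"
      proof (cases "p < P")
        case True
        have "s n = insert p (s m)" unfolding s_def using p m k True
          by (auto simp: prime_dvd_mult_iff prime_dvd_power_iff primes_dvd_imp_eq)
        moreover have "p \<notin> s m" using m by (simp add: s_def)
        ultimately have c: "card (s n) = Suc (card (s m))" using fin by simp
        have "real k + 1 \<le> A * 2 powr (real k * \<epsilon>)" by (rule A)
        also have "\<dots> \<le> A * real p powr (real k * \<epsilon>)"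
          using A1 \<epsilon> prime_ge_2_nat[OF p(1)] by (intro mult_left_mono powr_mono2) auto
        finally have "(real k + 1) * A ^ card (s m) \<le> A * real p powr (real k * \<epsilon>) * A ^ card (s m)"
          using A1 by (intro mult_right_mono) auto
        then show ?thesis unfolding c by (simp add: mult_ac)
      next
        case False
        have "s n = s m" unfolding s_def using p m k False
          by (auto simp: prime_dvd_mult_iff prime_dvd_power_iff dest: primes_dvd_imp_eq)
        then show ?thesis using large[of p k] False A1 by (auto intro!: mult_right_mono)
      qed
      have "real (card {d. d dvd n}) \<le> real ((k + 1) * card {d. d dvd m})"
        unfolding m(1) of_nat_le_iff by (rule card_divisors_prime_power_mult_le[OF p(1) m0])
      then have "real (card {d. d dvd n}) \<le> (real k + 1) * real (card {d. d dvd m})" by (simp add: distrib_right)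
      also have "\<dots> \<le> (real k + 1) * (A ^ card (s m) * real m powr \<epsilon>)"
        using less.IH[OF mn m0] by (intro mult_left_mono) auto
      also have "\<dots> = ((real k + 1) * A ^ card (s m)) * real m powr \<epsilon>" by simp
      also have "\<dots> \<le> (real p powr (real k * \<epsilon>) * A ^ card (s n)) * real m powr \<epsilon>"
        using kp by (intro mult_right_mono) auto
      also have "\<dots> = A ^ card (s n) * real n powr \<epsilon>"
        using prime_gt_0_nat[OF p(1)] m0 unfolding m(1)
        by (simp add: powr_mult powr_powr flip: powr_realpow)
      finally show ?thesis .
    qed
  qed
  show ?thesis
  proof
    show "1 \<le> A ^ P" using A1 by simp
    fix n :: nat assume "n > 0"
    have "card (s n) \<le> card {..<P}" by (intro card_mono) (auto simp: s_def)
    then have "A ^ card (s n) * real n powr \<epsilon> \<le> A ^ P * real n powr \<epsilon>"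
      using A1 by (intro mult_right_mono power_increasing) auto
    then show "real (card {d. d dvd n}) \<le> A ^ P * real n powr \<epsilon>"
      using main[OF \<open>n > 0\<close>] by linarith
  qed
qed

section \<open>Quadruples with equal sums of two squares\<close>

text \<open>From n = (a + c) (a - c), the divisor a + c of n determines the cofactor a - c and with
  it the pair.\<close>

lemma square_difference_inj:
  fixes n :: nat
  assumes n: "n > 0"
  shows "inj_on (\<lambda>(a, c). a + c) {(a, c). a ^ 2 = c ^ 2 + n}"
    and "(\<lambda>(a, c). a + c) ` {(a, c). a ^ 2 = c ^ 2 + n} \<subseteq> {d. d dvd n}"
proof -
  have *: "c < a \<and> n = (a + c) * (a - c)" if "a ^ 2 = c ^ 2 + n" for a c
  proof -
    have "c ^ 2 < a ^ 2" using that n by simp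
    then have "c < a" by (rule power_less_imp_less_base) simp
    moreover have "(a + c) * (a - c) = a ^ 2 - c ^ 2"
      using \<open>c < a\<close> by (auto simp: power2_eq_square algebra_simps dest!: less_imp_Suc_add)
    ultimately show ?thesis using that by simp
  qed
  show "inj_on (\<lambda>(a, c). a + c) {(a, c). a ^ 2 = c ^ 2 + n}"
  proof (intro inj_onI, clarify)
    fix a c a' c' :: nat
    assume h: "a ^ 2 = c ^ 2 + n" "a' ^ 2 = c' ^ 2 + n" "a + c = a' + c'"
    then have "(a + c) * (a - c) = (a + c) * (a' - c')" using * by metis
    moreover have "a + c \<noteq> 0" using *[OF h(1)] by simp
    ultimately have "a - c = a' - c'" by (metis mult_cancel_left)
    then show "a = a' \<and> c = c'" using *[OF h(1)] *[OF h(2)] h(3) by linarith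
  qed
  show "(\<lambda>(a, c). a + c) ` {(a, c). a ^ 2 = c ^ 2 + n} \<subseteq> {d. d dvd n}"
    using * by (auto intro: dvdI)
qed

lemma finite_square_difference: "n > 0 \<Longrightarrow> finite {(a, c). a ^ 2 = c ^ 2 + (n::nat)}"
  using square_difference_inj[of n] finite_divisors_nat[of n]
  by (meson finite_imageD finite_subset)

lemma card_square_difference_le:
  "n > 0 \<Longrightarrow> card {(a, c). a ^ 2 = c ^ 2 + (n::nat)} \<le> card {d. d dvd n}"
  using square_difference_inj[of n] finite_divisors_nat[of n]
  by (intro card_inj_on_le[where f = "\<lambda>(a, c). a + c"]) auto

text \<open>The additive energy of the squares of \<open>P\<close>. It is real valued because it is
  compared with a fourth moment of exponential sums.\<close>

definition square_quads :: "nat set \<Rightarrow> real" where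
  "square_quads P = (\<Sum>a\<in>P. \<Sum>b\<in>P. \<Sum>c\<in>P. \<Sum>d\<in>P. if a ^ 2 + b ^ 2 = c ^ 2 + d ^ 2 then 1 else 0)"

text \<open>If a = c then b = d, which gives at most x^2 quadruples. Otherwise n = a^2 - c^2 (up to
  exchanging the roles of a and c) is a nonzero difference of squares, and the pairs (d, b) with d^2
  - b^2 = n inject into the divisors of n.\<close>

lemma square_quads_bound:
  fixes \<epsilon> :: real
  assumes \<epsilon>: "\<epsilon> > 0"
  obtains C where "C > 0" "\<And>x P. P \<subseteq> {1..x} \<Longrightarrow> square_quads P \<le> C * real x powr (2 + \<epsilon>)"
proof -
  \<comment> \<open>The exponent is halved because n may be as large as x^2.\<close>
  obtain C where C: "C \<ge> 1" "\<And>n. n > 0 \<Longrightarrow> real (card {d. d dvd n}) \<le> C * real n powr (\<epsilon> / 2)"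
    using divisor_bound[of "\<epsilon> / 2"] \<epsilon> by auto
  have "square_quads P \<le> (2 * C) * real x powr (2 + \<epsilon>)" if P: "P \<subseteq> {1..x}" for x P
  proof -
    have fP: "finite P" using P finite_subset by blast
    define D where "D = C * real x powr \<epsilon>"
    have D0: "D \<ge> 0" unfolding D_def using C by simp
    have cP: "card P \<le> x" using card_mono[OF _ P] by simp
    have pos: "(\<Sum>b\<in>P. \<Sum>d\<in>P. if a ^ 2 + b ^ 2 = c ^ 2 + d ^ 2 then 1 else 0) \<le> D"
      if a: "a \<in> P" and c: "c \<in> P" and ca: "c < a" for a c
    proof -
      define n where "n = a ^ 2 - c ^ 2"
      have "c ^ 2 < a ^ 2" using ca by (intro power_strict_mono) auto
      then have n: "n > 0" "a ^ 2 = c ^ 2 + n" by (auto simp: n_def)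
      have "n \<le> x ^ 2" using n(2) a P power_mono[of a x 2] by auto
      then have nx: "real n \<le> real x ^ 2" by (metis of_nat_le_iff of_nat_power)
      have "(\<Sum>b\<in>P. \<Sum>d\<in>P. if a ^ 2 + b ^ 2 = c ^ 2 + d ^ 2 then 1 else 0) =
          (\<Sum>z\<in>P \<times> P. if a ^ 2 + fst z ^ 2 = c ^ 2 + snd z ^ 2 then 1 else (0::real))"
        by (simp add: sum.cartesian_product case_prod_unfold)
      also have "\<dots> = real (card {z \<in> P \<times> P. a ^ 2 + fst z ^ 2 = c ^ 2 + snd z ^ 2})"
        using fP by (simp add: sum.If_cases Int_def)
      also have "card {z \<in> P \<times> P. a ^ 2 + fst z ^ 2 = c ^ 2 + snd z ^ 2} \<le> card {(d, b). d ^ 2 = b ^ 2 + n}"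
        using finite_square_difference[OF n(1)] n(2)
        by (intro card_inj_on_le[where f = "\<lambda>(b, d). (d, b)"]) (auto simp: inj_on_def)
      also have "\<dots> \<le> card {d. d dvd n}" by (rule card_square_difference_le[OF n(1)])
      also have "real \<dots> \<le> C * real n powr (\<epsilon> / 2)" by (rule C(2)[OF n(1)])
      also have "\<dots> \<le> C * (real x ^ 2) powr (\<epsilon> / 2)"
        using C(1) \<epsilon> nx by (intro mult_left_mono powr_mono2) auto
      also have "(real x ^ 2) powr (\<epsilon> / 2) = real x powr \<epsilon>"
        using a P by (simp add: powr_powr flip: powr_numeral)
      finally show ?thesis unfolding D_def by simp
    qed
    have le: "(\<Sum>b\<in>P. \<Sum>d\<in>P. if a ^ 2 + b ^ 2 = c ^ 2 + d ^ 2 then 1 else 0) \<le> (if a = c then real x else D)"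
      if a: "a \<in> P" and c: "c \<in> P" for a c
    proof -
      consider "a = c" | "c < a" | "a < c" by linarith
      then show ?thesis
      proof cases
        case 1
        have "(\<Sum>b\<in>P. \<Sum>d\<in>P. if a ^ 2 + b ^ 2 = c ^ 2 + d ^ 2 then 1 else 0) = (\<Sum>b\<in>P. \<Sum>d\<in>P. if b = d then 1 else (0::real))"
          unfolding 1 by (intro sum.cong refl) auto
        also have "\<dots> = real (card P)" using fP by simp
        finally show ?thesis using 1 cP by simp
      next
        case 2
        then show ?thesis using pos[OF a c] by simp
      next
        case 3
        have "(\<Sum>b\<in>P. \<Sum>d\<in>P. if a ^ 2 + b ^ 2 = c ^ 2 + d ^ 2 then 1 else 0) =
            (\<Sum>b\<in>P. \<Sum>d\<in>P. if c ^ 2 + b ^ 2 = a ^ 2 + d ^ 2 then 1 else (0::real))"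
          by (subst sum.swap) (intro sum.cong refl, auto)
        then show ?thesis using 3 pos[OF c a] by simp
      qed
    qed
    have "square_quads P = (\<Sum>a\<in>P. \<Sum>c\<in>P. \<Sum>b\<in>P. \<Sum>d\<in>P. if a ^ 2 + b ^ 2 = c ^ 2 + d ^ 2 then 1 else 0)"
      unfolding square_quads_def by (intro sum.cong refl sum.swap)
    also have "\<dots> \<le> (\<Sum>a\<in>P. \<Sum>c\<in>P. if a = c then real x else D)"
      by (intro sum_mono le)
    also have "\<dots> \<le> (\<Sum>a\<in>P. \<Sum>c\<in>P. (if a = c then real x else 0) + D)"
      using D0 by (intro sum_mono) auto
    also have "\<dots> = real (card P) * real x + real (card P) * real (card P) * D"
      using fP by (simp add: sum.distrib distrib_left)
    also have "\<dots> \<le> real x * real x + real x * real x * D"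
      using cP D0 by (intro add_mono mult_mono mult_nonneg_nonneg) auto
    also have "\<dots> \<le> (2 * C) * real x powr (2 + \<epsilon>)"
    proof (cases "x = 0")
      case False
      have "1 \<le> D" unfolding D_def using C(1) False ge_one_powr_ge_zero[of "real x" \<epsilon>] \<epsilon>
          mult_mono[of 1 C 1 "real x powr \<epsilon>"] by simp
      then have "real x * real x * 1 \<le> real x * real x * D" by (intro mult_left_mono) auto
      moreover have "real x * real x * D = C * real x powr (2 + \<epsilon>)"
        unfolding D_def using False by (simp add: powr_add power2_eq_square mult_ac)
      ultimately show ?thesis by simp
    qed simp
    finally show ?thesis .
  qed
  then show ?thesis using that[of "2 * C"] C(1) by simp
qed

section \<open>Moebius cancellation and Vaughan's identity\<close>

definition moebius_mu :: "nat \<Rightarrow> complex" where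
  "moebius_mu n = (if squarefree n then (-1) ^ card (prime_factors n) else 0)"

lemma norm_moebius_mu_le: "norm (moebius_mu n) \<le> 1"
  by (simp add: moebius_mu_def norm_power)

lemma moebius_mu_prime_mult:
  assumes "prime p" "\<not> p dvd d" "squarefree d"
  shows "squarefree (p * d)" "moebius_mu (p * d) = - moebius_mu d"
proof -
  have d0: "d \<noteq> 0" using assms(2) by (intro notI) simp
  show sf: "squarefree (p * d)"
    using assms by (intro squarefree_mult_coprime) (auto intro: prime_imp_coprime squarefree_prime)
  have "prime_factors (p * d) = insert p (prime_factors d)"
    using assms d0 prime_gt_0_nat[of p] by (auto simp: prime_factors_product prime_prime_factors)
  moreover have "p \<notin> prime_factors d" using assms by auto
  ultimately show "moebius_mu (p * d) = - moebius_mu d"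
    using sf assms by (simp add: moebius_mu_def)
qed

text \<open>Fix a prime p dividing n. On squarefree divisors, d and p d are paired and carry
  opposite signs.\<close>

lemma sum_moebius_mu_divisors:
  assumes "n > 1"
  shows "(\<Sum>d | d dvd n. moebius_mu d) = 0"
proof -
  obtain p where p: "prime p" "p dvd n" using assms prime_factor_nat[of n] by auto
  define S where "S = {d. d dvd n \<and> squarefree d}"
  have fin: "finite {d. d dvd n}" using assms by (intro finite_divisors_nat) simp
  then have finS: "finite S" unfolding S_def by (rule rev_finite_subset) auto
  have "(\<Sum>d | d dvd n. moebius_mu d) = (\<Sum>d\<in>S. moebius_mu d)"
    using fin by (intro sum.mono_neutral_right) (auto simp: S_def moebius_mu_def)
  also have "\<dots> = (\<Sum>d\<in>{d \<in> S. \<not> p dvd d} \<union> {d \<in> S. p dvd d}. moebius_mu d)"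
    by (intro sum.cong) auto
  also have "\<dots> = (\<Sum>d\<in>{d \<in> S. \<not> p dvd d}. moebius_mu d) + (\<Sum>d\<in>{d \<in> S. p dvd d}. moebius_mu d)"
    using finS by (intro sum.union_disjoint) auto
  also have "(\<Sum>d\<in>{d \<in> S. p dvd d}. moebius_mu d) = (\<Sum>d\<in>{d \<in> S. \<not> p dvd d}. - moebius_mu d)"
  proof (rule sum.reindex_bij_witness[of _ "\<lambda>d. p * d" "\<lambda>d. d div p"])
    fix d assume d: "d \<in> {d \<in> S. p dvd d}"
    then obtain e where e: "d = p * e" by auto
    have sf: "squarefree (p * e)" using d e by (simp add: S_def)
    have npe: "\<not> p dvd e"
    proof
      assume "p dvd e"
      then have "p ^ 2 dvd p * e" by (simp add: power2_eq_square)
      then show False using sf p(1) unfolding squarefree_def by auto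
    qed
    have se: "squarefree e" using sf by (rule squarefree_mono[rotated]) simp
    have pd: "d div p = e" using e p(1) prime_gt_0_nat[of p] by simp
    show "p * (d div p) = d" using pd e by simp
    show "d div p \<in> {d \<in> S. \<not> p dvd d}"
      using npe se pd d e by (auto simp: S_def intro: dvd_mult_right)
    show "- moebius_mu (d div p) = moebius_mu d"
      unfolding pd unfolding e using moebius_mu_prime_mult(2)[OF p(1) npe se] by (simp only: minus_minus)
  next
    fix d assume d: "d \<in> {d \<in> S. \<not> p dvd d}"
    then have "p * d dvd n"
      using p by (intro divides_mult) (auto simp: S_def intro: prime_imp_coprime)
    then show "p * d \<in> {d \<in> S. p dvd d}"
      using d moebius_mu_prime_mult[OF p(1)] by (auto simp: S_def)
    show "p * d div p = d" using p(1) prime_gt_0_nat[of p] by simp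
  qed
  finally show ?thesis by (simp add: sum_negf)
qed

lemma sum_divisors_hyperbola:
  fixes F :: "nat \<Rightarrow> nat \<Rightarrow> 'a :: comm_monoid_add"
  shows "(\<Sum>n=1..Y. \<Sum>d | d dvd n. F d (n div d)) = (\<Sum>d=1..Y. \<Sum>j=1..Y div d. F d j)"
proof -
  have "(\<Sum>n=1..Y. \<Sum>d | d dvd n. F d (n div d)) =
      (\<Sum>(n, d)\<in>Sigma {1..Y} (\<lambda>n. {d. d dvd n}). F d (n div d))"
    by (rule sum.Sigma) (auto simp: finite_divisors_nat)
  also have "\<dots> = (\<Sum>(d, j)\<in>Sigma {1..Y} (\<lambda>d. {1..Y div d}). F d j)"
  proof (rule sum.reindex_bij_witness[of _ "\<lambda>(d, j). (d * j, d)" "\<lambda>(n, d). (d, n div d)"])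
    fix a assume "a \<in> Sigma {1..Y} (\<lambda>n. {d. d dvd n})"
    then obtain d j where a: "a = (d * j, d)" "1 \<le> d * j" "d * j \<le> Y" by (auto elim!: dvdE)
    then have dj: "d > 0" "j > 0" by (auto intro!: Nat.gr0I)
    then have "d * 1 \<le> d * j" by (intro mult_le_mono2) auto
    then have "d \<le> Y" using a by linarith
    then show "(case a of (n, d) \<Rightarrow> (d, n div d)) \<in> Sigma {1..Y} (\<lambda>d. {1..Y div d})"
      using a dj by (auto simp: less_eq_div_iff_mult_less_eq mult.commute)
  qed (auto simp: less_eq_div_iff_mult_less_eq mult.commute)
  also have "\<dots> = (\<Sum>d=1..Y. \<Sum>j=1..Y div d. F d j)"
    by (rule sum.Sigma[symmetric]) auto
  finally show ?thesis .
qed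

text \<open>Both sides run over the pairs with c d \<le> Y, a region symmetric in c and d.\<close>

lemma sum_hyperbola_swap:
  fixes G :: "nat \<Rightarrow> nat \<Rightarrow> 'a :: comm_monoid_add"
  shows "(\<Sum>c=1..Y. \<Sum>d=1..Y div c. G c d) = (\<Sum>d=1..Y. \<Sum>c=1..Y div d. G c d)"
proof -
  have "(\<Sum>c=1..Y. \<Sum>d=1..Y div c. G c d) = (\<Sum>(c, d)\<in>Sigma {1..Y} (\<lambda>c. {1..Y div c}). G c d)"
    by (rule sum.Sigma) auto
  also have "\<dots> = (\<Sum>(d, c)\<in>Sigma {1..Y} (\<lambda>d. {1..Y div d}). G c d)"
  proof (rule sum.reindex_bij_witness[of _ "\<lambda>(d, c). (c, d)" "\<lambda>(c, d). (d, c)"])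
    have *: "d \<le> Y \<and> c \<le> Y div d" if "1 \<le> c" "1 \<le> d" "d \<le> Y div c" for c d
    proof -
      have "d * c \<le> Y" using that by (simp add: less_eq_div_iff_mult_less_eq)
      moreover have "d * 1 \<le> d * c" using that by (intro mult_le_mono2)
      ultimately have "d \<le> Y" "d * c \<le> Y" by linarith+
      then show ?thesis using that
        by (auto simp: less_eq_div_iff_mult_less_eq mult.commute)
    qed
    show "(case a of (c, d) \<Rightarrow> (d, c)) \<in> Sigma {1..Y} (\<lambda>d. {1..Y div d})"
      if "a \<in> Sigma {1..Y} (\<lambda>c. {1..Y div c})" for a using that *[of "fst a" "snd a"] by (cases a) simp
    show "(case a of (d, c) \<Rightarrow> (c, d)) \<in> Sigma {1..Y} (\<lambda>d. {1..Y div d})"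
      if "a \<in> Sigma {1..Y} (\<lambda>c. {1..Y div c})" for a using that *[of "fst a" "snd a"] by (cases a) simp
  qed auto
  also have "\<dots> = (\<Sum>d=1..Y. \<Sum>c=1..Y div d. G c d)"
    by (rule sum.Sigma[symmetric]) auto
  finally show ?thesis .
qed

text \<open>With \<open>*\<close> for Dirichlet convolution and \<open>\<beta>\<close> for this coefficient, \<open>\<mu>\<^sub>\<le>\<^sub>U * 1 + \<beta>\<close> is the unit, so
  \<open>\<Lambda>\<^sub>>\<^sub>U = \<Lambda>\<^sub>>\<^sub>U * \<mu>\<^sub>\<le>\<^sub>U * 1 + \<Lambda>\<^sub>>\<^sub>U * \<beta>\<close>, where moreover \<open>\<Lambda>\<^sub>>\<^sub>U * 1 = ln - \<Lambda>\<^sub>\<le>\<^sub>U * 1\<close>.\<close>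
definition vaughan_coeff :: "nat \<Rightarrow> nat \<Rightarrow> complex" where
  "vaughan_coeff U k = (if k = 1 then 1 else 0) - (\<Sum>d | d dvd k. if d \<le> U then moebius_mu d else 0)"

text \<open>Every divisor of such a k survives the truncation, so the full Moebius sum appears.
  Consequently both variables of the bilinear sum exceed U, and this is the source of its
  saving.\<close>

lemma vaughan_coeff_eq_0:
  assumes "1 \<le> k" "k \<le> U"
  shows "vaughan_coeff U k = 0"
proof -
  have "(\<Sum>d | d dvd k. if d \<le> U then moebius_mu d else 0) = (\<Sum>d | d dvd k. moebius_mu d)"
    using assms by (intro sum.cong refl) (auto dest!: dvd_imp_le)
  then show ?thesis
    using assms sum_moebius_mu_divisors[of k]
    by (cases "k = 1") (auto simp: vaughan_coeff_def moebius_mu_def)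
qed

lemma norm_vaughan_coeff_le:
  assumes "1 \<le> k"
  shows "norm (vaughan_coeff U k) \<le> 2 * real (card {d. d dvd k})"
proof -
  have "norm (\<Sum>d | d dvd k. if d \<le> U then moebius_mu d else 0) \<le> (\<Sum>d | d dvd k. 1)"
    by (intro sum_norm_le) (auto simp: norm_moebius_mu_le)
  then have "norm (\<Sum>d | d dvd k. if d \<le> U then moebius_mu d else 0) \<le> real (card {d. d dvd k})"
    by simp
  moreover have "norm (vaughan_coeff U k) \<le>
      norm (if k = 1 then 1 else 0 :: complex) + norm (\<Sum>d | d dvd k. if d \<le> U then moebius_mu d else 0)"
    unfolding vaughan_coeff_def by (rule norm_triangle_ineq4)
  moreover have "norm (if k = 1 then 1 else 0 :: complex) \<le> 1" by simp
  moreover have "card {1::nat} \<le> card {d. d dvd k}" using assms by (intro card_mono finite_divisors_nat) auto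
  then have "1 \<le> real (card {d. d dvd k})" by simp
  ultimately show ?thesis by linarith
qed

text \<open>The three terms have different natures: a range n \<le> U for trivial bounds, a type I
  sum whose last variable runs freely over an interval behind an outer factor d or d c of size at
  most U^2, and a type II sum with unspecified coefficients but both variables above U.\<close>

lemma vaughan_identity:
  fixes f :: "nat \<Rightarrow> complex" and U y :: nat
  defines "\<mu> \<equiv> \<lambda>d. if d \<le> U then moebius_mu d else 0"
    and "lo \<equiv> \<lambda>c. if c \<le> U then mangoldt c else (0::complex)"
    and "hi \<equiv> \<lambda>c. if c \<le> U then 0 else (mangoldt c::complex)"
  shows "(\<Sum>n=1..y. mangoldt n * f n) = (\<Sum>n=1..y. lo n * f n) +
    (\<Sum>d=1..y. \<mu> d * ((\<Sum>m=1..y div d. of_real (ln (real m)) * f (d * m)) -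
       (\<Sum>c=1..y div d. lo c * (\<Sum>j=1..y div d div c. f (d * c * j))))) +
    (\<Sum>c=1..y. hi c * (\<Sum>k=1..y div c. vaughan_coeff U k * f (c * k)))"
proof -
  have lohi: "mangoldt c = lo c + hi c" for c by (simp add: lo_def hi_def)
  have inner: "(\<Sum>k=1..y div c. vaughan_coeff U k * f (c * k)) =
      f c - (\<Sum>d=1..y div c. \<Sum>j=1..y div c div d. \<mu> d * f (c * d * j))" if c: "c \<in> {1..y}" for c
  proof -
    have "(\<Sum>k=1..y div c. vaughan_coeff U k * f (c * k)) =
        (\<Sum>k=1..y div c. (if k = 1 then f c else 0) - (\<Sum>d | d dvd k. \<mu> d * f (c * (d * (k div d)))))"
      by (intro sum.cong refl) (auto simp: vaughan_coeff_def \<mu>_def sum_distrib_right left_diff_distrib)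
    also have "\<dots> = (\<Sum>k=1..y div c. if k = 1 then f c else 0) -
        (\<Sum>k=1..y div c. \<Sum>d | d dvd k. \<mu> d * f (c * (d * (k div d))))"
      by (rule sum_subtractf)
    also have "(\<Sum>k=1..y div c. if k = 1 then f c else 0) = f c"
      using c by (simp add: Suc_le_eq div_greater_zero_iff)
    also have "(\<Sum>k=1..y div c. \<Sum>d | d dvd k. \<mu> d * f (c * (d * (k div d)))) =
        (\<Sum>d=1..y div c. \<Sum>j=1..y div c div d. \<mu> d * f (c * (d * j)))"
      by (rule sum_divisors_hyperbola[of "\<lambda>d j. \<mu> d * f (c * (d * j))"])
    finally show ?thesis by (simp add: mult.assoc)
  qed
  have "(\<Sum>c=1..y. hi c * (\<Sum>k=1..y div c. vaughan_coeff U k * f (c * k))) =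
      (\<Sum>c=1..y. hi c * f c - (\<Sum>d=1..y div c. \<Sum>j=1..y div c div d. hi c * (\<mu> d * f (c * d * j))))"
    using inner by (intro sum.cong refl) (simp add: right_diff_distrib sum_distrib_left)
  also have "\<dots> = (\<Sum>c=1..y. hi c * f c) -
      (\<Sum>c=1..y. \<Sum>d=1..y div c. \<Sum>j=1..y div c div d. hi c * (\<mu> d * f (c * d * j)))"
    by (rule sum_subtractf)
  \<comment> \<open>Bringing the Moebius variable d outside leaves the convolution of
    \<open>hi\<close> with 1 inside, which turns into ln minus the convolution of \<open>lo\<close>
    with 1.\<close>
  also have "(\<Sum>c=1..y. \<Sum>d=1..y div c. \<Sum>j=1..y div c div d. hi c * (\<mu> d * f (c * d * j))) =
      (\<Sum>d=1..y. \<Sum>c=1..y div d. \<Sum>j=1..y div c div d. hi c * (\<mu> d * f (c * d * j)))"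
    by (rule sum_hyperbola_swap)
  also have "\<dots> = (\<Sum>d=1..y. \<mu> d * (\<Sum>c=1..y div d. \<Sum>j=1..y div d div c. hi c * f (d * (c * j))))"
    by (intro sum.cong refl) (simp add: sum_distrib_left mult_ac flip: div_mult2_eq)
  also have "\<dots> = (\<Sum>d=1..y. \<mu> d * ((\<Sum>m=1..y div d. of_real (ln (real m)) * f (d * m)) -
       (\<Sum>c=1..y div d. lo c * (\<Sum>j=1..y div d div c. f (d * c * j)))))"
  proof (intro sum.cong refl arg_cong2[where f = "(*)"])
    fix d assume "d \<in> {1..y}"
    have "(\<Sum>c=1..y div d. \<Sum>j=1..y div d div c. hi c * f (d * (c * j))) =
        (\<Sum>m=1..y div d. \<Sum>c | c dvd m. hi c * f (d * (c * (m div c))))"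
      by (rule sum_divisors_hyperbola[symmetric])
    also have "\<dots> = (\<Sum>m=1..y div d. of_real (ln (real m)) * f (d * m) - (\<Sum>c | c dvd m. lo c * f (d * (c * (m div c)))))"
    proof (intro sum.cong refl)
      fix m assume m: "m \<in> {1..y div d}"
      have "(\<Sum>c | c dvd m. mangoldt c :: complex) = of_real (ln (real m))"
        using m by (intro mangoldt_sum) auto
      then have "(\<Sum>c | c dvd m. hi c) = of_real (ln (real m)) - (\<Sum>c | c dvd m. lo c)"
        unfolding lohi sum.distrib by (simp add: algebra_simps)
      then show "(\<Sum>c | c dvd m. hi c * f (d * (c * (m div c)))) =
          of_real (ln (real m)) * f (d * m) - (\<Sum>c | c dvd m. lo c * f (d * (c * (m div c))))"
        by (simp flip: sum_distrib_right add: left_diff_distrib)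
    qed
    also have "\<dots> = (\<Sum>m=1..y div d. of_real (ln (real m)) * f (d * m)) -
        (\<Sum>m=1..y div d. \<Sum>c | c dvd m. lo c * f (d * (c * (m div c))))"
      by (rule sum_subtractf)
    also have "(\<Sum>m=1..y div d. \<Sum>c | c dvd m. lo c * f (d * (c * (m div c)))) =
        (\<Sum>c=1..y div d. \<Sum>j=1..y div d div c. lo c * f (d * (c * j)))"
      by (rule sum_divisors_hyperbola)
    finally show "(\<Sum>c=1..y div d. \<Sum>j=1..y div d div c. hi c * f (d * (c * j))) =
        (\<Sum>m=1..y div d. of_real (ln (real m)) * f (d * m)) -
        (\<Sum>c=1..y div d. lo c * (\<Sum>j=1..y div d div c. f (d * c * j)))"
      by (simp add: sum_distrib_left mult.assoc)
  qed
  finally show ?thesis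
    by (simp add: lohi sum.distrib distrib_right)
qed

section \<open>Bilinear sums\<close>

text \<open>Abel summation: the decrements of \<open>w\<close> are nonnegative and telescope, so the
  partial sums of \<open>g\<close> enter with total weight w 1.\<close>

lemma norm_sum_mult_decreasing_le:
  fixes g :: "nat \<Rightarrow> complex" and w :: "nat \<Rightarrow> real"
  assumes n: "1 \<le> n" and dec: "\<And>m. 1 \<le> m \<Longrightarrow> m < n \<Longrightarrow> w (Suc m) \<le> w m" and w0: "\<And>m. 1 \<le> m \<Longrightarrow> m \<le> n \<Longrightarrow> 0 \<le> w m"
    and B: "\<And>t. t \<le> n \<Longrightarrow> norm (\<Sum>m=1..t. g m) \<le> B"
  shows "norm (\<Sum>m=1..n. of_real (w m) * g m) \<le> w 1 * B"
proof -
  \<comment> \<open>The induction carries the sum without its boundary term; the boundary term w n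
    times the last partial sum is restored at the end.\<close>
  have "norm ((\<Sum>m=1..k. of_real (w m) * g m) - of_real (w k) * (\<Sum>m=1..k. g m)) \<le> (w 1 - w k) * B"
    if "1 \<le> k" "k \<le> n" for k
    using that
  proof (induction k rule: dec_induct)
    case (step k)
    define S where "S = (\<Sum>m=1..k. g m)"
    define T where "T = (\<Sum>m=1..k. of_real (w m) * g m)"
    have "(\<Sum>m=1..Suc k. of_real (w m) * g m) - of_real (w (Suc k)) * (\<Sum>m=1..Suc k. g m) =
        (T - of_real (w k) * S) + of_real (w k - w (Suc k)) * S"
      by (simp add: S_def T_def algebra_simps)
    also have "norm \<dots> \<le> norm (T - of_real (w k) * S) + norm (of_real (w k - w (Suc k)) * S)"
      by (rule norm_triangle_ineq)
    also have "norm (of_real (w k - w (Suc k)) * S) = (w k - w (Suc k)) * norm S"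
      using dec[of k] step by (simp only: norm_mult norm_of_real) simp
    also have "\<dots> \<le> (w k - w (Suc k)) * B"
      using dec[of k] step B[of k] unfolding S_def by (intro mult_left_mono) auto
    also have "norm (T - of_real (w k) * S) \<le> (w 1 - w k) * B"
      unfolding S_def T_def using step by simp
    finally show ?case by (simp add: algebra_simps)
  qed simp
  from this[of n] have "norm ((\<Sum>m=1..n. of_real (w m) * g m) - of_real (w n) * (\<Sum>m=1..n. g m)) \<le> (w 1 - w n) * B"
    using n by simp
  moreover have "norm (of_real (w n) * (\<Sum>m=1..n. g m)) \<le> w n * B"
    using w0[of n] B[of n] n unfolding norm_mult by (intro mult_mono) auto
  ultimately have "norm ((\<Sum>m=1..n. of_real (w m) * g m) - of_real (w n) * (\<Sum>m=1..n. g m)) +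
      norm (of_real (w n) * (\<Sum>m=1..n. g m)) \<le> w 1 * B"
    by (simp add: algebra_simps)
  then show ?thesis
    using norm_triangle_sub[of "\<Sum>m=1..n. of_real (w m) * g m" "of_real (w n) * (\<Sum>m=1..n. g m)"] by linarith
qed

text \<open>The weight ln m increases, so Abel summation is applied to ln n - ln m instead; the two
  pieces give the factor 2.\<close>

lemma norm_sum_ln_mult_le:
  fixes g :: "nat \<Rightarrow> complex"
  assumes B: "\<And>t. t \<le> n \<Longrightarrow> norm (\<Sum>m=1..t. g m) \<le> B"
  shows "norm (\<Sum>m=1..n. of_real (ln (real m)) * g m) \<le> 2 * ln (real n) * B"
proof (cases "n = 0")
  case False
  have "norm (\<Sum>m=1..n. of_real (ln (real n) - ln (real m)) * g m) \<le> (ln (real n) - ln (real 1)) * B"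
    by (rule norm_sum_mult_decreasing_le) (use B False in auto)
  moreover have "norm (of_real (ln (real n)) * (\<Sum>m=1..n. g m)) \<le> ln (real n) * B"
    using False B[of n] unfolding norm_mult by (intro mult_mono) auto
  moreover have "(\<Sum>m=1..n. of_real (ln (real m)) * g m) =
      of_real (ln (real n)) * (\<Sum>m=1..n. g m) - (\<Sum>m=1..n. of_real (ln (real n) - ln (real m)) * g m)"
    by (simp add: sum_distrib_left algebra_simps flip: sum_subtractf)
  ultimately show ?thesis
    using norm_triangle_ineq4[of "of_real (ln (real n)) * (\<Sum>m=1..n. g m)"
        "\<Sum>m=1..n. of_real (ln (real n) - ln (real m)) * g m"] by simp
qed simp

section \<open>Type I sums\<close>

text \<open>The numerator is hidden because all later bounds depend on the denominator
  alone.\<close>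

definition rational_approx :: "real \<Rightarrow> nat \<Rightarrow> bool" where
  "rational_approx \<alpha> q \<longleftrightarrow> q > 0 \<and> (\<exists>a. coprime a (int q) \<and> \<bar>\<alpha> - of_int a / real q\<bar> \<le> 1 / real q ^ 2)"

lemma sum_cap_approx_le:
  assumes "rational_approx \<alpha> q" "0 \<le> Y"
  shows "(\<Sum>n=1..X. cap Y (\<alpha> * real n)) \<le> cap_sum_bound q (real X) Y"
  using assms cap_sum_le unfolding rational_approx_def by blast

definition type1_bound :: "nat \<Rightarrow> nat \<Rightarrow> nat \<Rightarrow> real" where
  "type1_bound q U x = sqrt (real x + 2 * cap_sum_bound q (real (2 * U ^ 4 * x)) (real x))"

text \<open>Differencing produces the multiples 2 D^2 h of \<alpha>. They are distinct and at most 2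
  U^4 x, so the sum may be extended to all multiples in that range. This is wasteful in D, but only
  an approximation of \<alpha> itself enters, and none of \<alpha> D^2.\<close>

lemma type1_sum_le:
  assumes ap: "rational_approx \<alpha> q" and D: "D \<ge> 1" "D \<le> U ^ 2" and t: "t \<le> x"
  shows "norm (\<Sum>m=1..t. ee (\<alpha> * real (D * m) ^ 2)) \<le> type1_bound q U x"
  unfolding type1_bound_def
proof (rule real_le_rsqrt)
  have "norm (\<Sum>m=1..t. ee (\<alpha> * real (D * m) ^ 2)) ^ 2 =
      norm (\<Sum>c=1..<1 + t. ee ((\<alpha> * real D ^ 2) * real c ^ 2)) ^ 2"
    by (simp add: atLeastLessThanSuc_atLeastAtMost power_mult_distrib mult_ac)
  also have "\<dots> \<le> real t + 2 * (\<Sum>h=1..t. cap (real t) ((\<alpha> * real D ^ 2) * real (2 * h)))"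
    by (rule weyl_square)
  also have "(\<Sum>h=1..t. cap (real t) ((\<alpha> * real D ^ 2) * real (2 * h))) \<le>
      (\<Sum>h=1..t. cap (real x) (\<alpha> * real (2 * D ^ 2 * h)))"
  proof (rule sum_mono)
    fix h
    have "cap (real t) ((\<alpha> * real D ^ 2) * real (2 * h)) = cap (real t) (\<alpha> * real (2 * D ^ 2 * h))"
      by (simp add: mult_ac)
    also have "\<dots> \<le> cap (real x) (\<alpha> * real (2 * D ^ 2 * h))"
      using t by (intro cap_mono) auto
    finally show "cap (real t) ((\<alpha> * real D ^ 2) * real (2 * h)) \<le> cap (real x) (\<alpha> * real (2 * D ^ 2 * h))" .
  qed
  also have "\<dots> = (\<Sum>n\<in>(\<lambda>h. 2 * D ^ 2 * h) ` {1..t}. cap (real x) (\<alpha> * real n))"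
    using D by (subst sum.reindex) (auto simp: inj_on_def)
  also have "\<dots> \<le> (\<Sum>n=1..2 * U ^ 4 * x. cap (real x) (\<alpha> * real n))"
  proof (rule sum_mono2)
    show "(\<lambda>h. 2 * D ^ 2 * h) ` {1..t} \<subseteq> {1..2 * U ^ 4 * x}"
    proof safe
      fix h assume h: "h \<in> {1..t}"
      have "D ^ 2 \<le> (U ^ 2) ^ 2" using D by (intro power_mono) auto
      then have "2 * D ^ 2 * h \<le> 2 * U ^ 4 * x"
        using h t by (intro mult_le_mono) (auto simp flip: power_mult)
      moreover have "1 \<le> 2 * D ^ 2 * h" using h D by (simp add: Suc_le_eq)
      ultimately show "2 * D ^ 2 * h \<in> {1..2 * U ^ 4 * x}" by simp
    qed
  qed (auto intro: cap_nonneg)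
  also have "\<dots> \<le> cap_sum_bound q (real (2 * U ^ 4 * x)) (real x)"
    by (rule sum_cap_approx_le[OF ap]) simp
  finally show "norm (\<Sum>m=1..t. ee (\<alpha> * real (D * m) ^ 2)) ^ 2 \<le>
      real x + 2 * cap_sum_bound q (real (2 * U ^ 4 * x)) (real x)"
    using t by simp
qed

lemma type1_total_le:
  fixes \<alpha> :: real and x y U q :: nat
  defines "f \<equiv> \<lambda>n. ee (\<alpha> * real n ^ 2)"
  assumes ap: "rational_approx \<alpha> q" and y: "y \<le> x" and U: "U \<ge> 1" and x: "x \<ge> 1"
  shows "norm (\<Sum>d=1..y. (if d \<le> U then moebius_mu d else 0) *
      ((\<Sum>m=1..y div d. of_real (ln (real m)) * f (d * m)) -
       (\<Sum>c=1..y div d. (if c \<le> U then mangoldt c else 0) * (\<Sum>j=1..y div d div c. f (d * c * j)))))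
    \<le> 3 * real U ^ 2 * ln (real x) * type1_bound q U x"
proof -
  define T where "T = type1_bound q U x"
  have T0: "0 \<le> T"
    using order_trans[OF norm_ge_zero type1_sum_le[OF ap, of 1 U 0 x]] U unfolding T_def by simp
  have lx: "0 \<le> ln (real x)" using x by simp
  have T: "norm (\<Sum>m=1..t. f (D * m)) \<le> T" if "D \<ge> 1" "D \<le> U ^ 2" "t \<le> x" for D t
    unfolding f_def T_def by (rule type1_sum_le[OF ap that])
  have UU: "U \<le> U ^ 2" using U by (simp add: power2_eq_square)
  \<comment> \<open>The sum with weight ln costs 2 ln x by partial summation, the at most U values
    of c cost ln x each; together at most 3 U ln x as U \<ge> 1.\<close>
  have d: "norm ((\<Sum>m=1..y div d. of_real (ln (real m)) * f (d * m)) -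
       (\<Sum>c=1..y div d. (if c \<le> U then mangoldt c else 0) * (\<Sum>j=1..y div d div c. f (d * c * j))))
      \<le> 3 * real U * ln (real x) * T" if d: "1 \<le> d" "d \<le> U" for d
  proof -
    have yd: "y div d \<le> x" using y div_le_dividend le_trans by blast
    have "norm (\<Sum>m=1..y div d. of_real (ln (real m)) * f (d * m)) \<le> 2 * ln (real (y div d)) * T"
      using yd d UU by (intro norm_sum_ln_mult_le T) auto
    also have "\<dots> \<le> 2 * ln (real x) * T"
    proof (cases "y div d = 0")
      case False
      then show ?thesis using yd T0 by (intro mult_right_mono mult_left_mono) auto
    qed (use lx T0 in simp)
    finally have 1: "norm (\<Sum>m=1..y div d. of_real (ln (real m)) * f (d * m)) \<le> 2 * ln (real x) * T" .
    have "norm (\<Sum>c=1..y div d. (if c \<le> U then mangoldt c else 0) * (\<Sum>j=1..y div d div c. f (d * c * j)))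
        \<le> (\<Sum>c=1..y div d. if c \<le> U then ln (real x) * T else 0)"
    proof (rule sum_norm_le)
      fix c assume c: "c \<in> {1..y div d}"
      show "norm ((if c \<le> U then mangoldt c else 0) * (\<Sum>j=1..y div d div c. f (d * c * j)))
          \<le> (if c \<le> U then ln (real x) * T else 0)"
      proof (cases "c \<le> U")
        case True
        have "norm (mangoldt c :: complex) \<le> ln (real c)" using c by (simp add: mangoldt_le)
        also have "\<dots> \<le> ln (real x)" using c yd by simp
        finally have "norm (mangoldt c :: complex) \<le> ln (real x)" .
        moreover have "norm (\<Sum>j=1..y div d div c. f (d * c * j)) \<le> T"
          using d c True yd by (intro T) (auto simp: power2_eq_square intro: mult_le_mono le_trans[OF div_le_dividend])
        ultimately have "norm (mangoldt c :: complex) * norm (\<Sum>j=1..y div d div c. f (d * c * j)) \<le> ln (real x) * T"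
          using lx by (intro mult_mono) auto
        then show ?thesis using True by (simp add: norm_mult)
      qed simp
    qed
    also have "\<dots> = real (card {c \<in> {1..y div d}. c \<le> U}) * (ln (real x) * T)"
      by (simp add: sum.If_cases Int_def)
    also have "\<dots> \<le> real U * (ln (real x) * T)"
    proof -
      have "card {c \<in> {1..y div d}. c \<le> U} \<le> card {1..U}" by (intro card_mono) auto
      then show ?thesis using lx T0 by (intro mult_right_mono) auto
    qed
    finally have 2: "norm (\<Sum>c=1..y div d. (if c \<le> U then mangoldt c else 0) * (\<Sum>j=1..y div d div c. f (d * c * j)))
        \<le> real U * (ln (real x) * T)" .
    have "2 * (ln (real x) * T) \<le> 2 * real U * (ln (real x) * T)"
      using U lx T0 by (intro mult_right_mono) auto
    then show ?thesis using 1 2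
      by (intro order_trans[OF norm_triangle_ineq4]) (simp add: algebra_simps)
  qed
  have "norm (\<Sum>d=1..y. (if d \<le> U then moebius_mu d else 0) *
      ((\<Sum>m=1..y div d. of_real (ln (real m)) * f (d * m)) -
       (\<Sum>c=1..y div d. (if c \<le> U then mangoldt c else 0) * (\<Sum>j=1..y div d div c. f (d * c * j)))))
    \<le> (\<Sum>d=1..y. if d \<le> U then 3 * real U * ln (real x) * T else 0)"
  proof (rule sum_norm_le)
    fix i assume i: "i \<in> {1..y}"
    let ?E = "(\<Sum>m=1..y div i. of_real (ln (real m)) * f (i * m)) -
       (\<Sum>c=1..y div i. (if c \<le> U then mangoldt c else 0) * (\<Sum>j=1..y div i div c. f (i * c * j)))"
    show "norm ((if i \<le> U then moebius_mu i else 0) * ?E) \<le> (if i \<le> U then 3 * real U * ln (real x) * T else 0)"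
    proof (cases "i \<le> U")
      case True
      then have "norm ?E \<le> 3 * real U * ln (real x) * T" using i by (intro d) auto
      then have "norm (moebius_mu i) * norm ?E \<le> 1 * (3 * real U * ln (real x) * T)"
        using norm_moebius_mu_le by (intro mult_mono) auto
      then show ?thesis using True by (simp only: norm_mult if_True mult_1_left)
    qed simp
  qed
  also have "\<dots> = real (card {d \<in> {1..y}. d \<le> U}) * (3 * real U * ln (real x) * T)"
    by (simp add: sum.If_cases Int_def)
  also have "\<dots> \<le> real U * (3 * real U * ln (real x) * T)"
  proof -
    have "card {d \<in> {1..y}. d \<le> U} \<le> card {1..U}" by (intro card_mono) auto
    then show ?thesis using lx T0 by (intro mult_right_mono) auto
  qed
  finally show ?thesis unfolding T_def by (simp add: power2_eq_square mult_ac)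
qed

section \<open>Type II sums\<close>

text \<open>The two hyperbola conditions merely cut the dyadic block down to a shorter interval
  starting at C + 1, so differencing still applies.\<close>

lemma weyl_shifted_le:
  assumes "k > 0" "l > 0" "C \<ge> 1"
  shows "norm (\<Sum>c=C+1..2*C. if c * k \<le> y \<and> c * l \<le> y then ee (\<theta> * real c ^ 2) else 0) ^ 2
    \<le> real C + 2 * (\<Sum>h=1..C. cap (real C) (\<theta> * real (2 * h)))"
proof -
  define L where "L = min (2 * C) (min (y div k) (y div l)) - C"
  have LC: "L \<le> C" unfolding L_def by simp
  have dk: "c * k \<le> y \<longleftrightarrow> c \<le> y div k" and dl: "c * l \<le> y \<longleftrightarrow> c \<le> y div l" for c
    using assms by (simp_all add: less_eq_div_iff_mult_less_eq)
  have "(\<Sum>c=C+1..2*C. if c * k \<le> y \<and> c * l \<le> y then ee (\<theta> * real c ^ 2) else 0) =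
      (\<Sum>c=C+1..<C+1+L. ee (\<theta> * real c ^ 2))"
    unfolding L_def by (intro sum.mono_neutral_cong_right) (auto simp: dk dl)
  also have "norm \<dots> ^ 2 \<le> real L + 2 * (\<Sum>h=1..L. cap (real L) (\<theta> * real (2 * h)))"
    by (rule weyl_square)
  also have "(\<Sum>h=1..L. cap (real L) (\<theta> * real (2 * h))) \<le> (\<Sum>h=1..L. cap (real C) (\<theta> * real (2 * h)))"
    using LC by (intro sum_mono cap_mono) auto
  also have "\<dots> \<le> (\<Sum>h=1..C. cap (real C) (\<theta> * real (2 * h)))"
    using LC by (intro sum_mono2) (auto intro: cap_nonneg)
  finally show ?thesis using LC by simp
qed

text \<open>Each argument n factors as h (k + l) * 2 (k - l). Both h and k + l divide n, and
  together with n they determine the triple, so n is hit at most d(n)^2 \<le> R times and the sum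
  collapses to one over plain multiples of \<alpha>.\<close>

lemma sum_square_difference_cap_le:
  assumes ap: "rational_approx \<alpha> q"
    and R: "\<And>n. 1 \<le> n \<Longrightarrow> n \<le> 2 * C * K ^ 2 \<Longrightarrow> real (card {d. d dvd n}) ^ 2 \<le> R" and R0: "R \<ge> 0"
  shows "(\<Sum>(k, l, h)\<in>{(k, l, h). l < k \<and> 1 \<le> l \<and> k \<le> K \<and> 1 \<le> h \<and> h \<le> C}.
      cap (real C) (\<alpha> * real (2 * h * (k ^ 2 - l ^ 2)))) \<le> R * cap_sum_bound q (real (2 * C * K ^ 2)) (real C)"
proof -
  define S where "S = {(k, l, h). l < k \<and> 1 \<le> l \<and> k \<le> K \<and> 1 \<le> h \<and> h \<le> (C::nat)}"
  define g where "g = (\<lambda>(k, l, h). 2 * h * (k ^ 2 - l ^ 2) :: nat)"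
  have finS: "finite S" unfolding S_def
    by (rule finite_subset[of _ "{..K} \<times> {..K} \<times> {..C}"]) auto
  have pos: "1 \<le> g s \<and> g s \<le> 2 * C * K ^ 2" if "s \<in> S" for s
  proof -
    obtain k l h where kl: "s = (k, l, h)" by (rule prod_cases3)
    then have s: "l < k" "1 \<le> l" "k \<le> K" "1 \<le> h" "h \<le> C"
      using that unfolding S_def by auto
    have "l ^ 2 < k ^ 2" using s by (intro power_strict_mono) auto
    moreover have "k ^ 2 \<le> K ^ 2" using s by (intro power_mono) auto
    then have "2 * h * (k ^ 2 - l ^ 2) \<le> 2 * C * K ^ 2"
      using s by (intro mult_le_mono) (auto intro: le_trans[OF diff_le_self])
    ultimately show ?thesis using s kl by (simp add: g_def Suc_le_eq)
  qed
  have fib: "real (card {s \<in> S. g s = n}) \<le> R" if n: "1 \<le> n" "n \<le> 2 * C * K ^ 2" for n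
  proof -
    have "card {s \<in> S. g s = n} \<le> card ({d. d dvd n} \<times> {d. d dvd n})"
    proof (rule card_inj_on_le[where f = "\<lambda>(k, l, h). (h, k + l)"])
      have fact: "2 * h * (k ^ 2 - l ^ 2) = h * (k + l) * (2 * (k - l))" if "l < k" for h k l :: nat
        using that by (auto simp: power2_eq_square algebra_simps dest!: less_imp_Suc_add)
      show "inj_on (\<lambda>(k, l, h). (h, k + l)) {s \<in> S. g s = n}"
      proof (rule inj_onI)
        fix s s' assume ss: "s \<in> {s \<in> S. g s = n}" "s' \<in> {s \<in> S. g s = n}"
          "(case s of (k, l, h) \<Rightarrow> (h, k + l)) = (case s' of (k, l, h) \<Rightarrow> (h, k + l))"
        obtain k l h where s: "s = (k, l, h)" by (rule prod_cases3)
        obtain k' l' h' where s': "s' = (k', l', h')" by (rule prod_cases3)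
        have h: "h' = h" using ss unfolding s s' by simp
        have a: "(k, l, h) \<in> S" "(k', l', h) \<in> S" "k + l = k' + l'" "g (k', l', h) = g (k, l, h)"
          using ss unfolding s s' h by simp_all
        then have b: "l < k" "l' < k'" "h \<ge> 1" by (auto simp: S_def)
        have "h * (k' + l') * (2 * (k' - l')) = h * (k' + l') * (2 * (k - l))"
          using a(3,4) fact[OF b(1), of h] fact[OF b(2), of h] unfolding g_def by simp
        then have "k' - l' = k - l" using b by simp
        then have "k = k' \<and> l = l'" using a(3) b by linarith
        then show "s = s'" unfolding s s' h by simp
      qed
      show "(\<lambda>(k, l, h). (h, k + l)) ` {s \<in> S. g s = n} \<subseteq> {d. d dvd n} \<times> {d. d dvd n}"
      proof (rule image_subsetI)
        fix s assume ss: "s \<in> {s \<in> S. g s = n}"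
        obtain k l h where s: "s = (k, l, h)" by (rule prod_cases3)
        have "n = 2 * h * (k ^ 2 - l ^ 2)" "l < k" using ss unfolding s g_def S_def by auto
        then have "n = h * (k + l) * (2 * (k - l))" using fact[of l k h] by simp
        then have "h dvd n" "k + l dvd n" by (simp_all only: mult.assoc dvd_triv_left) (simp add: mult.left_commute)
        then show "(case s of (k, l, h) \<Rightarrow> (h, k + l)) \<in> {d. d dvd n} \<times> {d. d dvd n}"
          unfolding s by simp
      qed
      show "finite ({d. d dvd n} \<times> {d. d dvd n})" using n by (simp add: finite_divisors_nat)
    qed
    also have "\<dots> = card {d. d dvd n} ^ 2" by (simp add: card_cartesian_product power2_eq_square)
    finally have "real (card {s \<in> S. g s = n}) \<le> real (card {d. d dvd n} ^ 2)"
      by (simp only: of_nat_le_iff)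
    also have "\<dots> \<le> R" using R[OF n] by (simp only: of_nat_power)
    finally show ?thesis .
  qed
  have "(\<Sum>(k, l, h)\<in>S. cap (real C) (\<alpha> * real (2 * h * (k ^ 2 - l ^ 2)))) =
      (\<Sum>s\<in>S. cap (real C) (\<alpha> * real (g s)))"
    by (intro sum.cong refl) (auto simp: g_def)
  also have "\<dots> = (\<Sum>n\<in>g ` S. \<Sum>s\<in>{s \<in> S. g s = n}. cap (real C) (\<alpha> * real (g s)))"
    by (rule sum.image_gen[OF finS])
  also have "\<dots> = (\<Sum>n\<in>g ` S. real (card {s \<in> S. g s = n}) * cap (real C) (\<alpha> * real n))"
    by (intro sum.cong refl) simp
  also have "\<dots> \<le> (\<Sum>n\<in>g ` S. R * cap (real C) (\<alpha> * real n))"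
    using pos by (intro sum_mono mult_right_mono fib cap_nonneg) auto
  also have "\<dots> \<le> (\<Sum>n=1..2 * C * K ^ 2. R * cap (real C) (\<alpha> * real n))"
    using pos R0 by (intro sum_mono2) (auto intro!: mult_nonneg_nonneg cap_nonneg)
  also have "\<dots> \<le> R * cap_sum_bound q (real (2 * C * K ^ 2)) (real C)"
    unfolding sum_distrib_left[symmetric] using R0
    by (intro mult_left_mono sum_cap_approx_le[OF ap]) auto
  finally show ?thesis unfolding S_def .
qed

text \<open>The Cauchy-Schwarz inequality is applied twice: to open the inner sum over \<open>k\<close>, and to reach
  the squares of the sums over \<open>c\<close> with frequency \<open>\<alpha> (k\<^sup>2 - l\<^sup>2)\<close>, which Weyl differencing bounds.\<close>
lemma type2_block_le:
  fixes \<alpha> :: real and y C K :: nat and \<beta> \<gamma> :: "nat \<Rightarrow> complex"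
  assumes ap: "rational_approx \<alpha> q" and C: "C \<ge> 1" and K: "y div C \<le> K"
    and \<beta>: "\<And>k. 1 \<le> k \<Longrightarrow> k \<le> K \<Longrightarrow> norm (\<beta> k) \<le> b"
    and \<gamma>: "\<And>c. C < c \<Longrightarrow> c \<le> 2 * C \<Longrightarrow> c \<le> y \<Longrightarrow> norm (\<gamma> c) \<le> G" and bG: "b \<ge> 0" "G \<ge> 0"
    and R: "\<And>n. 1 \<le> n \<Longrightarrow> n \<le> 2 * C * K ^ 2 \<Longrightarrow> real (card {d. d dvd n}) ^ 2 \<le> R" and R0: "R \<ge> 0"
  shows "norm (\<Sum>c=C+1..2*C. \<gamma> c * (\<Sum>k=1..y div c. \<beta> k * ee (\<alpha> * real (c * k) ^ 2))) ^ 4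
    \<le> G ^ 4 * b ^ 4 * (real C * real K) ^ 2 * (real K * real C ^ 2 + real K ^ 2 * real C +
        4 * R * cap_sum_bound q (real (2 * C * K ^ 2)) (real C))"
proof -
  \<comment> \<open>The condition c k \<le> y is moved into the summand, which makes the range of k
    independent of c and lets the sums be exchanged after squaring.\<close>
  define F where "F = (\<lambda>c. \<Sum>k=1..K. if c * k \<le> y then \<beta> k * ee (\<alpha> * real (c * k) ^ 2) else 0)"
  define Hs where "Hs = (\<lambda>k l. \<Sum>c=C+1..2*C. if c * k \<le> y \<and> c * l \<le> y
      then ee (\<alpha> * (real k ^ 2 - real l ^ 2) * real c ^ 2) else 0)"
  define W where "W = (\<Sum>k=1..K. \<Sum>l=1..K. norm (Hs k l))"
  define cs where "cs = cap_sum_bound q (real (2 * C * K ^ 2)) (real C)"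
  have F: "(\<Sum>k=1..y div c. \<beta> k * ee (\<alpha> * real (c * k) ^ 2)) = F c" if c: "C < c" for c
  proof -
    have "y div c \<le> y div C" using c C by (intro div_le_mono2) auto
    then have "y div c \<le> K" using K by simp
    then show ?thesis unfolding F_def using c
      by (intro sum.mono_neutral_cong_left) (auto simp: less_eq_div_iff_mult_less_eq mult.commute not_le)
  qed
  define B where "B = norm (\<Sum>c=C+1..2*C. \<gamma> c * (\<Sum>k=1..y div c. \<beta> k * ee (\<alpha> * real (c * k) ^ 2)))"
  define A where "A = (\<Sum>c=C+1..2*C. norm (F c))"
  have B0: "B \<ge> 0" unfolding B_def by simp
  have GA: "G * (\<Sum>c=C+1..2*C. norm (F c)) = (\<Sum>c=C+1..2*C. G * norm (F c))"
    by (rule sum_distrib_left)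
  have BA: "B \<le> G * A"
    unfolding B_def A_def GA
  proof (rule sum_norm_le)
    fix c assume c: "c \<in> {C+1..2*C}"
    show "norm (\<gamma> c * (\<Sum>k=1..y div c. \<beta> k * ee (\<alpha> * real (c * k) ^ 2))) \<le> G * norm (F c)"
    proof (cases "c \<le> y")
      case True
      then show ?thesis using c \<gamma>[of c] F[of c] by (simp add: norm_mult mult_right_mono)
    next
      case False
      then show ?thesis using bG by simp
    qed
  qed
  have sq: "(\<Sum>c=C+1..2*C. norm (F c) ^ 2) \<le> b ^ 2 * W"
  proof -
    have "complex_of_real (\<Sum>c=C+1..2*C. norm (F c) ^ 2) = (\<Sum>c=C+1..2*C. F c * cnj (F c))"
      by (simp only: of_real_sum complex_norm_square)
    also have "\<dots> = (\<Sum>c=C+1..2*C. \<Sum>k=1..K. \<Sum>l=1..K. \<beta> k * cnj (\<beta> l) *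
        (if c * k \<le> y \<and> c * l \<le> y then ee (\<alpha> * (real k ^ 2 - real l ^ 2) * real c ^ 2) else 0))"
      unfolding F_def cnj_sum sum_product
      by (intro sum.cong refl) (auto simp: cnj_ee algebra_simps power_mult_distrib simp flip: ee_add)
    also have "\<dots> = (\<Sum>k=1..K. \<Sum>l=1..K. \<beta> k * cnj (\<beta> l) * Hs k l)"
      unfolding Hs_def sum_distrib_left
      by (rule trans[OF sum.swap]) (intro sum.cong refl sum.swap)
    finally have eq: "complex_of_real (\<Sum>c=C+1..2*C. norm (F c) ^ 2) = (\<Sum>k=1..K. \<Sum>l=1..K. \<beta> k * cnj (\<beta> l) * Hs k l)" .
    have "(\<Sum>c=C+1..2*C. norm (F c) ^ 2) = norm (complex_of_real (\<Sum>c=C+1..2*C. norm (F c) ^ 2))"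
      by (simp only: norm_of_real) (simp add: sum_nonneg)
    also have "\<dots> \<le> (\<Sum>k=1..K. \<Sum>l=1..K. b ^ 2 * norm (Hs k l))"
      unfolding eq
    proof (intro sum_norm_le)
      fix k l assume "k \<in> {1..K}" "l \<in> {1..K}"
      then have "norm (\<beta> k) * norm (\<beta> l) * norm (Hs k l) \<le> b * b * norm (Hs k l)"
        using \<beta> bG by (intro mult_right_mono mult_mono) auto
      then show "norm (\<beta> k * cnj (\<beta> l) * Hs k l) \<le> b ^ 2 * norm (Hs k l)"
        by (simp add: norm_mult power2_eq_square)
    qed
    finally show ?thesis unfolding W_def by (simp add: sum_distrib_left)
  qed
  have A2: "A ^ 2 \<le> real C * (b ^ 2 * W)"
  proof -
    have "A ^ 2 \<le> (\<Sum>c=C+1..2*C. norm (F c) ^ 2) * real (card {C+1..2*C})"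
      unfolding A_def by (rule sum_squared_le_sum_of_squares)
    also have "\<dots> \<le> (b ^ 2 * W) * real C" using sq by (simp add: mult_right_mono)
    finally show ?thesis by (simp add: mult.commute)
  qed
  define V where "V = (\<Sum>k=1..K. \<Sum>l=1..K. norm (Hs k l) ^ 2)"
  have W2: "W ^ 2 \<le> real K ^ 2 * V"
  proof -
    have "W = (\<Sum>z\<in>{1..K}\<times>{1..K}. norm (Hs (fst z) (snd z)))"
      unfolding W_def by (simp add: sum.cartesian_product case_prod_unfold)
    then have "W ^ 2 \<le> (\<Sum>z\<in>{1..K}\<times>{1..K}. norm (Hs (fst z) (snd z)) ^ 2) * real (card ({1..K}\<times>{1..K}))"
      by (simp only: sum_squared_le_sum_of_squares)
    also have "(\<Sum>z\<in>{1..K}\<times>{1..K}. norm (Hs (fst z) (snd z)) ^ 2) = V"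
      unfolding V_def by (simp add: sum.cartesian_product case_prod_unfold)
    finally show ?thesis by (simp add: card_cartesian_product power2_eq_square mult_ac)
  qed
  define Z where "Z = (\<lambda>k l. \<Sum>h=1..C. cap (real C) (\<alpha> * real (2 * h * (k ^ 2 - l ^ 2))))"
  have Z0: "Z k l \<ge> 0" for k l unfolding Z_def by (intro sum_nonneg cap_nonneg) auto
  \<comment> \<open>The diagonal k = l is estimated trivially. Off the diagonal, evenness of
    \<open>cap\<close> makes the cases l < k and k < l mirror images, so a single ordered sum
    \<open>SZ\<close> has to be bounded.\<close>
  have Hs2: "norm (Hs k l) ^ 2 \<le> (if k = l then real C ^ 2 else 0) + real C +
      2 * (if l < k then Z k l else 0) + 2 * (if k < l then Z l k else 0)"
    if kl: "k \<in> {1..K}" "l \<in> {1..K}" for k l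
  proof -
    have gen: "norm (Hs k l) ^ 2 \<le> real C + 2 * (\<Sum>h=1..C. cap (real C) (\<alpha> * (real k ^ 2 - real l ^ 2) * real (2 * h)))"
      unfolding Hs_def using kl C by (intro weyl_shifted_le) auto
    consider "k = l" | "l < k" | "k < l" by linarith
    then show ?thesis
    proof cases
      case 1
      have "norm (Hs k l) \<le> (\<Sum>c=C+1..2*C. 1)"
        unfolding Hs_def by (intro sum_norm_le) auto
      then have "norm (Hs k l) ^ 2 \<le> real C ^ 2" by (intro power_mono) auto
      then show ?thesis using 1 by (simp del: power2_le_iff_abs_le abs_le_square_iff power_mono_iff)
    next
      case 2
      then have "l ^ 2 \<le> k ^ 2" by (intro power_mono) auto
      then have "\<alpha> * (real k ^ 2 - real l ^ 2) * real (2 * h) = \<alpha> * real (2 * h * (k ^ 2 - l ^ 2))" for h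
        by (simp add: of_nat_diff algebra_simps)
      then have "norm (Hs k l) ^ 2 \<le> real C + 2 * Z k l" using gen unfolding Z_def by (simp only:)
      then show ?thesis using 2 by simp
    next
      case 3
      then have "k ^ 2 \<le> l ^ 2" by (intro power_mono) auto
      then have "\<alpha> * (real k ^ 2 - real l ^ 2) * real (2 * h) = - (\<alpha> * real (2 * h * (l ^ 2 - k ^ 2)))" for h
        by (simp add: of_nat_diff algebra_simps)
      then have "norm (Hs k l) ^ 2 \<le> real C + 2 * Z l k" using gen unfolding Z_def by (simp only: cap_minus)
      then show ?thesis using 3 by simp
    qed
  qed
  define SZ where "SZ = (\<Sum>k=1..K. \<Sum>l=1..K. if l < k then Z k l else 0)"
  have SZ: "SZ \<le> R * cs"
  proof -
    have "SZ = (\<Sum>k=1..K. \<Sum>l=1..K. \<Sum>h=1..C. if l < k then cap (real C) (\<alpha> * real (2 * h * (k ^ 2 - l ^ 2))) else 0)"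
      unfolding SZ_def Z_def by (intro sum.cong refl) auto
    also have "\<dots> = (\<Sum>(k, l, h)\<in>{1..K} \<times> {1..K} \<times> {1..C}. if l < k then cap (real C) (\<alpha> * real (2 * h * (k ^ 2 - l ^ 2))) else 0)"
      by (simp add: sum.cartesian_product)
    also have "\<dots> = (\<Sum>(k, l, h)\<in>{(k, l, h). l < k \<and> 1 \<le> l \<and> k \<le> K \<and> 1 \<le> h \<and> h \<le> C}.
        cap (real C) (\<alpha> * real (2 * h * (k ^ 2 - l ^ 2))))"
      by (intro sum.mono_neutral_cong_right) (auto split: if_splits)
    also have "\<dots> \<le> R * cs"
      unfolding cs_def by (rule sum_square_difference_cap_le[OF ap R R0])
    finally show ?thesis .
  qed
  have V: "V \<le> real K * real C ^ 2 + real K ^ 2 * real C + 4 * R * cs"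
  proof -
    have "V \<le> (\<Sum>k=1..K. \<Sum>l=1..K. (if k = l then real C ^ 2 else 0) + real C +
      2 * (if l < k then Z k l else 0) + 2 * (if k < l then Z l k else 0))"
      unfolding V_def by (intro sum_mono Hs2)
    also have "\<dots> = (\<Sum>k=1..K. \<Sum>l=1..K. if k = l then real C ^ 2 else 0) + (\<Sum>k=1..K. \<Sum>l=1..K. real C) +
        2 * SZ + 2 * (\<Sum>k=1..K. \<Sum>l=1..K. if k < l then Z l k else 0)"
      unfolding SZ_def by (simp only: sum.distrib sum_distrib_left)
    also have "(\<Sum>k=1..K. \<Sum>l=1..K. if k < l then Z l k else 0) = SZ"
      unfolding SZ_def by (rule sum.swap)
    also have "(\<Sum>k=1..K. \<Sum>l=1..K. if k = l then real C ^ 2 else 0) = real K * real C ^ 2"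
      by simp
    also have "(\<Sum>k=1..K. \<Sum>l=1..K. real C) = real K ^ 2 * real C"
      by (simp add: power2_eq_square)
    finally show ?thesis using SZ by simp
  qed
  have A0: "A \<ge> 0" unfolding A_def by (intro sum_nonneg) auto
  have W0: "W \<ge> 0" unfolding W_def by (intro sum_nonneg) auto
  have "B ^ 4 \<le> (G * A) ^ 4" using BA B0 by (intro power_mono)
  also have "\<dots> = G ^ 4 * (A ^ 2) ^ 2" by (simp add: power_mult_distrib flip: power_mult)
  also have "\<dots> \<le> G ^ 4 * (real C * (b ^ 2 * W)) ^ 2"
    using A2 bG by (intro mult_left_mono power_mono) auto
  also have "\<dots> = G ^ 4 * b ^ 4 * real C ^ 2 * W ^ 2" by (simp add: power_mult_distrib flip: power_mult)
  also have "\<dots> \<le> G ^ 4 * b ^ 4 * real C ^ 2 * (real K ^ 2 * V)"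
    using W2 by (intro mult_left_mono) auto
  also have "\<dots> \<le> G ^ 4 * b ^ 4 * real C ^ 2 * (real K ^ 2 * (real K * real C ^ 2 + real K ^ 2 * real C + 4 * R * cs))"
    using V by (intro mult_left_mono) auto
  finally show ?thesis unfolding B_def cs_def by (simp add: power_mult_distrib mult_ac)
qed

lemma sum_dyadic:
  fixes g :: "nat \<Rightarrow> 'a :: comm_monoid_add"
  assumes "U \<ge> 1"
  shows "(\<Sum>c=U+1..U*2^J. g c) = (\<Sum>j<J. \<Sum>c=U*2^j+1..2*(U*2^j). g c)"
proof (induction J)
  case (Suc J)
  define M where "M = U * 2 ^ J"
  have "U \<le> M" unfolding M_def by simp
  then have "{U+1..2*M} = {U+1..M} \<union> {M+1..2*M}" by auto
  then have "(\<Sum>c=U+1..2*M. g c) = (\<Sum>c=U+1..M. g c) + (\<Sum>c=M+1..2*M. g c)"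
    by (simp only:) (intro sum.union_disjoint, auto)
  then show ?case using Suc unfolding M_def by (simp add: mult_ac)
qed simp

text \<open>Fourth power of the bound for one dyadic block. \<open>G\<close> majorises everything of
  size x powr \<epsilon>: the eight leading powers come from the two coefficient sequences, the
  others from the divisor count and from 1 + ln q.\<close>

definition type2_bound :: "nat \<Rightarrow> nat \<Rightarrow> nat \<Rightarrow> real \<Rightarrow> real" where
  "type2_bound q U x G = G ^ 8 * real x ^ 2 * (2 * real x ^ 2 / real U +
     4 * G * (10 * real x ^ 2 / real q + 12 * (real x ^ 2 / real U) * G + 5 * real x + 6 * real q * G))"

lemma type2_total_le:
  fixes \<alpha> G :: real and x y U q J :: nat
  assumes ap: "rational_approx \<alpha> q" and y: "y \<le> x" and U: "U \<ge> 1" and x: "x \<ge> 1" and J: "x < 2 ^ J"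
    and lx: "ln (real x) \<le> G" and lq: "1 + ln (real q) \<le> G"
    and b: "\<And>k. 1 \<le> k \<Longrightarrow> k \<le> x \<Longrightarrow> norm (vaughan_coeff U k) \<le> G"
    and R: "\<And>n. 1 \<le> n \<Longrightarrow> n \<le> 2 * x ^ 2 \<Longrightarrow> real (card {d. d dvd n}) ^ 2 \<le> G"
  shows "norm (\<Sum>c=1..y. (if c \<le> U then 0 else mangoldt c) *
      (\<Sum>k=1..y div c. vaughan_coeff U k * ee (\<alpha> * real (c * k) ^ 2))) \<le> real J * root 4 (type2_bound q U x G)"
proof -
  define g where "g = (\<lambda>c. (if c \<le> U then 0 else mangoldt c) *
      (\<Sum>k=1..y div c. vaughan_coeff U k * ee (\<alpha> * real (c * k) ^ 2)))"
  have q: "q > 0" using ap by (simp add: rational_approx_def)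
  have "0 \<le> ln (real x)" using x by simp
  then have G0: "G \<ge> 0" using lx by linarith
  have E0: "type2_bound q U x G \<ge> 0"
    unfolding type2_bound_def using G0 q U by (intro mult_nonneg_nonneg add_nonneg_nonneg) auto
  have block: "norm (\<Sum>c=U*2^j+1..2*(U*2^j). g c) \<le> root 4 (type2_bound q U x G)" for j
  proof -
    define C where "C = U * 2 ^ j"
    define K where "K = x div C"
    have CU: "C \<ge> U" unfolding C_def by simp
    then have C1: "C \<ge> 1" using U by simp
    have yK: "y div C \<le> K" unfolding K_def using y by (rule div_le_mono)
    show ?thesis
    \<comment> \<open>If all k are at most U, the coefficients vanish and so does the block.
      Otherwise C \<ge> U and K > U, and C K \<le> x bounds both C and K by x / U; this gives the
      terms x^2 / U.\<close>
    proof (cases "K \<le> U")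
      case True
      have "(\<Sum>c=C+1..2*C. g c) = 0"
      proof (rule sum.neutral, safe)
        fix c assume c: "c \<in> {C+1..2*C}"
        have "y div c \<le> y div C" using c C1 by (intro div_le_mono2) auto
        then have "y div c \<le> U" using yK True by simp
        then have "(\<Sum>k=1..y div c. vaughan_coeff U k * ee (\<alpha> * real (c * k) ^ 2)) = 0"
          by (intro sum.neutral) (auto simp: vaughan_coeff_eq_0)
        then show "g c = 0" unfolding g_def by simp
      qed
      then show ?thesis using E0 unfolding C_def by simp
    next
      case False
      have CK: "C * K \<le> x" unfolding K_def by simp
      have Kx: "K \<le> x" unfolding K_def by simp
      have CK2: "2 * C * K ^ 2 \<le> 2 * x ^ 2"
        using mult_le_mono[OF CK Kx] by (simp add: power2_eq_square mult_ac)
      define X c k u where "X = real x" and "c = real C" and "k = real K" and "u = real U"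
      have r: "0 \<le> c" "0 \<le> k" "0 < u" "0 \<le> X" unfolding X_def c_def k_def u_def using U by auto
      have ck: "c * k \<le> X" unfolding X_def c_def k_def using CK by (metis of_nat_le_iff of_nat_mult)
      have "u * k \<le> c * k" unfolding u_def c_def using CU r by (intro mult_right_mono) auto
      then have ku: "k \<le> X / u" using ck r by (simp add: field_simps)
      have "c * u \<le> c * k" unfolding u_def k_def using False r by (intro mult_left_mono) auto
      then have cu: "c \<le> X / u" using ck r by (simp add: field_simps)
      have e1: "k * c ^ 2 \<le> X ^ 2 / u"
        using mult_mono[OF ck cu] r by (simp add: power2_eq_square mult_ac)
      have e2: "k ^ 2 * c \<le> X ^ 2 / u"
        using mult_mono[OF ck ku] r by (simp add: power2_eq_square mult_ac)
      have ck2: "(c * k) ^ 2 \<le> X ^ 2" using ck r by (intro power_mono) auto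
      have "X * 1 \<le> X * u" using r U unfolding u_def by (intro mult_left_mono) auto
      then have "X / u \<le> X" using r by (simp add: divide_le_eq)
      then have cX: "c \<le> X" using cu by linarith
      have cs: "cap_sum_bound q (real (2 * C * K ^ 2)) (real C) \<le>
          10 * X ^ 2 / real q + 12 * (X ^ 2 / u) * G + 5 * X + 6 * real q * G"
      proof -
        have "cap_sum_bound q (real (2 * C * K ^ 2)) (real C) =
            (2 * c * k ^ 2 / real q + 1) * (5 * c + 6 * real q * (1 + ln (real q)))"
          by (simp add: cap_sum_bound_def c_def k_def)
        also have "\<dots> \<le> (2 * c * k ^ 2 / real q + 1) * (5 * c + 6 * real q * G)"
          using lq r q by (intro mult_left_mono add_left_mono) auto
        also have "\<dots> = 10 * (c * k) ^ 2 / real q + 12 * (k ^ 2 * c) * G + 5 * c + 6 * real q * G"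
          using q by (simp add: field_simps power2_eq_square)
        also have "\<dots> \<le> 10 * X ^ 2 / real q + 12 * (X ^ 2 / u) * G + 5 * X + 6 * real q * G"
          using ck2 e2 cX G0 q by (intro add_mono divide_right_mono mult_left_mono mult_right_mono) auto
        finally show ?thesis .
      qed
      have "norm (\<Sum>c=C+1..2*C. g c) ^ 4 \<le> G ^ 4 * G ^ 4 * (c * k) ^ 2 *
          (k * c ^ 2 + k ^ 2 * c + 4 * G * cap_sum_bound q (real (2 * C * K ^ 2)) (real C))"
        unfolding g_def c_def k_def
      proof (rule type2_block_le[OF ap C1 yK])
        show "norm (vaughan_coeff U k) \<le> G" if "1 \<le> k" "k \<le> K" for k using b that Kx by simp
        show "norm (if c \<le> U then 0 else mangoldt c :: complex) \<le> G" if "C < c" "c \<le> 2 * C" "c \<le> y" for c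
        proof -
          have "norm (mangoldt c :: complex) \<le> ln (real c)" using that by (simp add: mangoldt_le)
          also have "\<dots> \<le> ln (real x)" using that y by simp
          finally show ?thesis using lx G0 by simp
        qed
        show "real (card {d. d dvd n}) ^ 2 \<le> G" if "1 \<le> n" "n \<le> 2 * C * K ^ 2" for n
          using R that CK2 by simp
      qed (use G0 in auto)
      also have "\<dots> \<le> G ^ 4 * G ^ 4 * X ^ 2 * (X ^ 2 / u + X ^ 2 / u +
          4 * G * (10 * X ^ 2 / real q + 12 * (X ^ 2 / u) * G + 5 * X + 6 * real q * G))"
      proof (intro mult_mono mult_nonneg_nonneg add_mono)
        have "0 \<le> cap_sum_bound q (real (2 * C * K ^ 2)) (real C)"
          unfolding cap_sum_bound_def using q by (intro mult_nonneg_nonneg add_nonneg_nonneg) auto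
        then show "0 \<le> k * c ^ 2 + k ^ 2 * c + 4 * G * cap_sum_bound q (real (2 * C * K ^ 2)) (real C)"
          using r G0 by (intro add_nonneg_nonneg mult_nonneg_nonneg) auto
        show "0 \<le> cap_sum_bound q (real (2 * C * K ^ 2)) (real C)" by fact
      qed (use ck2 e1 e2 cs G0 in auto)
      also have "\<dots> = type2_bound q U x G"
        unfolding type2_bound_def X_def u_def by (simp flip: power_add)
      finally have "root 4 (norm (\<Sum>c=C+1..2*C. g c) ^ 4) \<le> root 4 (type2_bound q U x G)"
        by (intro real_root_le_mono) auto
      then show ?thesis unfolding C_def[symmetric] by (simp add: real_root_power_cancel)
    qed
  qed
  have "(\<Sum>c=1..y. g c) = (\<Sum>c=U+1..U*2^J. g c)"
  proof -
    have "1 * 2 ^ J \<le> U * 2 ^ J" using U by (rule mult_le_mono1)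
    then have "x \<le> U * 2 ^ J" using J by linarith
    then have "(\<Sum>c=1..y. g c) = (\<Sum>c=1..U*2^J. g c)"
      using y by (intro sum.mono_neutral_left) (auto simp: g_def)
    also have "\<dots> = (\<Sum>c=U+1..U*2^J. g c)"
      by (intro sum.mono_neutral_right) (auto simp: g_def)
    finally show ?thesis .
  qed
  also have "\<dots> = (\<Sum>j<J. \<Sum>c=U*2^j+1..2*(U*2^j). g c)" by (rule sum_dyadic[OF U])
  also have "norm \<dots> \<le> (\<Sum>j<J. root 4 (type2_bound q U x G))"
    by (intro sum_norm_le block)
  finally show ?thesis unfolding g_def by simp
qed

section \<open>From the von Mangoldt weight to primes\<close>

text \<open>An exponent of at least 2 forces the base below sqrt x, and 2^k \<le> p^k \<le> x < 2^J
  forces k < J.\<close>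

lemma card_proper_primepow_le:
  assumes "x < 2 ^ J"
  shows "real (card {n \<in> {1..x}. primepow n \<and> \<not> prime n}) \<le> (sqrt (real x) + 1) * real J"
proof -
  define m where "m = nat \<lfloor>sqrt (real x)\<rfloor>"
  have "{n \<in> {1..x}. primepow n \<and> \<not> prime n} \<subseteq> (\<lambda>(p, k). p ^ k) ` ({0..m} \<times> {..<J})"
  proof
    fix n assume n: "n \<in> {n \<in> {1..x}. primepow n \<and> \<not> prime n}"
    then obtain p k where pk: "prime p" "k > 0" "n = p ^ k" by (auto simp: primepow_def)
    have "k \<noteq> 1" using n pk by auto
    then have k2: "k \<ge> 2" using pk by simp
    have "p ^ 2 \<le> p ^ k" using k2 pk prime_gt_0_nat by (intro power_increasing) (auto simp: Suc_le_eq)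
    then have "p ^ 2 \<le> x" using n pk by simp
    then have "real p ^ 2 \<le> real x" by (metis of_nat_le_iff of_nat_power)
    then have "real p \<le> sqrt (real x)" by (rule real_le_rsqrt)
    then have "p \<le> m" unfolding m_def by (simp add: le_nat_floor)
    moreover have "p ^ k \<le> x" using n pk by simp
    moreover have "2 ^ k \<le> p ^ k" using pk prime_ge_2_nat by (intro power_mono) auto
    ultimately have pm: "p \<le> m" and "2 ^ k < (2::nat) ^ J" using assms by linarith+
    then have "k < J" by simp
    with pm show "n \<in> (\<lambda>(p, k). p ^ k) ` ({0..m} \<times> {..<J})" using pk by force
  qed
  then have "card {n \<in> {1..x}. primepow n \<and> \<not> prime n} \<le> card ({0..m} \<times> {..<J})"
    by (intro surj_card_le) auto
  also have "\<dots> = (m + 1) * J" by (simp add: card_cartesian_product)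
  finally have "real (card {n \<in> {1..x}. primepow n \<and> \<not> prime n}) \<le> real ((m + 1) * J)"
    by (simp only: of_nat_le_iff)
  also have "\<dots> = (real m + 1) * real J" by (simp add: algebra_simps)
  also have "\<dots> \<le> (sqrt (real x) + 1) * real J"
    unfolding m_def by (intro mult_right_mono add_right_mono) auto
  finally show ?thesis .
qed

text \<open>Proper prime powers are discarded trivially and the weight ln p is removed by partial
  summation; for this the bound is assumed for every y \<le> x.\<close>

lemma prime_sum_le_mangoldt_sum:
  fixes f :: "nat \<Rightarrow> complex"
  assumes f: "\<And>n. norm (f n) \<le> 1" and x: "x \<ge> 1" and J: "x < 2 ^ J"
    and B: "\<And>y. y \<le> x \<Longrightarrow> norm (\<Sum>n=1..y. mangoldt n * f n) \<le> B"
  shows "norm (\<Sum>p | prime p \<and> p \<le> x. f p) \<le> 2 * (B + (sqrt (real x) + 1) * real J * ln (real x))"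
proof -
  define g where "g = (\<lambda>n. if prime n then of_real (ln (real n)) * f n else 0)"
  \<comment> \<open>At n = 1 the quotient 1 / ln 1 would be 0 by convention and spoil monotonicity;
    \<open>max 2\<close> avoids this and changes no value at a prime.\<close>
  define w where "w = (\<lambda>n. 1 / ln (real (max 2 n)))"
  have lx: "ln (real x) \<ge> 0" using x by simp
  define D where "D = B + (sqrt (real x) + 1) * real J * ln (real x)"
  have g: "norm (\<Sum>n=1..y. g n) \<le> D" if y: "y \<le> x" for y
  proof -
    have "(\<Sum>n=1..y. mangoldt n * f n) - (\<Sum>n=1..y. g n) =
        (\<Sum>n\<in>{n \<in> {1..y}. primepow n \<and> \<not> prime n}. mangoldt n * f n)"
      unfolding sum_subtractf[symmetric]
      by (intro sum.mono_neutral_cong_right) (auto simp: g_def mangoldt_def dest: primepow_prime)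
    also have "norm \<dots> \<le> (\<Sum>n\<in>{n \<in> {1..y}. primepow n \<and> \<not> prime n}. ln (real x))"
    proof (rule sum_norm_le)
      fix n assume n: "n \<in> {n \<in> {1..y}. primepow n \<and> \<not> prime n}"
      have "norm (mangoldt n :: complex) \<le> ln (real n)" using n by (simp add: mangoldt_le)
      also have "\<dots> \<le> ln (real x)" using n y by simp
      finally have "norm (mangoldt n :: complex) * norm (f n) \<le> ln (real x) * 1"
        using f lx by (intro mult_mono) auto
      then show "norm (mangoldt n * f n) \<le> ln (real x)" by (simp only: norm_mult mult_1_right)
    qed
    also have "\<dots> \<le> (\<Sum>n\<in>{n \<in> {1..x}. primepow n \<and> \<not> prime n}. ln (real x))"
      using y lx by (intro sum_mono2) auto
    also have "\<dots> \<le> (sqrt (real x) + 1) * real J * ln (real x)"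
      using card_proper_primepow_le[OF J] lx by (simp add: mult_right_mono)
    finally have "norm ((\<Sum>n=1..y. mangoldt n * f n) - (\<Sum>n=1..y. g n)) \<le> (sqrt (real x) + 1) * real J * ln (real x)" .
    then show ?thesis
      unfolding D_def using B[OF y] norm_triangle_sub[of "\<Sum>n=1..y. g n" "\<Sum>n=1..y. mangoldt n * f n"]
      by (simp add: norm_minus_commute)
  qed
  have "(\<Sum>p | prime p \<and> p \<le> x. f p) = (\<Sum>n=1..x. of_real (w n) * g n)"
  proof (rule sum.mono_neutral_cong_left)
    show "{p. prime p \<and> p \<le> x} \<subseteq> {1..x}" by (auto simp: Suc_le_eq prime_gt_0_nat)
    show "f p = of_real (w p) * g p" if "p \<in> {p. prime p \<and> p \<le> x}" for p
    proof -
      have "p \<ge> 2" using that prime_ge_2_nat by simp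
      then show ?thesis using that by (simp add: w_def g_def max_def)
    qed
  qed (auto simp: g_def Suc_le_eq prime_gt_0_nat)
  also have "norm \<dots> \<le> w 1 * D"
  proof (rule norm_sum_mult_decreasing_le[OF x _ _ g])
    show "w (Suc m) \<le> w m" for m unfolding w_def by (intro divide_left_mono mult_pos_pos) auto
    show "0 \<le> w m" for m unfolding w_def by simp
  qed
  also have "\<dots> \<le> 2 * D"
  proof -
    have "1 / ln 2 \<le> (2::real)" using ln2_ge_two_thirds by (simp add: divide_le_eq)
    moreover have "D \<ge> 0" using g[of 0] by simp
    ultimately show ?thesis unfolding w_def by (intro mult_right_mono) auto
  qed
  finally show ?thesis unfolding D_def .
qed

section \<open>Squares of primes in minor arcs\<close>

text \<open>One constant for the logarithms, the Vaughan coefficients and the squared divisor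
  counts, so that a single \<open>G\<close> can stand for all of them.\<close>

lemma log_like_bound:
  fixes \<epsilon> :: real
  assumes \<epsilon>: "\<epsilon> > 0"
  obtains C where "C \<ge> 1"
    "\<And>x. x \<ge> 1 \<Longrightarrow> 1 + 2 * ln (real x) \<le> C * real x powr \<epsilon>"
    "\<And>x k. x \<ge> 1 \<Longrightarrow> 1 \<le> k \<Longrightarrow> k \<le> x \<Longrightarrow> 2 * real (card {d. d dvd k}) \<le> C * real x powr \<epsilon>"
    "\<And>x n. x \<ge> 1 \<Longrightarrow> 1 \<le> n \<Longrightarrow> n \<le> 2 * x ^ 2 \<Longrightarrow> real (card {d. d dvd n}) ^ 2 \<le> C * real x powr \<epsilon>"
proof -
  \<comment> \<open>A squared divisor count at n \<le> 2 x^2 yields (2 x^2) powr (2 \<delta>): the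
    bound \<epsilon> / 4 handles the power of x, the bound 1/2 keeps the power of 2 at most
    2.\<close>
  define \<delta> where "\<delta> = min (\<epsilon> / 4) (1 / 2)"
  have \<delta>: "\<delta> > 0" "\<delta> \<le> \<epsilon> / 4" "\<delta> \<le> 1 / 2" unfolding \<delta>_def using \<epsilon> by auto
  obtain D where D: "D \<ge> 1" "\<And>n. n > 0 \<Longrightarrow> real (card {d. d dvd n}) \<le> D * real n powr \<delta>"
    using divisor_bound[OF \<delta>(1)] by blast
  define C where "C = 1 + 2 / \<epsilon> + 2 * D ^ 2"
  have D2: "D \<le> D ^ 2" "1 \<le> D ^ 2" using D(1) mult_mono[of 1 D 1 D] by (auto simp: power2_eq_square)
  have C: "1 + 2 / \<epsilon> \<le> C" "2 * D \<le> C" "2 * D ^ 2 \<le> C"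
    using D2 D(1) divide_nonneg_pos[of 2 \<epsilon>] \<epsilon> unfolding C_def by linarith+
  show ?thesis
  proof
    show "C \<ge> 1" using C(3) D2 by linarith
    fix x :: nat assume x: "x \<ge> 1"
    have p1: "1 \<le> real x powr \<epsilon>" using x \<epsilon> by (intro ge_one_powr_ge_zero) auto
    have "ln (real x) \<le> real x powr \<epsilon> / \<epsilon>" using x \<epsilon> by (intro ln_powr_bound) auto
    then have "1 + 2 * ln (real x) \<le> (1 + 2 / \<epsilon>) * real x powr \<epsilon>" using p1 by (simp add: algebra_simps)
    also have "\<dots> \<le> C * real x powr \<epsilon>" using C by (intro mult_right_mono) auto
    finally show "1 + 2 * ln (real x) \<le> C * real x powr \<epsilon>" .
    show "2 * real (card {d. d dvd k}) \<le> C * real x powr \<epsilon>" if k: "1 \<le> k" "k \<le> x" for k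
    proof -
      have "real k powr \<delta> \<le> real x powr \<delta>" using k \<delta> by (intro powr_mono2) auto
      also have "\<dots> \<le> real x powr \<epsilon>" using x \<delta> \<epsilon> by (intro powr_mono) auto
      finally have "D * real k powr \<delta> \<le> D * real x powr \<epsilon>" using D(1) by (intro mult_left_mono) auto
      then have "2 * real (card {d. d dvd k}) \<le> 2 * D * real x powr \<epsilon>" using D(2)[of k] k by simp
      also have "\<dots> \<le> C * real x powr \<epsilon>" using C by (intro mult_right_mono) auto
      finally show ?thesis .
    qed
    show "real (card {d. d dvd n}) ^ 2 \<le> C * real x powr \<epsilon>" if n: "1 \<le> n" "n \<le> 2 * x ^ 2" for n
    proof -
      have nx: "real n \<le> 2 * real x ^ 2" using n(2) by (metis of_nat_le_iff of_nat_mult of_nat_numeral of_nat_power)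
      have "real (card {d. d dvd n}) ^ 2 \<le> (D * real n powr \<delta>) ^ 2"
        using D(2)[of n] n by (intro power_mono) auto
      also have "\<dots> = D ^ 2 * real n powr (2 * \<delta>)"
        using n by (simp add: power_mult_distrib powr_powr mult.commute flip: powr_numeral)
      also have "\<dots> \<le> D ^ 2 * (2 * real x ^ 2) powr (2 * \<delta>)"
        using nx n \<delta> by (intro mult_left_mono powr_mono2) auto
      also have "(2 * real x ^ 2) powr (2 * \<delta>) = 2 powr (2 * \<delta>) * real x powr (4 * \<delta>)"
        using x by (simp add: powr_mult powr_powr flip: powr_numeral)
      also have "\<dots> \<le> 2 powr 1 * real x powr \<epsilon>"
        using x \<delta> by (intro mult_mono powr_mono) auto
      also have "D ^ 2 * (2 powr 1 * real x powr \<epsilon>) = (2 * D ^ 2) * real x powr \<epsilon>" by simp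
      also have "\<dots> \<le> C * real x powr \<epsilon>" using C by (intro mult_right_mono) auto
      finally show ?thesis by (simp add: mult_left_mono)
    qed
  qed
qed

lemma mangoldt_square_sum_le:
  fixes \<alpha> G :: real and x y U q J :: nat
  assumes ap: "rational_approx \<alpha> q" and y: "y \<le> x" and U: "U \<ge> 1" and x: "x \<ge> 1" and J: "x < 2 ^ J"
    and lx: "ln (real x) \<le> G" and lq: "1 + ln (real q) \<le> G"
    and b: "\<And>k. 1 \<le> k \<Longrightarrow> k \<le> x \<Longrightarrow> norm (vaughan_coeff U k) \<le> G"
    and R: "\<And>n. 1 \<le> n \<Longrightarrow> n \<le> 2 * x ^ 2 \<Longrightarrow> real (card {d. d dvd n}) ^ 2 \<le> G"
  shows "norm (\<Sum>n=1..y. mangoldt n * ee (\<alpha> * real n ^ 2)) \<le>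
    real U * G + 3 * real U ^ 2 * G * type1_bound q U x + real J * root 4 (type2_bound q U x G)"
proof -
  have lx0: "0 \<le> ln (real x)" using x by simp
  then have G0: "G \<ge> 0" using lx by linarith
  have "norm (\<Sum>n=1..y. (if n \<le> U then mangoldt n else 0) * ee (\<alpha> * real n ^ 2)) \<le> (\<Sum>n=1..y. if n \<le> U then G else 0)"
  proof (rule sum_norm_le)
    fix n assume n: "n \<in> {1..y}"
    have "norm (mangoldt n :: complex) \<le> ln (real n)" using n by (simp add: mangoldt_le)
    also have "\<dots> \<le> ln (real x)" using n y by simp
    finally show "norm ((if n \<le> U then mangoldt n else 0) * ee (\<alpha> * real n ^ 2)) \<le> (if n \<le> U then G else 0)"
      using lx by (simp add: norm_mult)
  qed
  also have "\<dots> = real (card {n \<in> {1..y}. n \<le> U}) * G" by (simp add: sum.If_cases Int_def)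
  also have "\<dots> \<le> real U * G"
  proof -
    have "card {d \<in> {1..y}. d \<le> U} \<le> card {1..U}" by (intro card_mono) auto
    then show ?thesis using G0 by (intro mult_right_mono) auto
  qed
  finally have 1: "norm (\<Sum>n=1..y. (if n \<le> U then mangoldt n else 0) * ee (\<alpha> * real n ^ 2)) \<le> real U * G" .
  have T0: "0 \<le> type1_bound q U x"
    using order_trans[OF norm_ge_zero type1_sum_le[OF ap, of 1 U 0 x]] U by simp
  note 2 = type1_total_le[OF ap y U x]
  have "3 * real U ^ 2 * ln (real x) * type1_bound q U x \<le> 3 * real U ^ 2 * G * type1_bound q U x"
    using lx T0 by (intro mult_right_mono mult_left_mono) auto
  note 2 = order_trans[OF 2 this]
  note 3 = type2_total_le[OF ap y U x J lx lq b R]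
  show ?thesis
    unfolding vaughan_identity[of "\<lambda>n. ee (\<alpha> * real n ^ 2)" y U]
    by (intro order_trans[OF norm_triangle_ineq] add_mono 1 2 3)
qed

text \<open>The choice \<open>U \<approx> x\<^sup>0\<^sup>.\<^sup>0\<^sup>5\<^sup>6\<close> makes type I contribute exponent \<open>0.984\<close> and type II \<open>0.986\<close>, up to
  factors \<open>x\<^sup>\<epsilon>\<close>.\<close>
lemma prime_square_sum_bound:
  obtains C where "C > 0" "\<And>x \<alpha> q. x \<ge> 1 \<Longrightarrow> rational_approx \<alpha> q \<Longrightarrow> real x powr 0.48 \<le> real q \<Longrightarrow>
     real q \<le> real x powr 1.52 \<Longrightarrow>
     norm (\<Sum>p | prime p \<and> p \<le> x. ee (\<alpha> * real p ^ 2)) \<le> C * real x powr 0.987"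
proof -
  \<comment> \<open>\<open>G\<close> occurs to the fourth power in the final estimate, so the
    exponent 0.00025 raises 0.986 to 0.987.\<close>
  obtain C where C: "C \<ge> 1"
    "\<And>x. x \<ge> 1 \<Longrightarrow> 1 + 2 * ln (real x) \<le> C * real x powr 0.00025"
    "\<And>x k. x \<ge> 1 \<Longrightarrow> 1 \<le> k \<Longrightarrow> k \<le> x \<Longrightarrow> 2 * real (card {d. d dvd k}) \<le> C * real x powr 0.00025"
    "\<And>x n. x \<ge> 1 \<Longrightarrow> 1 \<le> n \<Longrightarrow> n \<le> 2 * x ^ 2 \<Longrightarrow> real (card {d. d dvd n}) ^ 2 \<le> C * real x powr 0.00025"
    by (rule log_like_bound[of "0.00025"]) auto
  \<comment> \<open>68 = 2 * (32 + 2): the terms of Vaughan's identity give 1 + 27 + 4, the prime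
    powers give 2, and removing the weight ln p doubles the total.\<close>
  have "norm (\<Sum>p | prime p \<and> p \<le> x. ee (\<alpha> * real p ^ 2)) \<le> 68 * C ^ 4 * real x powr 0.987"
    if x: "x \<ge> 1" and ap: "rational_approx \<alpha> q" and q1: "real x powr 0.48 \<le> real q" and q2: "real q \<le> real x powr 1.52"
    for x \<alpha> q
  proof -
    define X where "X = real x"
    define G where "G = C * X powr 0.00025"
    define U where "U = nat \<lfloor>X powr 0.056\<rfloor>"
    define J where "J = nat \<lfloor>log 2 X\<rfloor> + 1"
    have X: "X \<ge> 1" unfolding X_def using x by simp
    have q: "q > 0" using ap by (simp add: rational_approx_def)
    have pX: "1 \<le> X powr s" if "s \<ge> 0" for s using X that by (intro ge_one_powr_ge_zero) auto
    have mono: "X powr s \<le> X powr t" if "s \<le> t" for s t using X that by (intro powr_mono) auto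
    have G1: "G \<ge> 1" unfolding G_def using C(1) pX[of "0.00025"] mult_mono[of 1 C 1 "X powr 0.00025"] by simp
    have lX0: "0 \<le> ln X" using X by simp
    have lX: "1 + 2 * ln X \<le> G" using C(2)[OF x] unfolding X_def G_def .
    have lx: "ln (real x) \<le> G" using lX lX0 unfolding X_def by linarith
    have lq: "1 + ln (real q) \<le> G"
    proof -
      have "real q \<le> X powr 2" by (rule order_trans[OF q2[folded X_def] mono]) simp
      then have "ln (real q) \<le> ln (X powr 2)" using q by (subst ln_le_cancel_iff) auto
      also have "\<dots> = 2 * ln X" by (simp add: ln_powr)
      finally show ?thesis using lX by linarith
    qed
    have J: "x < 2 ^ J"
    proof -
      have "log 2 X < real J" unfolding J_def using X by linarith
      then have "X < 2 powr real J" using X by (simp add: log_less_iff)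
      then show ?thesis unfolding X_def by (simp add: powr_realpow)
    qed
    have JG: "real J \<le> G"
    proof -
      have "real J \<le> log 2 X + 1" unfolding J_def using X by simp
      also have "log 2 X = ln X / ln 2" by (simp add: log_def)
      also have "\<dots> \<le> ln X / (1 / 2)"
        using ln2_ge_two_thirds lX0 by (intro divide_left_mono) auto
      finally show ?thesis using lX by simp
    qed
    have U: "U \<ge> 1" unfolding U_def using pX[of "0.056"] by (simp add: le_nat_iff le_floor_iff)
    have U1: "real U \<le> X powr 0.056" unfolding U_def by simp
    have U2: "X powr 0.056 / 2 \<le> real U"
    proof -
      have "X powr 0.056 < real U + 1" unfolding U_def by linarith
      then show ?thesis using U by simp
    qed
    have Xp: "X = X powr 1" "X ^ 2 = X powr 2" using X by auto
    \<comment> \<open>The worst term is U^4 x^2 / q of exponent 0.224 + 2 - 0.48 = 1.744, halved by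
      the square root to 0.872; the factor U^2 then adds 0.112.\<close>
    have T: "type1_bound q U x \<le> 9 * G * X powr 0.872"
      unfolding type1_bound_def
    proof (rule real_le_lsqrt)
      have u4: "real U ^ 4 \<le> X powr 0.224"
      proof -
        have "real U ^ 4 \<le> (X powr 0.056) ^ 4" using U1 by (intro power_mono) auto
        also have "\<dots> = X powr 0.224" using X by (simp add: powr_powr flip: powr_numeral)
        finally show ?thesis .
      qed
      have "cap_sum_bound q (real (2 * U ^ 4 * x)) (real x) =
          (2 * real U ^ 4 * X / real q + 1) * (5 * X + 6 * real q * (1 + ln (real q)))"
        by (simp add: cap_sum_bound_def X_def)
      also have "\<dots> \<le> (2 * real U ^ 4 * X / real q + 1) * (5 * X + 6 * real q * G)"
        using lq q X by (intro mult_left_mono add_left_mono) auto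
      also have "\<dots> = 10 * (real U ^ 4 * X ^ 2 / real q) + 12 * (real U ^ 4 * X) * G + 5 * X + 6 * real q * G"
        using q by (simp add: field_simps power2_eq_square)
      also have "\<dots> \<le> 10 * X powr 1.744 * G + 12 * X powr 1.744 * G + 5 * X powr 1.744 * G + 6 * X powr 1.744 * G"
      proof (intro add_mono)
        have "real U ^ 4 * X ^ 2 / real q \<le> X powr 0.224 * X powr 2 / X powr 0.48"
          using u4 q1 X Xp unfolding X_def by (intro frac_le mult_mono) auto
        also have "\<dots> = X powr 1.744" by (simp only: powr_add[symmetric] powr_diff[symmetric]) simp
        also have "\<dots> \<le> X powr 1.744 * G" using G1 X by (simp add: mult_le_cancel_left1)
        finally show "10 * (real U ^ 4 * X ^ 2 / real q) \<le> 10 * X powr 1.744 * G" by simp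
        have "real U ^ 4 * X \<le> X powr 0.224 * X powr 1" using u4 X Xp by (intro mult_mono) auto
        also have "\<dots> = X powr 1.224" by (simp only: powr_add[symmetric]) simp
        also have "\<dots> \<le> X powr 1.744" by (rule mono) simp
        finally show "12 * (real U ^ 4 * X) * G \<le> 12 * X powr 1.744 * G"
          using G1 by (intro mult_right_mono mult_left_mono) auto
        have "X \<le> X powr 1.744" using mono[of 1 "1.744"] X by simp
        then have "X * 1 \<le> X powr 1.744 * G" using G1 X by (intro mult_mono) auto
        then show "5 * X \<le> 5 * X powr 1.744 * G" by simp
        have "real q \<le> X powr 1.744" by (rule order_trans[OF q2[folded X_def] mono]) simp
        then show "6 * real q * G \<le> 6 * X powr 1.744 * G"
          using G1 by (intro mult_right_mono mult_left_mono) auto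
      qed
      finally have cs: "cap_sum_bound q (real (2 * U ^ 4 * x)) (real x) \<le> 33 * X powr 1.744 * G" by (simp add: algebra_simps)
      have "X \<le> X powr 1.744" using mono[of 1 "1.744"] X by simp
      then have "X * 1 \<le> X powr 1.744 * G" using G1 X by (intro mult_mono) auto
      then have "real x + 2 * cap_sum_bound q (real (2 * U ^ 4 * x)) (real x) \<le> 67 * (X powr 1.744 * G)"
        using cs unfolding X_def by (simp add: algebra_simps)
      also have "\<dots> \<le> 81 * (X powr 1.744 * G ^ 2)"
        using G1 X by (intro mult_mono) (auto simp: power2_eq_square)
      also have "\<dots> = (9 * G * X powr 0.872) ^ 2"
        using X by (simp add: power_mult_distrib powr_powr flip: powr_numeral)
      finally show "real x + 2 * cap_sum_bound q (real (2 * U ^ 4 * x)) (real x) \<le> (9 * G * X powr 0.872) ^ 2" .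
      show "0 \<le> 9 * G * X powr 0.872" using G1 by simp
    qed
    have T0: "0 \<le> type1_bound q U x"
      using order_trans[OF norm_ge_zero type1_sum_le[OF ap, of 1 U 0 x]] U by simp
    have t1: "3 * real U ^ 2 * G * type1_bound q U x \<le> 27 * G ^ 4 * X powr 0.986"
    proof -
      have "real U ^ 2 \<le> (X powr 0.056) ^ 2" using U1 by (intro power_mono) auto
      also have "\<dots> = X powr 0.112" using X by (simp add: powr_powr flip: powr_numeral)
      finally have "3 * real U ^ 2 * G * type1_bound q U x \<le> 3 * X powr 0.112 * G * (9 * G * X powr 0.872)"
        using T T0 G1 by (intro mult_mono) auto
      also have "\<dots> = 27 * G ^ 2 * (X powr 0.112 * X powr 0.872)"
        by (simp add: power2_eq_square)
      also have "X powr 0.112 * X powr 0.872 = X powr 0.984"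
        by (simp only: powr_add[symmetric]) simp
      also have "27 * G ^ 2 * X powr 0.984 \<le> 27 * G ^ 4 * X powr 0.986"
        using G1 mono[of "0.984" "0.986"] by (intro mult_mono power_increasing) auto
      finally show ?thesis .
    qed
    \<comment> \<open>The worst term is x^2 / U of exponent 1.944; with the leading x^2 this is
      3.944, a quarter of which is 0.986.\<close>
    have t2: "real J * root 4 (type2_bound q U x G) \<le> 4 * G ^ 4 * X powr 0.986"
    proof -
      have x2U: "X ^ 2 / real U \<le> 2 * X powr 1.944"
      proof -
        have "X ^ 2 / real U \<le> X powr 2 / (X powr 0.056 / 2)"
          using U2 X Xp by (intro frac_le) auto
        also have "\<dots> = 2 * (X powr 2 / X powr 0.056)" by simp
        also have "\<dots> = 2 * X powr 1.944" by (simp only: powr_diff[symmetric]) simp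
        finally show ?thesis .
      qed
      have x2q: "X ^ 2 / real q \<le> X powr 1.944"
      proof -
        have "X ^ 2 / real q \<le> X powr 2 / X powr 0.48"
          using q1 X Xp unfolding X_def by (intro frac_le) auto
        also have "\<dots> = X powr 1.52" by (simp only: powr_diff[symmetric]) simp
        also have "\<dots> \<le> X powr 1.944" by (rule mono) simp
        finally show ?thesis .
      qed
      have "type2_bound q U x G = G ^ 8 * X ^ 2 * (2 * (X ^ 2 / real U) +
          4 * G * (10 * (X ^ 2 / real q) + 12 * (X ^ 2 / real U) * G + 5 * X + 6 * real q * G))"
        by (simp add: type2_bound_def X_def)
      also have "\<dots> \<le> G ^ 8 * X powr 2 * (4 * X powr 1.944 * G ^ 2 + 4 * G * (45 * X powr 1.944 * G))"
      proof -
        have "2 * (X ^ 2 / real U) \<le> 4 * X powr 1.944" using x2U by simp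
        moreover have "1 \<le> G ^ 2" using G1 by (rule one_le_power)
        ultimately have "2 * (X ^ 2 / real U) * 1 \<le> (4 * X powr 1.944) * G ^ 2"
          by (rule mult_mono) auto
        then have a: "2 * (X ^ 2 / real U) \<le> 4 * X powr 1.944 * G ^ 2" by simp
        have "X ^ 2 / real q * 1 \<le> X powr 1.944 * G" using x2q G1 by (intro mult_mono) auto
        moreover have "X ^ 2 / real U * G \<le> 2 * X powr 1.944 * G" using x2U G1 by (intro mult_right_mono) auto
        then have "X ^ 2 / real U * G \<le> 2 * (X powr 1.944 * G)" by (simp only: mult.assoc)
        moreover have "X * 1 \<le> X powr 1.944 * G" using mono[of 1 "1.944"] X G1 by (intro mult_mono) auto
        moreover have "real q \<le> X powr 1.944" by (rule order_trans[OF q2[folded X_def] mono]) simp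
        then have "real q * G \<le> X powr 1.944 * G" using G1 by (intro mult_right_mono) auto
        ultimately have b: "10 * (X ^ 2 / real q) + 12 * (X ^ 2 / real U) * G + 5 * X + 6 * real q * G \<le> 45 * X powr 1.944 * G"
          unfolding mult.assoc[of "12::real"] mult.assoc[of "6::real"] mult.assoc[of "45::real"] by linarith
        have "4 * G * (10 * (X ^ 2 / real q) + 12 * (X ^ 2 / real U) * G + 5 * X + 6 * real q * G) \<le> 4 * G * (45 * X powr 1.944 * G)"
          using G1 by (intro mult_left_mono b) auto
        then show ?thesis unfolding Xp(2) using a G1 by (intro mult_left_mono add_mono) (auto simp: Xp(2))
      qed
      also have "\<dots> = 184 * (G ^ 10 * (X powr 2 * X powr 1.944))"
        by (simp add: algebra_simps power_numeral_reduce)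
      also have "X powr 2 * X powr 1.944 = X powr 3.944"
        by (simp only: powr_add[symmetric]) simp
      also have "184 * (G ^ 10 * X powr 3.944) \<le> 256 * (G ^ 12 * X powr 3.944)"
        using G1 by (intro mult_mono mult_right_mono power_increasing) auto
      also have "\<dots> = (4 * G ^ 3 * X powr 0.986) ^ 4"
        using X by (simp add: power_mult_distrib powr_powr flip: powr_numeral power_mult)
      finally have "root 4 (type2_bound q U x G) \<le> root 4 ((4 * G ^ 3 * X powr 0.986) ^ 4)"
        by (intro real_root_le_mono) auto
      also have "\<dots> = 4 * G ^ 3 * X powr 0.986" using G1 by (intro real_root_power_cancel) auto
      finally have "real J * root 4 (type2_bound q U x G) \<le> G * (4 * G ^ 3 * X powr 0.986)"
        using JG G1 by (intro mult_mono) (auto simp: type2_bound_def intro!: mult_nonneg_nonneg add_nonneg_nonneg)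
      then show ?thesis by (simp add: power_numeral_reduce mult_ac)
    qed
    have t0: "real U * G \<le> G ^ 4 * X powr 0.986"
    proof -
      have "real U \<le> X powr 0.986" using U1 mono[of "0.056" "0.986"] by simp
      then have "real U * G \<le> X powr 0.986 * G ^ 4"
        using G1 power_increasing[of 1 4 G] by (intro mult_mono) auto
      then show ?thesis by (simp add: mult.commute)
    qed
    have t3: "(sqrt (real x) + 1) * real J * ln (real x) \<le> 2 * G ^ 4 * X powr 0.986"
    proof -
      have "sqrt (real x) = X powr (1 / 2)" unfolding X_def by (simp add: powr_half_sqrt)
      also have "\<dots> \<le> X powr 0.986" by (rule mono) simp
      finally have "sqrt (real x) + 1 \<le> 2 * X powr 0.986" using pX[of "0.986"] by simp
      then have "(sqrt (real x) + 1) * real J * ln (real x) \<le> 2 * X powr 0.986 * G * G"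
        using JG lx lX0 G1 unfolding X_def by (intro mult_mono) auto
      also have "\<dots> = 2 * G ^ 2 * X powr 0.986" by (simp add: power2_eq_square mult_ac)
      also have "\<dots> \<le> 2 * G ^ 4 * X powr 0.986"
        using G1 by (intro mult_right_mono mult_left_mono power_increasing) auto
      finally show ?thesis .
    qed
    have B: "norm (\<Sum>n=1..y. mangoldt n * ee (\<alpha> * real n ^ 2)) \<le> 32 * G ^ 4 * X powr 0.986" if "y \<le> x" for y
    proof -
      have "norm (\<Sum>n=1..y. mangoldt n * ee (\<alpha> * real n ^ 2)) \<le>
        real U * G + 3 * real U ^ 2 * G * type1_bound q U x + real J * root 4 (type2_bound q U x G)"
      proof (rule mangoldt_square_sum_le[OF ap that U x J lx lq])
        show "norm (vaughan_coeff U k) \<le> G" if "1 \<le> k" "k \<le> x" for k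
          using norm_vaughan_coeff_le[OF that(1), of U] C(3)[OF x that] unfolding G_def X_def by linarith
        show "real (card {d. d dvd n}) ^ 2 \<le> G" if "1 \<le> n" "n \<le> 2 * x ^ 2" for n
          using C(4)[OF x that] unfolding G_def X_def .
      qed
      then show ?thesis using t0 t1 t2 by (simp add: algebra_simps)
    qed
    have "norm (\<Sum>p | prime p \<and> p \<le> x. ee (\<alpha> * real p ^ 2)) \<le>
        2 * (32 * G ^ 4 * X powr 0.986 + (sqrt (real x) + 1) * real J * ln (real x))"
      by (rule prime_sum_le_mangoldt_sum[OF _ x J B]) auto
    also have "\<dots> \<le> 68 * (G ^ 4 * X powr 0.986)" using t3 by (simp add: algebra_simps)
    also have "G ^ 4 * X powr 0.986 = C ^ 4 * X powr 0.987"
    proof -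
      have "(X powr 0.00025) ^ 4 = X powr 0.001" using X by (simp add: powr_powr flip: powr_numeral)
      then have "G ^ 4 * X powr 0.986 = C ^ 4 * (X powr 0.001 * X powr 0.986)"
        unfolding G_def by (simp add: power_mult_distrib)
      also have "X powr 0.001 * X powr 0.986 = X powr 0.987"
        by (simp only: powr_add[symmetric]) simp
      finally show ?thesis .
    qed
    finally show ?thesis unfolding X_def by simp
  qed
  then show ?thesis using that[of "68 * C ^ 4"] C(1) by simp
qed

section \<open>Diophantine approximation and the circle method\<close>

text \<open>Liouville's argument: the quadratic polynomial at p / q is n / q^2 with an integer n,
  nonzero because the conjugate root is irrational as well. Dividing out r - \<eta> leaves a factor
  bounded by \<open>A\<close> when |r - \<eta>| \<le> 1; otherwise the claim is immediate.\<close>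

lemma quadratic_irrationality_badly_approximable:
  assumes "quadratic_irrationality \<eta>"
  obtains c where "c > 0" "\<And>p q :: int. q \<noteq> 0 \<Longrightarrow> c / of_int q ^ 2 \<le> \<bar>\<eta> - of_int p / of_int q\<bar>"
proof -
  obtain u v w :: int where u: "u \<noteq> 0" and eq: "of_int u * \<eta> ^ 2 + of_int v * \<eta> + of_int w = 0"
    and irr: "\<eta> \<notin> \<rat>"
    using assms unfolding quadratic_irrationality_def by auto
  define A where "A = \<bar>real_of_int u\<bar> * (2 * \<bar>\<eta>\<bar> + 1) + \<bar>of_int v\<bar>"
  have "1 * 1 \<le> \<bar>real_of_int u\<bar> * (2 * \<bar>\<eta>\<bar> + 1)"
    using u by (intro mult_mono) linarith+
  then have A1: "A \<ge> 1" unfolding A_def by simp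
  have "(1 / A) / of_int q ^ 2 \<le> \<bar>\<eta> - of_int p / of_int q\<bar>" if q: "q \<noteq> 0" for p q :: int
  proof (cases "\<bar>\<eta> - of_int p / of_int q\<bar> \<le> 1")
    case False
    have "1 \<le> q ^ 2" using q by (simp add: int_one_le_iff_zero_less)
    then have "1 \<le> (real_of_int q) ^ 2" by (metis of_int_1_le_iff of_int_power)
    then have "1 * 1 \<le> A * (real_of_int q) ^ 2" using A1 by (intro mult_mono) auto
    then have "(1 / A) / of_int q ^ 2 \<le> 1" by simp
    then show ?thesis using False by linarith
  next
    case True
    define r where "r = real_of_int p / of_int q"
    define n where "n = u * p ^ 2 + v * p * q + w * q ^ 2"
    have q0: "real_of_int q ^ 2 > 0" using q by simp
    have nq: "of_int n / real_of_int q ^ 2 = of_int u * r ^ 2 + of_int v * r + of_int w"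
      unfolding n_def r_def using q by (simp add: field_simps power2_eq_square)
    have fac: "of_int u * r ^ 2 + of_int v * r + of_int w = (r - \<eta>) * (of_int u * (r + \<eta>) + of_int v)"
      using eq by (simp add: algebra_simps power2_eq_square)
    have rr: "r \<in> \<rat>" unfolding r_def by simp
    have "n \<noteq> 0"
    proof
      assume "n = 0"
      then have "(r - \<eta>) * (of_int u * (r + \<eta>) + of_int v) = 0" using nq fac by simp
      moreover have "r \<noteq> \<eta>" using rr irr by auto
      ultimately have "of_int u * (r + \<eta>) + of_int v = 0" by simp
      then have "\<eta> = - of_int v / of_int u - r" using u by (simp add: field_simps)
      moreover have "- of_int v / of_int u - r \<in> \<rat>" using rr by (intro Rats_diff Rats_divide) auto
      ultimately show False using irr by simp
    qed
    then have "1 \<le> \<bar>real_of_int n\<bar>" by linarith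
    then have "1 / real_of_int q ^ 2 \<le> \<bar>of_int n / real_of_int q ^ 2\<bar>"
      using q0 by (simp add: divide_right_mono)
    also have "\<dots> = \<bar>r - \<eta>\<bar> * \<bar>of_int u * (r + \<eta>) + of_int v\<bar>"
      unfolding nq fac abs_mult ..
    also have "\<dots> \<le> \<bar>r - \<eta>\<bar> * A"
    proof (intro mult_left_mono)
      have "\<bar>r + \<eta>\<bar> \<le> 2 * \<bar>\<eta>\<bar> + 1" using True unfolding r_def by linarith
      then have "\<bar>of_int u * (r + \<eta>)\<bar> \<le> \<bar>of_int u\<bar> * (2 * \<bar>\<eta>\<bar> + 1)"
        unfolding abs_mult by (intro mult_left_mono) auto
      then show "\<bar>of_int u * (r + \<eta>) + of_int v\<bar> \<le> A" unfolding A_def by linarith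
    qed simp
    finally have "1 / real_of_int q ^ 2 / A \<le> \<bar>r - \<eta>\<bar> * A / A" using A1 by (intro divide_right_mono) auto
    also have "\<dots> = \<bar>\<eta> - r\<bar>" using A1 by (simp add: abs_minus_commute)
    finally show ?thesis unfolding r_def by (simp only: divide_divide_eq_left mult.commute)
  qed
  then show ?thesis using that[of "1 / A"] A1 by simp
qed

definition prime_exp_sum :: "nat \<Rightarrow> real \<Rightarrow> complex" where
  "prime_exp_sum x \<alpha> = (\<Sum>p | prime p \<and> p \<le> x. ee (\<alpha> * real p ^ 2))"

text \<open>The sharp error 1 / (q Q) is kept beside \<open>rational_approx\<close>: the exponential
  sum bound uses the latter, the comparison of two shifts needs the former.\<close>

lemma dirichlet_rational_approx:
  assumes "Q > 0"
  obtains a q where "q > 0" "q \<le> Q" "rational_approx \<alpha> q" "\<bar>\<alpha> - of_int a / real q\<bar> \<le> 1 / (real q * real Q)"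
proof -
  obtain h k where hk: "coprime h k" "0 < k" "k \<le> int Q" "\<bar>of_int k * \<alpha> - of_int h\<bar> < 1 / real Q"
    using Dirichlet_approx_coprime[OF assms] by metis
  define q where "q = nat k"
  have q: "int q = k" "q > 0" "q \<le> Q" unfolding q_def using hk by auto
  then have rq: "real_of_int k = real q" by (metis of_int_of_nat_eq)
  have "\<alpha> - of_int h / real q = (of_int k * \<alpha> - of_int h) / real q" using q rq by (simp add: field_simps)
  then have "\<bar>\<alpha> - of_int h / real q\<bar> = \<bar>of_int k * \<alpha> - of_int h\<bar> / real q" by simp
  also have "\<dots> \<le> (1 / real Q) / real q" using hk by (intro divide_right_mono) auto
  finally have b: "\<bar>\<alpha> - of_int h / real q\<bar> \<le> 1 / (real q * real Q)" by (simp add: mult.commute)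
  also have "\<dots> \<le> 1 / real q ^ 2" unfolding power2_eq_square
    using q by (intro divide_left_mono mult_left_mono mult_pos_pos) auto
  finally have "rational_approx \<alpha> q" unfolding rational_approx_def using q hk by auto
  then show ?thesis using that q b by blast
qed

text \<open>If both \<open>\<alpha>\<close> and \<open>\<alpha> + m \<eta>\<close> were close to fractions with small denominators,
  then so would be \<open>\<eta>\<close>.\<close>
lemma prime_exp_sum_dichotomy:
  assumes "quadratic_irrationality \<eta>"
  obtains B x0 where "B > 0"
    "\<And>x \<alpha> m. x \<ge> x0 \<Longrightarrow> m \<noteq> 0 \<Longrightarrow> \<bar>of_int m\<bar> \<le> real x powr 0.05 \<Longrightarrow>
      norm (prime_exp_sum x \<alpha>) \<le> B * real x powr 0.987 \<or>
      norm (prime_exp_sum x (\<alpha> + of_int m * \<eta>)) \<le> B * real x powr 0.987"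
proof -
  obtain c where c: "c > 0" "\<And>p q :: int. q \<noteq> 0 \<Longrightarrow> c / of_int q ^ 2 \<le> \<bar>\<eta> - of_int p / of_int q\<bar>"
    using quadratic_irrationality_badly_approximable[OF assms] by blast
  obtain B where B: "B > 0" "\<And>x \<alpha> q. x \<ge> 1 \<Longrightarrow> rational_approx \<alpha> q \<Longrightarrow> real x powr 0.48 \<le> real q \<Longrightarrow>
     real q \<le> real x powr 1.52 \<Longrightarrow> norm (prime_exp_sum x \<alpha>) \<le> B * real x powr 0.987"
    by (rule prime_square_sum_bound) (auto simp: prime_exp_sum_def)
  define x0 where "x0 = nat \<lceil>(4 / c) powr (1 / 0.03)\<rceil> + 1"
  show ?thesis
  proof
    show "B > 0" by fact
    fix x :: nat and \<alpha> :: real and m :: int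
    assume x: "x \<ge> x0" and m: "m \<noteq> 0" and mx: "\<bar>of_int m\<bar> \<le> real x powr 0.05"
    define X where "X = real x"
    have x1: "x \<ge> 1" using x unfolding x0_def by simp
    have X1: "X \<ge> 1" unfolding X_def using x1 by simp
    define Q where "Q = nat \<lfloor>X powr 1.52\<rfloor>"
    have "1 \<le> X powr 1.52" using X1 by (intro ge_one_powr_ge_zero) auto
    then have fl: "1 \<le> \<lfloor>X powr 1.52\<rfloor>" by (simp add: le_floor_iff)
    then have rQ: "real Q = of_int \<lfloor>X powr 1.52\<rfloor>" unfolding Q_def by simp
    have Q: "Q > 0" "real Q \<le> X powr 1.52" "X powr 1.52 \<le> 2 * real Q"
      using fl rQ floor_correct[of "X powr 1.52"] by linarith+
    obtain a1 q1 where q1: "q1 > 0" "q1 \<le> Q" "rational_approx \<alpha> q1" "\<bar>\<alpha> - of_int a1 / real q1\<bar> \<le> 1 / (real q1 * real Q)"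
      by (rule dirichlet_rational_approx[OF Q(1)])
    obtain a2 q2 where q2: "q2 > 0" "q2 \<le> Q" "rational_approx (\<alpha> + of_int m * \<eta>) q2"
      "\<bar>\<alpha> + of_int m * \<eta> - of_int a2 / real q2\<bar> \<le> 1 / (real q2 * real Q)"
      by (rule dirichlet_rational_approx[OF Q(1)])
    have qX: "real q1 \<le> X powr 1.52" "real q2 \<le> X powr 1.52"
      using q1 q2 Q by linarith+
    have "X powr 0.48 \<le> real q1 \<or> X powr 0.48 \<le> real q2"
    proof (rule ccontr)
      assume "\<not> (X powr 0.48 \<le> real q1 \<or> X powr 0.48 \<le> real q2)"
      then have small: "real q1 \<le> X powr 0.48" "real q2 \<le> X powr 0.48" by auto
      \<comment> \<open>Subtracting the two approximations shows that P / D is close to \<eta>.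
        Against the lower bound c / D^2 this gives c \<le> |m| q1 q2 (q1 + q2) / Q, of exponent 0.05
        + 3 * 0.48 - 1.52 = -0.03. The factor 4 comes from q1 + q2 and from Q \<ge> X^1.52 / 2;
        \<open>x0\<close> is chosen to contradict the result.\<close>
      define D where "D = m * int q1 * int q2"
      define P where "P = a2 * int q1 - a1 * int q2"
      define M where "M = \<bar>real_of_int m\<bar>"
      have M0: "M > 0" unfolding M_def using m by simp
      have D0: "D \<noteq> 0" unfolding D_def using m q1 q2 by simp
      define E where "E = (\<alpha> + of_int m * \<eta> - of_int a2 / real q2) - (\<alpha> - of_int a1 / real q1)"
      have "\<eta> - of_int P / of_int D = E / of_int m"
        unfolding E_def P_def D_def using m q1 q2 by (simp add: field_simps)
      then have "\<bar>\<eta> - of_int P / of_int D\<bar> = \<bar>E\<bar> / M" unfolding M_def by simp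
      also have "\<bar>E\<bar> \<le> 1 / (real q1 * real Q) + 1 / (real q2 * real Q)"
        unfolding E_def using q1(4) q2(4) by linarith
      finally have "c / of_int D ^ 2 \<le> (1 / (real q1 * real Q) + 1 / (real q2 * real Q)) / M"
        using c(2)[OF D0, of P] M0 by (smt (verit) divide_right_mono)
      also have "real_of_int D ^ 2 = M ^ 2 * real q1 ^ 2 * real q2 ^ 2"
        unfolding D_def M_def by (simp add: power_mult_distrib)
      finally have "c \<le> (1 / (real q1 * real Q) + 1 / (real q2 * real Q)) / M * (M ^ 2 * real q1 ^ 2 * real q2 ^ 2)"
        using M0 q1 q2 by (simp add: pos_divide_le_eq)
      also have "\<dots> = M * (real q1 * real q2 * (real q1 + real q2)) / real Q"
        using M0 q1 q2 Q by (simp add: field_simps power2_eq_square)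
      also have "\<dots> \<le> X powr 0.05 * (X powr 0.48 * X powr 0.48 * (X powr 0.48 + X powr 0.48)) / (X powr 1.52 / 2)"
        using mx M0 small Q X1 unfolding M_def X_def[symmetric]
        by (intro frac_le mult_mono add_mono mult_nonneg_nonneg add_nonneg_nonneg) auto
      also have "\<dots> = 4 * (X powr 0.05 * X powr 0.48 * X powr 0.48 * X powr 0.48 / X powr 1.52)" by simp
      also have "X powr 0.05 * X powr 0.48 * X powr 0.48 * X powr 0.48 / X powr 1.52 = X powr (- 0.03)"
        by (simp only: powr_add[symmetric] powr_diff[symmetric]) simp
      finally have le: "c \<le> 4 * X powr (- 0.03)" .
      have "(4 / c) powr (1 / 0.03) < X" using x unfolding x0_def X_def by linarith
      then have "((4 / c) powr (1 / 0.03)) powr 0.03 < X powr 0.03"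
        by (intro powr_less_mono2) auto
      then have "4 / c < X powr 0.03" using c(1) by (simp add: powr_powr)
      then have "4 < c * X powr 0.03" using c(1) by (simp add: divide_less_eq mult.commute)
      moreover have "c * X powr 0.03 \<le> 4 * X powr (- 0.03) * X powr 0.03"
        using le by (intro mult_right_mono) auto
      moreover have "X powr (- 0.03) * X powr 0.03 = 1"
        using X1 by (simp flip: powr_add)
      ultimately show False by simp
    qed
    then show "norm (prime_exp_sum x \<alpha>) \<le> B * real x powr 0.987 \<or>
      norm (prime_exp_sum x (\<alpha> + of_int m * \<eta>)) \<le> B * real x powr 0.987"
      using B(2)[OF x1 q1(3)] B(2)[OF x1 q2(3)] qX unfolding X_def by blast
  qed
qed

section \<open>Orthogonality and the discrete circle method\<close>

text \<open>Distributivity in the form that fits tuples encoded as lists. It is used over primes for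
  the circle method and over frequencies for the smoothed indicators.\<close>

lemma prod_list_sum_eq_sum_lists:
  fixes gs :: "('a \<Rightarrow> 'b :: comm_semiring_1) list"
  assumes "finite P"
  shows "prod_list (map (\<lambda>g. \<Sum>p\<in>P. g p) gs) =
    (\<Sum>ps | set ps \<subseteq> P \<and> length ps = length gs. prod_list (map2 (\<lambda>g p. g p) gs ps))"
proof (induction gs)
  case Nil
  have "{ps. set ps \<subseteq> P \<and> length ps = length []} = {[]}" by auto
  then show ?case by simp
next
  case (Cons g gs)
  define Ls where "Ls = {ps. set ps \<subseteq> P \<and> length ps = length gs}"
  have "{ps. set ps \<subseteq> P \<and> length ps = length (g # gs)} = (\<lambda>(p, ps). p # ps) ` (P \<times> Ls)"
    unfolding Ls_def by (auto simp: length_Suc_conv image_iff)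
  then have "(\<Sum>ps | set ps \<subseteq> P \<and> length ps = length (g # gs). prod_list (map2 (\<lambda>g p. g p) (g # gs) ps)) =
      (\<Sum>(p, ps)\<in>P \<times> Ls. g p * prod_list (map2 (\<lambda>g p. g p) gs ps))"
    by (simp only:) (subst sum.reindex, auto simp: inj_on_def intro!: sum.cong)
  also have "\<dots> = (\<Sum>p\<in>P. g p) * (\<Sum>ps\<in>Ls. prod_list (map2 (\<lambda>g p. g p) gs ps))"
    by (simp add: sum_product sum.cartesian_product)
  finally show ?case using Cons unfolding Ls_def by simp
qed

text \<open>Since 0 < |n| < L, the quotient n / L is not an integer; the geometric ratio differs
  from 1 while its L-th power equals 1.\<close>

lemma sum_ee_eq_0:
  assumes L: "L > 0" and n: "n \<noteq> 0" "\<bar>n\<bar> < int L"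
  shows "(\<Sum>j<L. ee (real j / real L * of_int n)) = 0"
proof -
  define t where "t = of_int n / real L"
  have "nid t \<noteq> 0"
  proof
    assume "nid t = 0"
    then have "t = of_int (round t)" by (simp add: nid_def)
    then have "of_int n = real_of_int (round t * int L)" using L unfolding t_def by (simp add: field_simps)
    then have "n = round t * int L" by (simp only: of_int_eq_iff)
    then have "int L dvd n" by simp
    then show False using n dvd_imp_le_int[of n "int L"] by simp
  qed
  then have "nid t > 0" using nid_nonneg[of t] by linarith
  then have ne: "1 - ee t \<noteq> 0" using nid_le_norm_1_minus_ee[of t] by auto
  have pw: "ee t ^ j = ee (real j / real L * of_int n)" for j
    by (induction j) (simp_all add: t_def distrib_right add_divide_distrib flip: ee_add)
  have "(1 - ee t) * (\<Sum>j<L. ee t ^ j) = 1 - ee t ^ L"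
    by (rule one_diff_power_eq[symmetric])
  then have "(1 - ee t) * (\<Sum>j<L. ee (real j / real L * of_int n)) = 1 - ee (real L / real L * of_int n)"
    unfolding pw .
  also have "\<dots> = 0" using L by simp
  finally show ?thesis using ne by simp
qed

lemma sum_ee_orthogonality:
  assumes L: "L > 0" and n: "\<bar>n\<bar> < int L"
  shows "(\<Sum>j<L. ee (real j / real L * of_int n)) = (if n = 0 then of_nat L else 0)"
  using sum_ee_eq_0[OF L _ n] by simp

text \<open>As L > 2 x^2, a difference of two sums of two squares is divisible by L only if it is 0.
  On these terms the phase of the shift \<open>\<beta>\<close> is 1, so the moment is the same for
  every shift.\<close>

lemma prime_exp_sum_fourth_moment:
  assumes L: "2 * x ^ 2 < L"
  shows "(\<Sum>j<L. norm (prime_exp_sum x (real j / real L + \<beta>)) ^ 4) = real L * square_quads {p. prime p \<and> p \<le> x}"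
proof -
  define P where "P = {p. prime p \<and> p \<le> x}"
  define S where "S = (\<lambda>j. prime_exp_sum x (real j / real L + \<beta>))"
  define D where "D = (\<lambda>a b c d :: nat. int (a ^ 2 + b ^ 2) - int (c ^ 2 + d ^ 2))"
  have expand: "complex_of_real (norm (S j) ^ 4) =
      (\<Sum>a\<in>P. \<Sum>b\<in>P. \<Sum>c\<in>P. \<Sum>d\<in>P. ee (real j / real L * of_int (D a b c d)) * ee (\<beta> * of_int (D a b c d)))" for j
  proof -
    define f where "f = (\<lambda>p. ee ((real j / real L + \<beta>) * real p ^ 2))"
    have S: "S j = (\<Sum>p\<in>P. f p)" unfolding S_def P_def f_def prime_exp_sum_def ..
    have "complex_of_real (norm (S j) ^ 4) = (complex_of_real (norm (S j) ^ 2)) ^ 2"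
      by (simp flip: power_mult of_real_power)
    also have "\<dots> = S j * S j * cnj (S j) * cnj (S j)"
      unfolding complex_norm_square by (simp add: power2_eq_square mult_ac)
    also have "\<dots> = (\<Sum>a\<in>P. \<Sum>b\<in>P. \<Sum>c\<in>P. \<Sum>d\<in>P. f a * f b * cnj (f c) * cnj (f d))"
      unfolding S cnj_sum by (simp only: sum_distrib_left[symmetric] sum_distrib_right[symmetric])
    also have "\<dots> = (\<Sum>a\<in>P. \<Sum>b\<in>P. \<Sum>c\<in>P. \<Sum>d\<in>P. ee (real j / real L * of_int (D a b c d)) * ee (\<beta> * of_int (D a b c d)))"
      unfolding f_def cnj_ee ee_add[symmetric] D_def
      by (intro sum.cong refl arg_cong[where f = ee]) (simp add: algebra_simps)
    finally show ?thesis .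
  qed
  have bound: "\<bar>D a b c d\<bar> < int L" if "a \<in> P" "b \<in> P" "c \<in> P" "d \<in> P" for a b c d
  proof -
    have "a ^ 2 \<le> x ^ 2" "b ^ 2 \<le> x ^ 2" "c ^ 2 \<le> x ^ 2" "d ^ 2 \<le> x ^ 2"
      using that by (auto simp: P_def intro: power_mono)
    then have "a ^ 2 + b ^ 2 < L" "c ^ 2 + d ^ 2 < L" using L by linarith+
    then show ?thesis unfolding D_def by linarith
  qed
  have L0: "L > 0" using L by simp
  have "complex_of_real (\<Sum>j<L. norm (S j) ^ 4) =
      (\<Sum>j<L. \<Sum>a\<in>P. \<Sum>b\<in>P. \<Sum>c\<in>P. \<Sum>d\<in>P. ee (real j / real L * of_int (D a b c d)) * ee (\<beta> * of_int (D a b c d)))"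
    by (simp only: of_real_sum expand)
  also have "\<dots> = (\<Sum>a\<in>P. \<Sum>b\<in>P. \<Sum>c\<in>P. \<Sum>d\<in>P. \<Sum>j<L. ee (real j / real L * of_int (D a b c d)) * ee (\<beta> * of_int (D a b c d)))"
    by (rule trans[OF sum.swap], rule sum.cong[OF refl], rule trans[OF sum.swap], rule sum.cong[OF refl],
        rule trans[OF sum.swap], rule sum.cong[OF refl], rule sum.swap)
  also have "\<dots> = (\<Sum>a\<in>P. \<Sum>b\<in>P. \<Sum>c\<in>P. \<Sum>d\<in>P. complex_of_real (real L * (if a ^ 2 + b ^ 2 = c ^ 2 + d ^ 2 then 1 else 0)))"
  proof (intro sum.cong refl)
    fix a b c d assume "a \<in> P" "b \<in> P" "c \<in> P" "d \<in> P"
    then have "(\<Sum>j<L. ee (real j / real L * of_int (D a b c d))) = (if D a b c d = 0 then of_nat L else 0)"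
      using L0 by (intro sum_ee_orthogonality bound)
    moreover have "D a b c d = 0 \<longleftrightarrow> a ^ 2 + b ^ 2 = c ^ 2 + d ^ 2" unfolding D_def by linarith
    ultimately show "(\<Sum>j<L. ee (real j / real L * of_int (D a b c d)) * ee (\<beta> * of_int (D a b c d))) =
        complex_of_real (real L * (if a ^ 2 + b ^ 2 = c ^ 2 + d ^ 2 then 1 else 0))"
      unfolding sum_distrib_right[symmetric] by (cases "D a b c d = 0") simp_all
  qed
  also have "\<dots> = complex_of_real (real L * square_quads P)"
    unfolding square_quads_def sum_distrib_left of_real_sum ..
  finally have "(\<Sum>j<L. norm (S j) ^ 4) = real L * square_quads P" by (simp only: of_real_eq_iff)
  then show ?thesis unfolding S_def P_def .
qed

definition twisted_reps :: "real \<Rightarrow> nat \<Rightarrow> int list \<Rightarrow> complex" where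
  "twisted_reps \<eta> N ms = (\<Sum>ps\<in>prime_square_reps N. prod_list (map2 (\<lambda>m p. ee (of_int m * \<eta> * real p ^ 2)) ms ps))"

lemma prod_list_ee_shift:
  "length ms = length ps \<Longrightarrow>
    prod_list (map2 (\<lambda>m p. ee ((t + of_int m * \<eta>) * real p ^ 2)) ms ps) =
    ee (t * real (\<Sum>p\<leftarrow>ps. p ^ 2)) * prod_list (map2 (\<lambda>m p. ee (of_int m * \<eta> * real p ^ 2)) ms ps)"
  by (induction ms ps rule: list_induct2) (simp_all add: algebra_simps ee_add)

text \<open>The circle method with the mean over the points \<open>j / L\<close> in place of an integral over \<open>[0, 1]\<close>.\<close>
lemma twisted_reps_circle:
  assumes N: "N < (x + 1) ^ 2" and L: "5 * x ^ 2 + N < L" and ms: "length ms = 5"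
  shows "of_nat L * twisted_reps \<eta> N ms =
    (\<Sum>j<L. ee (- (real j / real L * real N)) * prod_list (map (\<lambda>m. prime_exp_sum x (real j / real L + of_int m * \<eta>)) ms))"
proof -
  define P where "P = {p. prime p \<and> p \<le> x}"
  define Ls where "Ls = {ps. set ps \<subseteq> P \<and> length ps = (5::nat)}"
  define h where "h = (\<lambda>ps. prod_list (map2 (\<lambda>m p. ee (of_int m * \<eta> * real p ^ 2)) ms ps))"
  define s where "s = (\<lambda>ps :: nat list. \<Sum>p\<leftarrow>ps. p ^ 2)"
  have finP: "finite P" unfolding P_def by simp
  have finLs: "finite Ls" unfolding Ls_def using finite_lists_length_eq[OF finP] by simp
  have L0: "L > 0" using L by simp
  have prod: "prod_list (map (\<lambda>m. prime_exp_sum x (t + of_int m * \<eta>)) ms) = (\<Sum>ps\<in>Ls. ee (t * real (s ps)) * h ps)" for t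
  proof -
    have "prod_list (map (\<lambda>m. prime_exp_sum x (t + of_int m * \<eta>)) ms) =
        prod_list (map (\<lambda>g. \<Sum>p\<in>P. g p) (map (\<lambda>m p. ee ((t + of_int m * \<eta>) * real p ^ 2)) ms))"
      unfolding prime_exp_sum_def P_def by (simp add: o_def)
    also have "\<dots> = (\<Sum>ps\<in>Ls. prod_list (map2 (\<lambda>g p. g p) (map (\<lambda>m p. ee ((t + of_int m * \<eta>) * real p ^ 2)) ms) ps))"
      unfolding prod_list_sum_eq_sum_lists[OF finP] Ls_def using ms by simp
    also have "\<dots> = (\<Sum>ps\<in>Ls. ee (t * real (s ps)) * h ps)"
    proof (rule sum.cong[OF refl])
      fix ps assume "ps \<in> Ls"
      then have len: "length ms = length ps" using ms unfolding Ls_def by simp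
      have "map2 (\<lambda>g p. g p) (map (\<lambda>m p. ee ((t + of_int m * \<eta>) * real p ^ 2)) ms) ps =
          map2 (\<lambda>m p. ee ((t + of_int m * \<eta>) * real p ^ 2)) ms ps"
        using len by (induction ms ps rule: list_induct2) auto
      then show "prod_list (map2 (\<lambda>g p. g p) (map (\<lambda>m p. ee ((t + of_int m * \<eta>) * real p ^ 2)) ms) ps) = ee (t * real (s ps)) * h ps"
        unfolding h_def s_def using prod_list_ee_shift[OF len] by simp
    qed
    finally show ?thesis .
  qed
  have sb: "s ps \<le> 5 * x ^ 2" if "ps \<in> Ls" for ps
  proof -
    have "s ps \<le> (\<Sum>p\<leftarrow>ps. x ^ 2)"
      unfolding s_def using that by (intro sum_list_mono power_mono) (auto simp: Ls_def P_def)
    then show ?thesis using that unfolding Ls_def by (simp add: sum_list_triv)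
  qed
  \<comment> \<open>Here \<open>N < (x + 1) ^ 2\<close> enters: a prime with square at most N is at
    most x, so cutting the primes at x loses no representation.\<close>
  have reps: "prime_square_reps N = {ps \<in> Ls. s ps = N}"
  proof -
    have "p \<le> x" if "p \<in> set ps" "s ps = N" for p ps
    proof -
      have "p ^ 2 \<le> s ps" unfolding s_def using that(1) by (intro member_le_sum_list) auto
      then have "p ^ 2 < (x + 1) ^ 2" using that(2) N by linarith
      then have "p < x + 1" by (rule power_less_imp_less_base) simp
      then show ?thesis by simp
    qed
    then show ?thesis unfolding prime_square_reps_def Ls_def P_def s_def by auto
  qed
  have "(\<Sum>j<L. ee (- (real j / real L * real N)) * prod_list (map (\<lambda>m. prime_exp_sum x (real j / real L + of_int m * \<eta>)) ms)) =
      (\<Sum>j<L. \<Sum>ps\<in>Ls. ee (real j / real L * of_int (int (s ps) - int N)) * h ps)"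
    unfolding prod sum_distrib_left
    by (intro sum.cong refl) (simp add: algebra_simps flip: ee_add mult.assoc)
  also have "\<dots> = (\<Sum>ps\<in>Ls. (\<Sum>j<L. ee (real j / real L * of_int (int (s ps) - int N))) * h ps)"
    unfolding sum_distrib_right by (rule sum.swap)
  also have "\<dots> = (\<Sum>ps\<in>Ls. (if int (s ps) - int N = 0 then of_nat L else 0) * h ps)"
  proof (intro sum.cong refl arg_cong2[where f = "(*)"] sum_ee_orthogonality L0)
    fix ps assume "ps \<in> Ls"
    then show "\<bar>int (s ps) - int N\<bar> < int L" using sb[of ps] L by linarith
  qed
  also have "\<dots> = (\<Sum>ps\<in>prime_square_reps N. of_nat L * h ps)"
    unfolding reps using finLs by (intro sum.mono_neutral_cong_right) auto
  finally show ?thesis unfolding twisted_reps_def h_def by (simp add: sum_distrib_left)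
qed

lemma prod_list_remove1_mult:
  fixes zs :: "'a :: comm_monoid_mult list"
  shows "z \<in> set zs \<Longrightarrow> z * prod_list (remove1 z zs) = prod_list zs"
  by (induction zs) (auto simp: mult.left_commute)

lemma prod_list_le_power:
  fixes zs :: "real list"
  assumes "\<And>z. z \<in> set zs \<Longrightarrow> 0 \<le> z \<and> z \<le> M"
  shows "0 \<le> prod_list zs \<and> prod_list zs \<le> M ^ length zs"
  using assms
proof (induction zs)
  case (Cons z zs)
  then have "0 \<le> prod_list zs" "prod_list zs \<le> M ^ length zs" "0 \<le> z" "z \<le> M" by auto
  then show ?case by (auto intro!: mult_nonneg_nonneg mult_mono)
qed simp

text \<open>One factor is at most B. The other four are at most the maximum M, and M^4 is itself one
  of the summands, so no mixed moments arise. Removing a single occurrence of z is right even if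
  entries repeat.\<close>

lemma prod_list_le_fourth_powers:
  fixes zs :: "real list"
  assumes len: "length zs = 5" and nn: "\<And>z. z \<in> set zs \<Longrightarrow> 0 \<le> z" and z: "z \<in> set zs" "z \<le> B"
  shows "prod_list zs \<le> B * (\<Sum>z\<leftarrow>zs. z ^ 4)"
proof -
  define M where "M = Max (set zs)"
  have M: "M \<in> set zs" "\<And>y. y \<in> set zs \<Longrightarrow> y \<le> M" unfolding M_def using z by (auto intro: Max_in)
  have rem: "0 \<le> prod_list (remove1 z zs) \<and> prod_list (remove1 z zs) \<le> M ^ length (remove1 z zs)"
    using nn M set_remove1_subset[of z zs] by (intro prod_list_le_power) auto
  have "length (remove1 z zs) = 4" using len z by (simp add: length_remove1)
  then have "prod_list (remove1 z zs) \<le> M ^ 4" using rem by simp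
  also have "\<dots> \<le> (\<Sum>z\<leftarrow>zs. z ^ 4)"
    using M(1) by (intro member_le_sum_list) auto
  finally have "z * prod_list (remove1 z zs) \<le> B * (\<Sum>z\<leftarrow>zs. z ^ 4)"
    using z nn[OF z(1)] rem by (intro mult_mono) auto
  then show ?thesis using prod_list_remove1_mult[OF z(1)] by simp
qed

lemma norm_prod_list: "norm (prod_list (zs :: complex list)) = prod_list (map norm zs)"
  by (induction zs) (auto simp: norm_mult)

text \<open>Which factor is small may depend on \<alpha>, so B is taken out at each point j / L
  separately; the fourth powers of the five shifted sums then average to the same energy.\<close>

lemma norm_twisted_reps_le:
  assumes N: "N < (x + 1) ^ 2" and ms: "length ms = 5"
    and B: "\<And>\<alpha>. \<exists>m\<in>set ms. norm (prime_exp_sum x (\<alpha> + of_int m * \<eta>)) \<le> B"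
  shows "norm (twisted_reps \<eta> N ms) \<le> 5 * B * square_quads {p. prime p \<and> p \<le> x}"
proof -
  define L where "L = 5 * x ^ 2 + N + 1"
  have L: "5 * x ^ 2 + N < L" "2 * x ^ 2 < L" "L > 0" unfolding L_def by auto
  define S where "S = (\<lambda>j m. norm (prime_exp_sum x (real j / real L + of_int m * \<eta>)))"
  have "real L * norm (twisted_reps \<eta> N ms) = norm (of_nat L * twisted_reps \<eta> N ms)"
    by (simp add: norm_mult)
  also have "\<dots> \<le> (\<Sum>j<L. B * (\<Sum>m\<leftarrow>ms. S j m ^ 4))"
    unfolding twisted_reps_circle[OF N L(1) ms]
  proof (rule sum_norm_le)
    fix j assume "j \<in> {..<L}"
    obtain m where m: "m \<in> set ms" "S j m \<le> B" using B[of "real j / real L"] unfolding S_def by blast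
    have "prod_list (map (S j) ms) \<le> B * (\<Sum>z\<leftarrow>map (S j) ms. z ^ 4)"
      using ms m by (intro prod_list_le_fourth_powers[where z = "S j m"]) (auto simp: S_def)
    then show "norm (ee (- (real j / real L * real N)) * prod_list (map (\<lambda>m. prime_exp_sum x (real j / real L + of_int m * \<eta>)) ms))
        \<le> B * (\<Sum>m\<leftarrow>ms. S j m ^ 4)"
      by (simp add: norm_mult norm_prod_list S_def o_def)
  qed
  also have "\<dots> = B * (\<Sum>m\<leftarrow>ms. \<Sum>j<L. S j m ^ 4)"
    by (simp add: sum_list_sum_nth atLeast0LessThan sum.swap[of _ "{..<L}"] flip: sum_distrib_left)
  also have "\<dots> = B * (\<Sum>m\<leftarrow>ms. real L * square_quads {p. prime p \<and> p \<le> x})"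
    unfolding S_def prime_exp_sum_fourth_moment[OF L(2)] ..
  also have "\<dots> = real L * (5 * B * square_quads {p. prime p \<and> p \<le> x})"
    using ms by (simp add: sum_list_triv)
  finally show ?thesis using L(3) by simp
qed

section \<open>Fejer approximation of an arc\<close>

text \<open>Normalised to have mean 1 over a period.\<close>

definition fejer :: "nat \<Rightarrow> real \<Rightarrow> real" where
  "fejer K u = norm (\<Sum>j<K. ee (real j * u)) ^ 2 / real K"

text \<open>The m-th Fourier coefficient of the indicator of (a, b), written with the midpoint phase
  split off so that its fifth power matches \<open>sigma_term\<close>.\<close>

definition arc_coeff :: "real \<Rightarrow> real \<Rightarrow> int \<Rightarrow> complex" where
  "arc_coeff a b m = (if m = 0 then of_real (b - a) else
     ee (- (of_int m * (a + b) / 2)) * of_real (sin (pi * of_int m * (b - a)) / (pi * of_int m)))"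

text \<open>The convolution of the indicator of the arc with \<open>fejer K\<close>, introduced as a
  trigonometric polynomial because its frequencies become those of
  \<open>twisted_reps\<close>.\<close>

definition fejer_arc :: "nat \<Rightarrow> real \<Rightarrow> real \<Rightarrow> real \<Rightarrow> complex" where
  "fejer_arc K a b t = (\<Sum>m\<in>{- int K<..<int K}. of_real (1 - \<bar>of_int m\<bar> / real K) * arc_coeff a b m * ee (of_int m * t))"

lemma fejer_nonneg [simp]: "0 \<le> fejer K u"
  by (simp add: fejer_def)

lemma sum_symmetric_int:
  fixes g :: "int \<Rightarrow> 'a :: comm_monoid_add"
  assumes "K \<ge> 1"
  shows "(\<Sum>m\<in>{- int K<..<int K}. g m) = g 0 + (\<Sum>h=1..<K. g (int h) + g (- int h))"
  using assms
proof (induction K rule: dec_induct)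
  case base
  have "{- int 1<..<int 1} = {0}" by auto
  then show ?case by simp
next
  case (step K)
  have "{- int (Suc K)<..<int (Suc K)} = insert (int K) (insert (- int K) {- int K<..<int K})"
    by auto
  then have "(\<Sum>m\<in>{- int (Suc K)<..<int (Suc K)}. g m) = g (int K) + (g (- int K) + (\<Sum>m\<in>{- int K<..<int K}. g m))"
    using step by (simp only:) (subst sum.insert, simp, simp, subst sum.insert, auto)
  then show ?case using step by (simp add: sum.atLeastLessThan_Suc add_ac)
qed

lemma fejer_expansion:
  assumes K: "K \<ge> 1"
  shows "complex_of_real (fejer K u) = (\<Sum>m\<in>{- int K<..<int K}. of_real (1 - \<bar>of_int m\<bar> / real K) * ee (of_int m * u))"
proof -
  have re: "complex_of_real (2 * Re (ee s)) = ee s + ee (- s)" for s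
    using complex_add_cnj[of "ee s"] by (simp add: cnj_ee)
  have "norm (\<Sum>j<K. ee (real j * u)) ^ 2 = real K + 2 * Re (\<Sum>h=1..<K. \<Sum>c<K - h. ee (real (c + h) * u) * cnj (ee (real c * u)))"
    unfolding norm_sum_square by simp
  also have "(\<Sum>h=1..<K. \<Sum>c<K - h. ee (real (c + h) * u) * cnj (ee (real c * u))) = (\<Sum>h=1..<K. of_real (real K - real h) * ee (real h * u))"
  proof (intro sum.cong refl)
    fix h assume h: "h \<in> {1..<K}"
    have "ee (real (c + h) * u) * cnj (ee (real c * u)) = ee (real h * u)" for c
      unfolding cnj_ee ee_add[symmetric] by (simp add: algebra_simps)
    then show "(\<Sum>c<K - h. ee (real (c + h) * u) * cnj (ee (real c * u))) = of_real (real K - real h) * ee (real h * u)"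
      using h by (simp add: of_nat_diff)
  qed
  also have "2 * Re \<dots> = (\<Sum>h=1..<K. (real K - real h) * (2 * Re (ee (real h * u))))"
    by (simp add: sum_distrib_left mult_ac)
  finally have "complex_of_real (norm (\<Sum>j<K. ee (real j * u)) ^ 2) =
      of_nat K + (\<Sum>h=1..<K. of_real (real K - real h) * (ee (real h * u) + ee (- (real h * u))))"
    by (simp only: of_real_add of_real_sum of_real_mult[of "real K - real h" for h] re of_real_of_nat_eq)
  then have "complex_of_real (fejer K u) =
      (of_nat K + (\<Sum>h=1..<K. of_real (real K - real h) * (ee (real h * u) + ee (- (real h * u))))) / of_nat K"
    unfolding fejer_def of_real_divide by simp
  also have "\<dots> = 1 + (\<Sum>h=1..<K. of_real (1 - real h / real K) * (ee (real h * u) + ee (- (real h * u))))"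
  proof -
    have "of_real (real K - real h) / of_nat K = complex_of_real (1 - real h / real K)" for h
      using K by (simp add: diff_divide_distrib)
    then show ?thesis using K by (simp add: add_divide_distrib sum_divide_distrib flip: times_divide_eq_left)
  qed
  also have "\<dots> = (\<Sum>m\<in>{- int K<..<int K}. of_real (1 - \<bar>of_int m\<bar> / real K) * ee (of_int m * u))"
    unfolding sum_symmetric_int[OF K] by (simp add: distrib_left)
  finally show ?thesis .
qed

lemma ee_has_integral:
  assumes ab: "a \<le> b"
  shows "((\<lambda>y. ee (of_int m * (t - y))) has_integral arc_coeff a b m * ee (of_int m * t)) {a..b}"
proof (cases "m = 0")
  case True
  have "((\<lambda>y. 1 :: complex) has_integral of_real (b - a)) {a..b}"
    using has_integral_const_real[of "1::complex" a b] ab by (simp add: scaleR_conv_of_real)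
  then show ?thesis using True by (simp add: arc_coeff_def)
next
  case False
  define F where "F = (\<lambda>y. - ee (of_int m * (t - y)) / (2 * pi * \<i> * of_int m))"
  have "((\<lambda>y. ee (of_int m * (t - y))) has_integral (F b - F a)) {a..b}"
  proof (rule fundamental_theorem_of_calculus[OF ab])
    fix y assume "y \<in> {a..b}"
    have "((\<lambda>z. exp (2 * of_real pi * \<i> * of_int m * (of_real t - z))) has_field_derivative
        - (2 * of_real pi * \<i> * of_int m) * exp (2 * of_real pi * \<i> * of_int m * (of_real t - of_real y))) (at (of_real y))"
      by (auto intro!: derivative_eq_intros)
    then have "((\<lambda>y. exp (2 * of_real pi * \<i> * of_int m * (of_real t - of_real y))) has_vector_derivative
        - (2 * of_real pi * \<i> * of_int m) * exp (2 * of_real pi * \<i> * of_int m * (of_real t - of_real y))) (at y within {a..b})"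
      by (rule has_vector_derivative_real_field)
    moreover have "exp (2 * of_real pi * \<i> * of_int m * (of_real t - of_real y)) = ee (of_int m * (t - y))" for y
      unfolding ee_def cis_conv_exp by (simp add: mult_ac)
    ultimately have "((\<lambda>y. ee (of_int m * (t - y))) has_vector_derivative
        (2 * pi * (- of_int m)) *\<^sub>R (\<i> * ee (of_int m * (t - y)))) (at y within {a..b})"
      by (simp add: scaleR_conv_of_real mult_ac)
    then have "((\<lambda>y. (- 1 / (2 * pi * \<i> * of_int m)) * ee (of_int m * (t - y))) has_vector_derivative
        (- 1 / (2 * pi * \<i> * of_int m)) * ((2 * pi * (- of_int m)) *\<^sub>R (\<i> * ee (of_int m * (t - y))))) (at y within {a..b})"
      by (rule has_vector_derivative_mult_right)
    moreover have "(- 1 / (2 * pi * \<i> * of_int m)) * ((2 * pi * (- of_int m)) *\<^sub>R (\<i> * ee (of_int m * (t - y)))) = ee (of_int m * (t - y))"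
      using False by (simp add: scaleR_conv_of_real field_simps)
    ultimately show "(F has_vector_derivative ee (of_int m * (t - y))) (at y within {a..b})"
      unfolding F_def by simp
  qed
  moreover have "F b - F a = arc_coeff a b m * ee (of_int m * t)"
  proof -
    define w where "w = of_int m * (b - a) / 2"
    define z where "z = of_int m * t - of_int m * (a + b) / 2"
    have e: "of_int m * (t - a) = z + w" "of_int m * (t - b) = z + - w"
      unfolding z_def w_def by (simp_all add: field_simps)
    have "F b - F a = ee z * (ee w - ee (- w)) / (2 * pi * \<i> * of_int m)"
      unfolding F_def e ee_add by (simp add: diff_divide_distrib right_diff_distrib)
    also have "ee w - ee (- w) = 2 * \<i> * of_real (sin (2 * pi * w))"
      by (simp add: ee_def complex_eq_iff)
    also have "2 * pi * w = pi * of_int m * (b - a)" unfolding w_def by simp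
    also have "ee z = ee (- (of_int m * (a + b) / 2)) * ee (of_int m * t)"
      unfolding z_def by (simp flip: ee_add)
    finally show ?thesis using False by (simp add: arc_coeff_def)
  qed
  ultimately show ?thesis by simp
qed

text \<open>The integral form shows what the polynomial hides: the values are real and nonnegative,
  additive in the arc, and small when the arc is far from t.\<close>

lemma fejer_has_integral:
  assumes K: "K \<ge> 1" and ab: "a \<le> b"
  shows "((\<lambda>y. complex_of_real (fejer K (t - y))) has_integral fejer_arc K a b t) {a..b}"
  unfolding fejer_expansion[OF K] fejer_arc_def mult.assoc
  by (intro has_integral_sum has_integral_mult_right ee_has_integral[OF ab]) auto

lemma fejer_has_real_integral:
  assumes K: "K \<ge> 1" and ab: "a \<le> b"
  shows "((\<lambda>y. fejer K (t - y)) has_integral Re (fejer_arc K a b t)) {a..b}"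
  using has_integral_linear[OF fejer_has_integral[OF assms] bounded_linear_Re] by (simp add: o_def)

lemma fejer_arc_real:
  assumes K: "K \<ge> 1" and ab: "a \<le> b"
  shows "fejer_arc K a b t = of_real (Re (fejer_arc K a b t))"
proof -
  have "((\<lambda>y. 0 :: real) has_integral Im (fejer_arc K a b t)) {a..b}"
    using has_integral_linear[OF fejer_has_integral[OF assms] bounded_linear_Im] by (simp add: o_def)
  then have "Im (fejer_arc K a b t) = 0" using has_integral_unique has_integral_0 by blast
  then show ?thesis by (simp add: complex_eq_iff)
qed

lemma fejer_arc_full:
  assumes K: "K \<ge> 1"
  shows "fejer_arc K 0 1 t = 1"
proof -
  have "arc_coeff 0 1 m = (if m = 0 then 1 else 0)" for m
    using sin_npi_int[of m] by (simp add: arc_coeff_def mult.commute)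
  then have "fejer_arc K 0 1 t = (\<Sum>m\<in>{- int K<..<int K}. if m = 0 then 1 else 0)"
    unfolding fejer_arc_def by (intro sum.cong refl) auto
  then show ?thesis using K by simp
qed

lemma fejer_arc_nonneg:
  assumes K: "K \<ge> 1" and ab: "a \<le> b"
  shows "0 \<le> Re (fejer_arc K a b t)"
  using fejer_has_real_integral[OF assms] by (rule has_integral_nonneg) simp

lemma fejer_arc_add:
  assumes K: "K \<ge> 1" and "a \<le> c" "c \<le> b"
  shows "Re (fejer_arc K a c t) + Re (fejer_arc K c b t) = Re (fejer_arc K a b t)"
proof -
  have "((\<lambda>y. fejer K (t - y)) has_integral Re (fejer_arc K a c t) + Re (fejer_arc K c b t)) {a..b}"
    by (rule has_integral_combine[OF assms(2,3)]; rule fejer_has_real_integral[OF K]) (use assms in auto)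
  moreover have "((\<lambda>y. fejer K (t - y)) has_integral Re (fejer_arc K a b t)) {a..b}"
    using assms by (intro fejer_has_real_integral) auto
  ultimately show ?thesis by (rule has_integral_unique)
qed

text \<open>A partition of unity on the circle: being near 1 inside the arc reduces to being near 0
  on the two complementary arcs.\<close>

lemma fejer_arc_split:
  assumes K: "K \<ge> 1" and "0 \<le> a" "a \<le> b" "b \<le> 1"
  shows "Re (fejer_arc K 0 a t) + Re (fejer_arc K a b t) + Re (fejer_arc K b 1 t) = 1"
  using fejer_arc_add[OF K, of 0 a b t] fejer_arc_add[OF K, of 0 b 1 t] fejer_arc_full[OF K, of t] assms by simp

lemma fejer_le:
  assumes d: "0 < d" "d \<le> nid u" and K: "K \<ge> 1"
  shows "fejer K u \<le> 1 / (real K * d ^ 2)"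
proof -
  have "d * norm (\<Sum>j<K. ee (real j * u)) \<le> nid u * norm (\<Sum>j<K. ee (real j * u))"
    using d by (intro mult_right_mono) auto
  also have "\<dots> \<le> 1"
    using nid_mult_geometric_le[of u 0 K] by (simp add: mult.commute lessThan_atLeast0)
  finally have "norm (\<Sum>j<K. ee (real j * u)) \<le> 1 / d" using d by (simp add: field_simps)
  then have "norm (\<Sum>j<K. ee (real j * u)) ^ 2 \<le> (1 / d) ^ 2" by (intro power_mono) auto
  then have "fejer K u \<le> (1 / d) ^ 2 / real K" unfolding fejer_def by (intro divide_right_mono) auto
  then show ?thesis by (simp add: power_divide mult.commute)
qed

lemma fejer_ge:
  assumes "nid u \<le> 1 / (6 * real K)" and K: "K \<ge> 1"
  shows "real K / 4 \<le> fejer K u"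
proof -
  define v where "v = u - of_int (round u)"
  have v: "\<bar>v\<bar> \<le> 1 / (6 * real K)" using assms(1) unfolding nid_def v_def .
  \<comment> \<open>For j < K and distance at most 1 / (6 K) the angle 2 pi j v stays within pi / 3,
    where the cosine is at least 1/2; this is the origin of the 6.\<close>
  have "real K * (1 / 2) \<le> (\<Sum>j<K. Re (ee (real j * u)))"
  proof -
    have "1 / 2 \<le> Re (ee (real j * u))" if j: "j < K" for j
    proof -
      have "real j * u = real j * v + of_int (int j * round u)" unfolding v_def by (simp add: algebra_simps)
      then have "ee (real j * u) = ee (real j * v)" by (simp only: ee_add_int)
      then have "Re (ee (real j * u)) = cos \<bar>2 * pi * (real j * v)\<bar>" by (simp add: ee_def)
      moreover have "cos (pi / 3) \<le> cos \<bar>2 * pi * (real j * v)\<bar>"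
      proof (rule cos_monotone_0_pi_le)
        have "real j * \<bar>v\<bar> \<le> real K * (1 / (6 * real K))" using v j by (intro mult_mono) auto
        also have "\<dots> = 1 / 6" using K by simp
        finally have "2 * pi * (real j * \<bar>v\<bar>) \<le> 2 * pi * (1 / 6)" by (intro mult_left_mono) auto
        then show "\<bar>2 * pi * (real j * v)\<bar> \<le> pi / 3" by (simp add: abs_mult)
      qed auto
      ultimately show ?thesis by (simp add: cos_60)
    qed
    then have "(\<Sum>j<K. 1 / 2) \<le> (\<Sum>j<K. Re (ee (real j * u)))" by (intro sum_mono) auto
    then show ?thesis by simp
  qed
  also have "\<dots> = Re (\<Sum>j<K. ee (real j * u))" by simp
  also have "\<dots> \<le> norm (\<Sum>j<K. ee (real j * u))" by (rule complex_Re_le_cmod)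
  finally have "(real K * (1 / 2)) ^ 2 \<le> norm (\<Sum>j<K. ee (real j * u)) ^ 2" by (intro power_mono) auto
  then have "(real K * (1 / 2)) ^ 2 / real K \<le> fejer K u" unfolding fejer_def by (intro divide_right_mono) auto
  then show ?thesis using K by (simp add: power2_eq_square)
qed

lemma fejer_arc_le:
  assumes K: "K \<ge> 1" and ab: "a \<le> b" and d: "d > 0" and y: "\<And>y. a \<le> y \<Longrightarrow> y \<le> b \<Longrightarrow> d \<le> nid (t - y)"
  shows "Re (fejer_arc K a b t) \<le> (b - a) * (1 / (real K * d ^ 2))"
proof (rule has_integral_le[OF fejer_has_real_integral[OF K ab]])
  show "((\<lambda>y. 1 / (real K * d ^ 2)) has_integral (b - a) * (1 / (real K * d ^ 2))) {a..b}"
    using has_integral_const_real[of "1 / (real K * d ^ 2)" a b] ab by simp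
qed (use fejer_le[OF d _ K] y in auto)

lemma nid_frac_diff_le: "nid (t - c) \<le> \<bar>frac t - c - of_int k\<bar>"
  using nid_le[of "t - c" "k + \<lfloor>t\<rfloor>"] by (simp add: frac_def algebra_simps)

lemma nid_ge_fracI:
  assumes "\<And>k. d \<le> \<bar>frac t - y - of_int k\<bar>"
  shows "d \<le> nid (t - y)"
proof (rule nid_geI)
  fix k :: int
  show "d \<le> \<bar>t - y - of_int k\<bar>" using assms[of "k - \<lfloor>t\<rfloor>"] by (simp add: frac_def algebra_simps)
qed

text \<open>Inside the arc the error is the mass on the complementary arcs, outside it is the mass
  on the arc itself. Either way the kernel is integrated only over points at distance at least d
  from t, and the lengths involved add up to at most 1.\<close>

lemma fejer_arc_close:
  assumes K: "K \<ge> 1" and ab: "0 < a" "a < b" "b < 1" and d: "0 < d" "d \<le> nid (t - a)" "d \<le> nid (t - b)"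
  shows "norm (fejer_arc K a b t - (if a < frac t \<and> frac t < b then 1 else 0)) \<le> 1 / (real K * d ^ 2)"
proof -
  define M where "M = 1 / (real K * d ^ 2)"
  have M0: "M \<ge> 0" unfolding M_def by simp
  define s where "s = frac t"
  have s: "0 \<le> s" "s < 1" unfolding s_def by (auto simp: frac_lt_1)
  have da: "d \<le> \<bar>s - a - of_int k\<bar>" and db: "d \<le> \<bar>s - b - of_int k\<bar>" for k
    using d nid_frac_diff_le[of t a k] nid_frac_diff_le[of t b k] unfolding s_def by linarith+
  note das = da[of 0] da[of "-1"] da[of 1] and dbs = db[of 0] db[of 1] db[of "-1"]
  \<comment> \<open>Both \<open>frac t\<close> and y lie in [0, 1], so of the integer k it matters
    only whether it is 0, at least 1 or at most -1.\<close>
  have trich: "of_int k = (0::real) \<or> of_int k \<ge> (1::real) \<or> of_int k \<le> (- 1::real)" for k :: int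
  proof -
    have "k = 0 \<or> 1 \<le> k \<or> k \<le> - 1" by linarith
    then show ?thesis by (elim disjE) (simp, linarith, linarith)
  qed
  show ?thesis
  proof (cases "a < s \<and> s < b")
    case True
    have in_arc: "d \<le> s - a" "d \<le> b - s" using das(1) dbs(1) True by simp_all
    have 1: "Re (fejer_arc K 0 a t) \<le> (a - 0) * M" unfolding M_def
    proof (rule fejer_arc_le[OF K _ d(1)])
      show "d \<le> nid (t - y)" if "0 \<le> y" "y \<le> a" for y
      proof (rule nid_ge_fracI)
        fix k :: int
        show "d \<le> \<bar>frac t - y - of_int k\<bar>"
          unfolding s_def[symmetric] using in_arc that ab s trich[of k]
          by (elim disjE conjE) linarith+
      qed
    qed (use ab in auto)
    have 2: "Re (fejer_arc K b 1 t) \<le> (1 - b) * M" unfolding M_def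
    proof (rule fejer_arc_le[OF K _ d(1)])
      show "d \<le> nid (t - y)" if "b \<le> y" "y \<le> 1" for y
      proof (rule nid_ge_fracI)
        fix k :: int
        show "d \<le> \<bar>frac t - y - of_int k\<bar>"
          unfolding s_def[symmetric] using in_arc that ab s trich[of k]
          by (elim disjE conjE) linarith+
      qed
    qed (use ab in auto)
    have "(a - 0) * M + (1 - b) * M \<le> 1 * M" unfolding distrib_right[symmetric]
      using ab M0 by (intro mult_right_mono) auto
    moreover have "0 \<le> Re (fejer_arc K 0 a t)" "0 \<le> Re (fejer_arc K b 1 t)"
      using ab by (intro fejer_arc_nonneg[OF K]; simp)+
    ultimately have "\<bar>Re (fejer_arc K a b t) - 1\<bar> \<le> M"
      using fejer_arc_split[OF K, of a b t] ab 1 2 by simp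
    moreover have "fejer_arc K a b t - 1 = of_real (Re (fejer_arc K a b t) - 1)"
      using fejer_arc_real[OF K, of a b t] ab by simp
    ultimately have "norm (fejer_arc K a b t - 1) \<le> M" by (simp only: norm_of_real)
    then show ?thesis using True unfolding M_def s_def by simp
  next
    case False
    \<comment> \<open>The second inequality in each case is the distance around the circle: to the
      copy b - 1 of b, or to the copy a + 1 of a.\<close>
    have out: "(d \<le> a - s \<and> d \<le> s - b + 1) \<or> (d \<le> s - b \<and> d \<le> 1 + a - s)"
      using das dbs False s ab by auto
    have 1: "Re (fejer_arc K a b t) \<le> (b - a) * M" unfolding M_def
    proof (rule fejer_arc_le[OF K _ d(1)])
      show "d \<le> nid (t - y)" if "a \<le> y" "y \<le> b" for y
      proof (rule nid_ge_fracI)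
        fix k :: int
        show "d \<le> \<bar>frac t - y - of_int k\<bar>"
          unfolding s_def[symmetric] using out that ab s trich[of k]
          by (elim disjE conjE) linarith+
      qed
    qed (use ab in auto)
    also have "\<dots> \<le> 1 * M" using ab M0 by (intro mult_right_mono) auto
    finally have "\<bar>Re (fejer_arc K a b t)\<bar> \<le> M" using fejer_arc_nonneg[OF K, of a b t] ab by simp
    moreover have "fejer_arc K a b t = of_real (Re (fejer_arc K a b t))"
      using fejer_arc_real[OF K, of a b t] ab by simp
    ultimately have "norm (fejer_arc K a b t) \<le> M" by (metis norm_of_real)
    moreover have "(if a < frac t \<and> frac t < b then 1 else 0) = (0 :: complex)"
      using False unfolding s_def by (rule if_not_P)
    ultimately show ?thesis unfolding M_def by (simp only: diff_zero)
  qed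
qed

lemma norm_fejer_arc_le:
  assumes K: "K \<ge> 1" and ab: "0 < a" "a < b" "b < 1"
  shows "norm (fejer_arc K a b t) \<le> 1"
    and "norm (fejer_arc K a b t - (if a < frac t \<and> frac t < b then 1 else 0)) \<le> 1"
proof -
  define r where "r = Re (fejer_arc K a b t)"
  have e: "fejer_arc K a b t = of_real r" unfolding r_def using fejer_arc_real[OF K, of a b t] ab by simp
  have "0 \<le> Re (fejer_arc K 0 a t)" "0 \<le> Re (fejer_arc K b 1 t)" "0 \<le> r"
    unfolding r_def using ab by (intro fejer_arc_nonneg[OF K]; simp)+
  then have r: "0 \<le> r" "r \<le> 1" using fejer_arc_split[OF K, of a b t] ab unfolding r_def by linarith+
  show "norm (fejer_arc K a b t) \<le> 1" unfolding e using r by simp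
  have "of_real r - (if a < frac t \<and> frac t < b then 1 else 0) = complex_of_real (r - (if a < frac t \<and> frac t < b then 1 else 0))"
    by simp
  then show "norm (fejer_arc K a b t - (if a < frac t \<and> frac t < b then 1 else 0)) \<le> 1"
    unfolding e using r by (simp only: norm_of_real) auto
qed

text \<open>Away from the endpoints the kernel of order \<open>H\<^sup>3\<close> is small; within \<open>1 / (6 H)\<close> of an endpoint the
  kernel of order \<open>H\<close> is at least \<open>H / 4\<close>.\<close>
lemma fejer_arc_error:
  assumes H: "H \<ge> 1" and ab: "0 < a" "a < b" "b < 1"
  shows "norm (fejer_arc (H ^ 3) a b t - (if a < frac t \<and> frac t < b then 1 else 0)) \<le>
    36 / real H + 4 / real H * (fejer H (t - a) + fejer H (t - b))"
proof -
  \<comment> \<open>This choice turns the bound 1 / (H^3 d^2) of the far case into 36 / H, which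
    explains the cube.\<close>
  define d where "d = 1 / (6 * real H)"
  have d: "d > 0" unfolding d_def using H by simp
  have K: "H ^ 3 \<ge> 1" using H by simp
  show ?thesis
  proof (cases "d \<le> nid (t - a) \<and> d \<le> nid (t - b)")
    case True
    have "norm (fejer_arc (H ^ 3) a b t - (if a < frac t \<and> frac t < b then 1 else 0)) \<le> 1 / (real (H ^ 3) * d ^ 2)"
      using True by (intro fejer_arc_close[OF K ab d]) auto
    also have "\<dots> = 36 / real H" unfolding d_def using H by (simp add: field_simps power_numeral_reduce)
    also have "\<dots> \<le> 36 / real H + 4 / real H * (fejer H (t - a) + fejer H (t - b))"
      by (simp add: add_nonneg_nonneg)
    finally show ?thesis .
  next
    case False
    then have "nid (t - a) \<le> 1 / (6 * real H) \<or> nid (t - b) \<le> 1 / (6 * real H)" unfolding d_def by auto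
    then have "real H / 4 \<le> fejer H (t - a) + fejer H (t - b)"
      using fejer_ge[OF _ H, of "t - a"] fejer_ge[OF _ H, of "t - b"] fejer_nonneg[of H "t - a"] fejer_nonneg[of H "t - b"]
      by linarith
    then have "4 / real H * (real H / 4) \<le> 4 / real H * (fejer H (t - a) + fejer H (t - b))"
      by (intro mult_left_mono) auto
    then have "1 \<le> 36 / real H + 4 / real H * (fejer H (t - a) + fejer H (t - b))"
      using H by (simp add: add_increasing)
    then show ?thesis using norm_fejer_arc_le(2)[OF K ab, of t] by linarith
  qed
qed

section \<open>The asymptotic formula\<close>

lemma prod_list_ee_const:
  "prod_list (map2 (\<lambda>m p. ee (of_int m * \<eta> * real p ^ 2)) (replicate (length ps) m) ps) = ee (of_int m * \<eta> * real (\<Sum>p\<leftarrow>ps. p ^ 2))"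
  by (induction ps) (simp_all add: distrib_left ee_add)

lemma twisted_reps_const:
  "twisted_reps \<eta> N (replicate 5 m) = ee (of_int m * \<eta> * real N) * of_nat (I_5_2 N)"
proof -
  have "twisted_reps \<eta> N (replicate 5 m) = (\<Sum>ps\<in>prime_square_reps N. ee (of_int m * \<eta> * real N))"
    unfolding twisted_reps_def
  proof (rule sum.cong[OF refl])
    fix ps assume "ps \<in> prime_square_reps N"
    then have "length ps = 5" "(\<Sum>p\<leftarrow>ps. p ^ 2) = N" by (auto simp: prime_square_reps_def)
    then show "prod_list (map2 (\<lambda>m p. ee (of_int m * \<eta> * real p ^ 2)) (replicate 5 m) ps) = ee (of_int m * \<eta> * real N)"
      using prod_list_ee_const[where m = m and ps = ps and \<eta> = \<eta>] by simp
  qed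
  then show ?thesis unfolding I_5_2_def by simp
qed

lemma real_I_5_2_eq: "complex_of_real (real (I_5_2 N)) = twisted_reps \<eta> N (replicate 5 0)"
  using twisted_reps_const[of \<eta> N 0] by simp

lemma norm_prime_exp_sum_le: "norm (prime_exp_sum x \<alpha>) \<le> real x"
proof -
  have "norm (prime_exp_sum x \<alpha>) \<le> (\<Sum>p | prime p \<and> p \<le> x. 1)"
    unfolding prime_exp_sum_def by (intro sum_norm_le) simp
  also have "\<dots> = real (card {p. prime p \<and> p \<le> x})" by simp
  also have "card {p. prime p \<and> p \<le> x} \<le> card {1..x}"
    by (intro card_mono) (auto simp: Suc_le_eq prime_gt_0_nat)
  finally show ?thesis by simp
qed

text \<open>I(N) is the twisted sum with all frequencies 0, so the moment inequality with the
  trivial bound x for one factor gives x^3.0001. Two different frequencies replace x by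
  x^0.987.\<close>

lemma twisted_reps_bounds:
  assumes "quadratic_irrationality \<eta>"
  obtains C x0 where "C > 0"
    "\<And>N x. N < (x + 1) ^ 2 \<Longrightarrow> real (I_5_2 N) \<le> C * real x powr 3.0001"
    "\<And>N x ms m m'. N < (x + 1) ^ 2 \<Longrightarrow> x \<ge> x0 \<Longrightarrow> length ms = 5 \<Longrightarrow> m \<in> set ms \<Longrightarrow> m' \<in> set ms \<Longrightarrow> m \<noteq> m' \<Longrightarrow>
      \<bar>of_int (m' - m)\<bar> \<le> real x powr 0.05 \<Longrightarrow> norm (twisted_reps \<eta> N ms) \<le> C * real x powr 2.9871"
proof -
  obtain B x0 where B: "B > 0"
    "\<And>x \<alpha> m. x \<ge> x0 \<Longrightarrow> m \<noteq> 0 \<Longrightarrow> \<bar>of_int m\<bar> \<le> real x powr 0.05 \<Longrightarrow>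
      norm (prime_exp_sum x \<alpha>) \<le> B * real x powr 0.987 \<or>
      norm (prime_exp_sum x (\<alpha> + of_int m * \<eta>)) \<le> B * real x powr 0.987"
    using prime_exp_sum_dichotomy[OF assms] by blast
  obtain C where C: "C > 0" "\<And>x P. P \<subseteq> {1..x} \<Longrightarrow> square_quads P \<le> C * real x powr (2 + 0.0001)"
    using square_quads_bound[of "0.0001"] by auto
  have sq: "square_quads {p. prime p \<and> p \<le> x} \<le> C * real x powr 2.0001" for x
  proof -
    have "{p. prime p \<and> p \<le> x} \<subseteq> {1..x}" by (auto simp: Suc_le_eq prime_gt_0_nat)
    then show ?thesis using C(2)[of "{p. prime p \<and> p \<le> x}" x] by simp
  qed
  show ?thesis
  proof
    show "5 * C * (B + 1) > 0" using B C by simp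
    fix N x :: nat assume N: "N < (x + 1) ^ 2"
    have "norm (twisted_reps \<eta> N (replicate 5 0)) \<le> 5 * real x * square_quads {p. prime p \<and> p \<le> x}"
      by (intro norm_twisted_reps_le[OF N]) (auto intro: norm_prime_exp_sum_le)
    then have "real (I_5_2 N) \<le> 5 * real x * square_quads {p. prime p \<and> p \<le> x}"
      unfolding real_I_5_2_eq[of N \<eta>, symmetric] by simp
    also have "\<dots> \<le> 5 * real x * (C * real x powr 2.0001)"
      by (intro mult_left_mono sq) auto
    also have "\<dots> = 5 * C * (real x powr 1 * real x powr 2.0001)" by simp
    also have "real x powr 1 * real x powr 2.0001 = real x powr 3.0001"
      by (simp only: powr_add[symmetric]) simp
    also have "5 * C * real x powr 3.0001 \<le> 5 * C * (B + 1) * real x powr 3.0001"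
      using B C by (intro mult_right_mono) auto
    finally show "real (I_5_2 N) \<le> 5 * C * (B + 1) * real x powr 3.0001" .
    fix ms m m' assume ms: "x \<ge> x0" "length ms = 5" "m \<in> set ms" "m' \<in> set ms" "m \<noteq> m'"
      "\<bar>of_int (m' - m)\<bar> \<le> real x powr 0.05"
    have "norm (twisted_reps \<eta> N ms) \<le> 5 * (B * real x powr 0.987) * square_quads {p. prime p \<and> p \<le> x}"
    proof (rule norm_twisted_reps_le[OF N ms(2)])
      fix \<alpha> :: real
      \<comment> \<open>The dichotomy is applied at \<alpha> + m \<eta> with shift m' - m, so that
        its two alternatives concern the frequencies m and m'.\<close>
      have e: "\<alpha> + of_int m * \<eta> + of_int (m' - m) * \<eta> = \<alpha> + of_int m' * \<eta>" by (simp add: algebra_simps)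
      have "m' - m \<noteq> 0" using ms by simp
      from B(2)[OF ms(1) this ms(6), of "\<alpha> + of_int m * \<eta>"]
      show "\<exists>m\<in>set ms. norm (prime_exp_sum x (\<alpha> + of_int m * \<eta>)) \<le> B * real x powr 0.987"
        unfolding e using ms(3,4) by blast
    qed
    also have "\<dots> \<le> 5 * (B * real x powr 0.987) * (C * real x powr 2.0001)"
      using B by (intro mult_left_mono sq) auto
    also have "\<dots> = 5 * C * B * (real x powr 0.987 * real x powr 2.0001)" by simp
    also have "real x powr 0.987 * real x powr 2.0001 = real x powr 2.9871"
      by (simp only: powr_add[symmetric]) simp
    also have "5 * C * B * real x powr 2.9871 \<le> 5 * C * (B + 1) * real x powr 2.9871"
      using B C by (intro mult_right_mono) auto
    finally show "norm (twisted_reps \<eta> N ms) \<le> 5 * C * (B + 1) * real x powr 2.9871" .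
  qed
qed

text \<open>The factors are exchanged one at a time; all remaining ones have norm at most 1.\<close>

lemma norm_prod_list_diff_le:
  fixes f g :: "'a \<Rightarrow> complex"
  assumes "\<And>p. norm (f p) \<le> 1" "\<And>p. norm (g p) \<le> 1"
  shows "norm (prod_list (map f ps) - prod_list (map g ps)) \<le> (\<Sum>p\<leftarrow>ps. norm (f p - g p))"
proof (induction ps)
  case (Cons p ps)
  have "norm (prod_list (map h ps)) \<le> 1" if "\<And>p. norm (h p) \<le> 1" for h :: "'a \<Rightarrow> complex"
    by (induction ps) (use that in \<open>auto simp: norm_mult intro: mult_le_one\<close>)
  then have g1: "norm (prod_list (map g ps)) \<le> 1" using assms by blast
  have "prod_list (map f (p # ps)) - prod_list (map g (p # ps)) =
      f p * (prod_list (map f ps) - prod_list (map g ps)) + (f p - g p) * prod_list (map g ps)"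
    by (simp add: algebra_simps)
  also have "norm \<dots> \<le> norm (f p) * norm (prod_list (map f ps) - prod_list (map g ps)) + norm (f p - g p) * norm (prod_list (map g ps))"
    by (metis norm_mult norm_triangle_ineq)
  also have "\<dots> \<le> 1 * (\<Sum>p\<leftarrow>ps. norm (f p - g p)) + norm (f p - g p) * 1"
    using assms g1 Cons by (intro add_mono mult_mono) auto
  finally show ?case by simp
qed simp

lemma prod_list_ee_single:
  assumes "length ps = 5" "i < 5"
  shows "prod_list (map2 (\<lambda>m p. ee (of_int m * \<eta> * real p ^ 2)) ((replicate 5 0)[i := m]) ps) = ee (of_int m * \<eta> * real (ps ! i) ^ 2)"
proof -
  have "prod_list (map2 (\<lambda>m p. ee (of_int m * \<eta> * real p ^ 2)) ((replicate 5 0)[i := m]) ps) =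
      (\<Prod>k=0..<5. ee (of_int ((replicate 5 0)[i := m] ! k) * \<eta> * real (ps ! k) ^ 2))"
    using assms by (subst prod.list_conv_set_nth) simp
  also have "\<dots> = (\<Prod>k=0..<5. if k = i then ee (of_int m * \<eta> * real (ps ! k) ^ 2) else 1)"
    using assms by (intro prod.cong refl) (auto simp: nth_list_update)
  finally show ?thesis using assms by simp
qed

text \<open>A smoothed count of the representations whose i-th prime falls near an endpoint c. The
  frequency 0 returns I(N); any other frequency sits in position i alone, giving a tuple that is not
  constant and hence small.\<close>

lemma sum_fejer_reps_le:
  assumes H: "H \<ge> 1" and i: "i < 5"
    and R: "\<And>m. m \<noteq> 0 \<Longrightarrow> \<bar>m\<bar> < int H \<Longrightarrow> norm (twisted_reps \<eta> N ((replicate 5 0)[i := m])) \<le> R" and R0: "R \<ge> 0"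
  shows "(\<Sum>ps\<in>prime_square_reps N. fejer H (\<eta> * real (ps ! i) ^ 2 - c)) \<le> real (I_5_2 N) + 2 * real H * R"
proof -
  define w where "w = (\<lambda>m::int. complex_of_real (1 - \<bar>of_int m\<bar> / real H) * ee (- (of_int m * c)))"
  have w: "norm (w m) \<le> 1" if "m \<in> {- int H<..<int H}" for m
  proof -
    have "\<bar>real_of_int m\<bar> \<le> real H" using that by auto
    then have "0 \<le> 1 - \<bar>real_of_int m\<bar> / real H" "1 - \<bar>real_of_int m\<bar> / real H \<le> 1" using H by auto
    then show ?thesis unfolding w_def norm_mult norm_of_real by simp
  qed
  have eq: "complex_of_real (\<Sum>ps\<in>prime_square_reps N. fejer H (\<eta> * real (ps ! i) ^ 2 - c)) =
      (\<Sum>m\<in>{- int H<..<int H}. w m * twisted_reps \<eta> N ((replicate 5 0)[i := m]))"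
  proof -
    have "complex_of_real (\<Sum>ps\<in>prime_square_reps N. fejer H (\<eta> * real (ps ! i) ^ 2 - c)) =
      (\<Sum>ps\<in>prime_square_reps N. \<Sum>m\<in>{- int H<..<int H}. w m *
         prod_list (map2 (\<lambda>m p. ee (of_int m * \<eta> * real p ^ 2)) ((replicate 5 0)[i := m]) ps))"
      unfolding of_real_sum
    proof (rule sum.cong[OF refl])
      fix ps assume "ps \<in> prime_square_reps N"
      then have len: "length ps = 5" by (simp add: prime_square_reps_def)
      show "complex_of_real (fejer H (\<eta> * real (ps ! i) ^ 2 - c)) =
          (\<Sum>m\<in>{- int H<..<int H}. w m * prod_list (map2 (\<lambda>m p. ee (of_int m * \<eta> * real p ^ 2)) ((replicate 5 0)[i := m]) ps))"
        unfolding fejer_expansion[OF H] prod_list_ee_single[OF len i] unfolding w_def mult.assoc ee_add[symmetric]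
        by (intro sum.cong refl arg_cong2[where f = "(*)"] arg_cong[where f = ee]) (simp add: algebra_simps)
    qed
    also have "\<dots> = (\<Sum>m\<in>{- int H<..<int H}. w m * twisted_reps \<eta> N ((replicate 5 0)[i := m]))"
      unfolding twisted_reps_def sum_distrib_left by (rule sum.swap)
    finally show ?thesis .
  qed
  have "(\<Sum>ps\<in>prime_square_reps N. fejer H (\<eta> * real (ps ! i) ^ 2 - c)) =
      norm (complex_of_real (\<Sum>ps\<in>prime_square_reps N. fejer H (\<eta> * real (ps ! i) ^ 2 - c)))"
    by (simp only: norm_of_real) (simp add: sum_nonneg)
  also have "\<dots> \<le> (\<Sum>m\<in>{- int H<..<int H}. (if m = 0 then real (I_5_2 N) else 0) + R)"
    unfolding eq
  proof (rule sum_norm_le)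
    fix m assume m: "m \<in> {- int H<..<int H}"
    have "norm (w m * twisted_reps \<eta> N ((replicate 5 0)[i := m])) \<le> 1 * norm (twisted_reps \<eta> N ((replicate 5 0)[i := m]))"
      unfolding norm_mult using w[OF m] by (intro mult_right_mono) auto
    also have "\<dots> \<le> (if m = 0 then real (I_5_2 N) else 0) + R"
    proof (cases "m = 0")
      case True
      have "(replicate 5 0)[i := 0] = replicate 5 (0::int)" by (metis list_update_id nth_replicate i)
      then show ?thesis using True R0 real_I_5_2_eq[of N \<eta>] by (metis (full_types) mult_1 norm_of_nat of_real_of_nat_eq le_add_same_cancel1)
    next
      case False
      moreover have "\<bar>m\<bar> < int H" using m by auto
      ultimately show ?thesis using R[of m] by simp
    qed
    finally show "norm (w m * twisted_reps \<eta> N ((replicate 5 0)[i := m])) \<le> (if m = 0 then real (I_5_2 N) else 0) + R" .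
  qed
  also have "\<dots> = real (I_5_2 N) + real (card {- int H<..<int H}) * R"
    using H by (simp add: sum.distrib)
  also have "\<dots> \<le> real (I_5_2 N) + 2 * real H * R"
    using R0 by (intro add_left_mono mult_right_mono) auto
  finally show ?thesis .
qed

section \<open>Truncating the series sigma\<close>

text \<open>The term at 0 is 1 / 0 = 0 by convention. As a majorant in
  \<open>sigma_series_approx\<close> this is consistent, since the difference estimated there
  vanishes exactly at m = 0.\<close>

lemma summable_inverse_square_int: "(\<lambda>m::int. 1 / real (nat \<bar>m\<bar>) ^ 2) summable_on UNIV"
proof -
  have s: "(\<lambda>n. 1 / real n ^ 2) summable_on UNIV"
    using inverse_power_summable[of 2, where ?'a = real]
    by (intro norm_summable_imp_summable_on) (simp add: field_simps)
  have half: "(\<lambda>m::int. 1 / real (nat \<bar>m\<bar>) ^ 2) summable_on range h" if "inj h" "\<And>n. nat \<bar>h n\<bar> = n" for h :: "nat \<Rightarrow> int"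
  proof -
    have "(\<lambda>m::int. 1 / real (nat \<bar>m\<bar>) ^ 2) \<circ> h = (\<lambda>n. 1 / real n ^ 2)"
      unfolding o_def that(2) ..
    then show ?thesis using s summable_on_reindex[OF that(1), of "\<lambda>m. 1 / real (nat \<bar>m\<bar>) ^ 2"] by (simp only:)
  qed
  have "(UNIV :: int set) = range int \<union> range (\<lambda>n. - int n)"
  proof (intro set_eqI iffI UNIV_I)
    fix m :: int
    have "m = int (nat m) \<or> m = - int (nat (- m))" by linarith
    then show "m \<in> range int \<union> range (\<lambda>n. - int n)" by blast
  qed
  moreover have "(\<lambda>m::int. 1 / real (nat \<bar>m\<bar>) ^ 2) summable_on (range int \<union> range (\<lambda>n. - int n))"
    by (intro summable_on_union half) (auto simp: inj_on_def)
  ultimately show ?thesis by simp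
qed

lemma norm_arc_coeff_le:
  assumes "m \<noteq> 0"
  shows "norm (arc_coeff a b m) \<le> 1 / \<bar>of_int m\<bar>"
proof -
  have m1: "1 \<le> \<bar>real_of_int m\<bar>" using assms by linarith
  have "norm (arc_coeff a b m) = \<bar>sin (pi * of_int m * (b - a))\<bar> / (pi * \<bar>of_int m\<bar>)"
    using assms unfolding arc_coeff_def
    by (simp only: if_False norm_mult norm_ee norm_of_real mult_1_left abs_divide abs_mult) simp
  also have "\<dots> \<le> 1 / (1 * \<bar>of_int m\<bar>)"
    using m1 pi_gt3 by (intro frac_le mult_right_mono) auto
  finally show ?thesis by simp
qed

text \<open>The shift 2.5 (a + b) is five times the midpoint of the arc, one for each prime.\<close>

lemma sigma_term_eq: "sigma_term \<eta> a b N m = arc_coeff a b m ^ 5 * ee (of_int m * \<eta> * real N)"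
proof (cases "m = 0")
  case False
  have "exp (2 * of_real pi * \<i> * of_int m * of_real (\<eta> * real N - 2.5 * (a + b))) =
      ee (of_int m * (\<eta> * real N - 2.5 * (a + b)))"
    unfolding ee_def cis_conv_exp by (simp add: mult_ac)
  also have "\<dots> = ee (- (of_int m * (a + b) / 2)) ^ 5 * ee (of_int m * \<eta> * real N)"
  proof -
    have "of_int m * (\<eta> * real N - 2.5 * (a + b)) = - (of_int m * (a + b) / 2) + - (of_int m * (a + b) / 2) + - (of_int m * (a + b) / 2)
        + - (of_int m * (a + b) / 2) + - (of_int m * (a + b) / 2) + of_int m * \<eta> * real N"
      by (simp add: algebra_simps)
    then show ?thesis by (simp only: ee_add power_numeral_reduce) (simp add: power_numeral_reduce)
  qed
  finally show ?thesis using False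
    by (simp add: sigma_term_def arc_coeff_def power_mult_distrib power_divide mult_ac)
qed (simp add: sigma_term_def arc_coeff_def)

text \<open>For 0 < |m| < K the Fejer weight differs from 1 by |m| / K, its fifth power by at most
  five times that, and the coefficients bring |m|^-5. For |m| \<ge> K the whole term is at most
  |m|^-5, of which one factor is traded for 1 / K. Both cases are below 5 / (K m^2).\<close>

lemma sigma_series_approx:
  assumes K: "K \<ge> 1"
  shows "norm ((\<Sum>m\<in>{- int K<..<int K}. (of_real (1 - \<bar>of_int m\<bar> / real K) * arc_coeff a b m) ^ 5 * ee (of_int m * \<eta> * real N))
      - sigma_series \<eta> a b N) \<le> 5 / real K * (\<Sum>\<^sub>\<infinity>m\<in>(UNIV :: int set). 1 / real (nat \<bar>m\<bar>) ^ 2)"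
proof -
  define t where "t = (\<lambda>m::int. (complex_of_real (1 - \<bar>of_int m\<bar> / real K) * arc_coeff a b m) ^ 5 * ee (of_int m * \<eta> * real N))"
  define s where "s = (\<lambda>m. if m \<in> {- int K<..<int K} then t m else 0)"
  define S where "S = (\<Sum>m\<in>{- int K<..<int K}. t m)"
  have "(t has_sum S) {- int K<..<int K}" unfolding S_def by (rule has_sum_finite) simp
  moreover have "(t has_sum S) {- int K<..<int K} \<longleftrightarrow> (s has_sum S) UNIV"
    by (rule has_sum_cong_neutral) (auto simp: s_def)
  ultimately have "(s has_sum S) UNIV" by blast
  moreover have "(sigma_term \<eta> a b N has_sum sigma_series \<eta> a b N) UNIV"
    unfolding sigma_series_def using summable_on_sigma_term by (rule has_sum_infsum)
  then have "((\<lambda>m. - sigma_term \<eta> a b N m) has_sum - sigma_series \<eta> a b N) UNIV"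
    by (simp add: has_sum_uminus)
  ultimately have d: "((\<lambda>m. s m + - sigma_term \<eta> a b N m) has_sum (S + - sigma_series \<eta> a b N)) UNIV"
    by (rule has_sum_add)
  have u: "((\<lambda>m::int. 5 / real K * (1 / real (nat \<bar>m\<bar>) ^ 2)) has_sum (5 / real K * (\<Sum>\<^sub>\<infinity>m\<in>(UNIV :: int set). 1 / real (nat \<bar>m\<bar>) ^ 2))) UNIV"
    by (intro has_sum_cmult_right has_sum_infsum summable_inverse_square_int)
  have "norm (s m + - sigma_term \<eta> a b N m) \<le> 5 / real K * (1 / real (nat \<bar>m\<bar>) ^ 2)" for m
  proof (cases "m = 0")
    case True
    then show ?thesis using K by (simp add: s_def t_def sigma_term_eq)
  next
    case False
    define M where "M = \<bar>real_of_int m\<bar>"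
    have M1: "M \<ge> 1" unfolding M_def using False by linarith
    have nM: "real (nat \<bar>m\<bar>) = M" unfolding M_def by simp
    have a5: "norm (arc_coeff a b m) ^ 5 \<le> 1 / M ^ 5"
      using power_mono[OF norm_arc_coeff_le[OF False] norm_ge_zero, of a b 5] by (simp add: M_def power_divide)
    show ?thesis
    proof (cases "m \<in> {- int K<..<int K}")
      case True
      define v where "v = 1 - M / real K"
      have "M \<le> real K" unfolding M_def using True by auto
      then have v: "0 \<le> v" "v \<le> 1" unfolding v_def using K M1 by auto
      have "norm (v ^ 5 - 1 ^ 5) \<le> real 5 * norm (v - 1)"
        using v by (intro norm_power_diff) auto
      then have v5: "\<bar>v ^ 5 - 1\<bar> \<le> 5 * (M / real K)" unfolding v_def using M1 by simp
      have "s m + - sigma_term \<eta> a b N m = of_real (v ^ 5 - 1) * arc_coeff a b m ^ 5 * ee (of_int m * \<eta> * real N)"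
      proof -
        have "s m = (of_real v * arc_coeff a b m) ^ 5 * ee (of_int m * \<eta> * real N)"
          using True by (simp only: s_def t_def v_def M_def if_True)
        then show ?thesis unfolding sigma_term_eq by (simp add: power_mult_distrib left_diff_distrib)
      qed
      then have "norm (s m + - sigma_term \<eta> a b N m) = \<bar>v ^ 5 - 1\<bar> * norm (arc_coeff a b m) ^ 5"
        by (simp only: norm_mult norm_of_real norm_ee norm_power mult_1_right)
      also have "\<dots> \<le> (5 * (M / real K)) * (1 / M ^ 5)"
        using v5 a5 M1 by (intro mult_mono) auto
      also have "\<dots> = 5 / real K * (1 / M ^ 4)" using M1 by (simp add: field_simps power_numeral_reduce)
      also have "\<dots> \<le> 5 / real K * (1 / M ^ 2)"
        using M1 by (intro mult_left_mono divide_left_mono power_increasing) auto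
      finally show ?thesis unfolding nM .
    next
      case False
      then have "int K \<le> \<bar>m\<bar>" by auto
      then have KM: "real K \<le> M" unfolding M_def by (metis of_int_abs of_int_le_iff of_int_of_nat_eq)
      have "norm (s m + - sigma_term \<eta> a b N m) = norm (arc_coeff a b m) ^ 5"
      proof -
        have "s m = 0" using False unfolding s_def by (rule if_not_P)
        then show ?thesis unfolding sigma_term_eq by (simp add: norm_mult norm_power)
      qed
      also have "\<dots> \<le> 1 / M ^ 5" by (rule a5)
      also have "\<dots> \<le> 1 / (real K * M ^ 2)"
      proof (intro divide_left_mono mult_pos_pos)
        have "real K * M ^ 2 \<le> M * M ^ 2" using KM M1 by (intro mult_right_mono) auto
        also have "\<dots> = M ^ 3" by (simp add: power_numeral_reduce)
        also have "\<dots> \<le> M ^ 5" using M1 by (intro power_increasing) auto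
        finally show "real K * M ^ 2 \<le> M ^ 5" .
      qed (use K M1 in auto)
      also have "\<dots> \<le> 5 / real K * (1 / M ^ 2)" using K M1 by (simp add: divide_right_mono)
      finally show ?thesis unfolding nM .
    qed
  qed
  then have "norm (S + - sigma_series \<eta> a b N) \<le> 5 / real K * (\<Sum>\<^sub>\<infinity>m\<in>(UNIV :: int set). 1 / real (nat \<bar>m\<bar>) ^ 2)"
    by (intro norm_infsum_le[OF d u]) auto
  then show ?thesis unfolding S_def t_def by simp
qed

lemma J_5_2_eq:
  "complex_of_real (real (J_5_2 \<eta> a b N)) = (\<Sum>ps\<in>prime_square_reps N.
     prod_list (map (\<lambda>p. if a < frac (\<eta> * real p ^ 2) \<and> frac (\<eta> * real p ^ 2) < b then 1 else 0) ps))"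
proof -
  have "prod_list (map (\<lambda>p. if Q p then 1 else 0) ps) = (if \<forall>p\<in>set ps. Q p then 1 else (0::complex))" for Q and ps :: "nat list"
    by (induction ps) auto
  then show ?thesis
    unfolding J_5_2_def using finite_prime_square_reps[of N] by (simp add: sum.If_cases Int_def)
qed

lemma J_5_2_smooth_le:
  assumes H: "H \<ge> 1" and ab: "0 < a" "a < b" "b < 1"
    and R: "\<And>i m. i < 5 \<Longrightarrow> m \<noteq> 0 \<Longrightarrow> \<bar>m\<bar> < int H \<Longrightarrow> norm (twisted_reps \<eta> N ((replicate 5 0)[i := m])) \<le> R" and R0: "R \<ge> 0"
  shows "norm ((\<Sum>ps\<in>prime_square_reps N. prod_list (map (\<lambda>p. fejer_arc (H ^ 3) a b (\<eta> * real p ^ 2)) ps))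
      - of_real (real (J_5_2 \<eta> a b N))) \<le> 220 / real H * real (I_5_2 N) + 80 * R"
proof -
  define \<psi> where "\<psi> = (\<lambda>p. if a < frac (\<eta> * real p ^ 2) \<and> frac (\<eta> * real p ^ 2) < b then 1 else (0::complex))"
  define T where "T = (\<lambda>p. fejer_arc (H ^ 3) a b (\<eta> * real p ^ 2))"
  define er where "er = (\<lambda>p. 36 / real H + 4 / real H * (fejer H (\<eta> * real p ^ 2 - a) + fejer H (\<eta> * real p ^ 2 - b)))"
  have K: "H ^ 3 \<ge> 1" using H by simp
  have er: "norm (T p - \<psi> p) \<le> er p" for p
    unfolding T_def \<psi>_def er_def by (rule fejer_arc_error[OF H ab])
  have "norm ((\<Sum>ps\<in>prime_square_reps N. prod_list (map T ps)) - (\<Sum>ps\<in>prime_square_reps N. prod_list (map \<psi> ps)))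
      \<le> (\<Sum>ps\<in>prime_square_reps N. \<Sum>i<5. er (ps ! i))"
    unfolding sum_subtractf[symmetric]
  proof (rule sum_norm_le)
    fix ps assume "ps \<in> prime_square_reps N"
    then have len: "length ps = 5" by (simp add: prime_square_reps_def)
    have "norm (prod_list (map T ps) - prod_list (map \<psi> ps)) \<le> (\<Sum>p\<leftarrow>ps. norm (T p - \<psi> p))"
      by (rule norm_prod_list_diff_le) (auto simp: T_def \<psi>_def norm_fejer_arc_le(1)[OF K ab])
    also have "\<dots> \<le> (\<Sum>p\<leftarrow>ps. er p)" by (intro sum_list_mono er)
    also have "\<dots> = (\<Sum>i<5. er (ps ! i))" using len by (simp add: sum_list_sum_nth atLeast0LessThan)
    finally show "norm (prod_list (map T ps) - prod_list (map \<psi> ps)) \<le> (\<Sum>i<5. er (ps ! i))" .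
  qed
  also have "\<dots> = (\<Sum>i<5. \<Sum>ps\<in>prime_square_reps N. er (ps ! i))" by (rule sum.swap)
  also have "\<dots> \<le> (\<Sum>i<(5::nat). 36 / real H * real (I_5_2 N) + 4 / real H * ((real (I_5_2 N) + 2 * real H * R) + (real (I_5_2 N) + 2 * real H * R)))"
  proof (rule sum_mono)
    fix i :: nat assume "i \<in> {..<5}"
    then have i: "i < 5" by simp
    have "(\<Sum>ps\<in>prime_square_reps N. er (ps ! i)) = 36 / real H * real (I_5_2 N) +
        4 / real H * ((\<Sum>ps\<in>prime_square_reps N. fejer H (\<eta> * real (ps ! i) ^ 2 - a)) + (\<Sum>ps\<in>prime_square_reps N. fejer H (\<eta> * real (ps ! i) ^ 2 - b)))"
      unfolding er_def I_5_2_def sum.distrib sum_distrib_left[symmetric] by simp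
    also have "\<dots> \<le> 36 / real H * real (I_5_2 N) + 4 / real H * ((real (I_5_2 N) + 2 * real H * R) + (real (I_5_2 N) + 2 * real H * R))"
      using R[OF i] R0 by (intro add_left_mono mult_left_mono add_mono sum_fejer_reps_le[OF H i]) auto
    finally show "(\<Sum>ps\<in>prime_square_reps N. er (ps ! i)) \<le> \<dots>" .
  qed
  \<comment> \<open>Five positions, each with 36 + 2 * 4 for I / H and 4 * 2 * 2 for R.\<close>
  also have "\<dots> = 220 / real H * real (I_5_2 N) + 80 * R"
    using H by (simp add: field_simps)
  finally show ?thesis unfolding J_5_2_eq T_def \<psi>_def .
qed

lemma prod_list_mult_map2:
  fixes t :: "'a \<Rightarrow> complex"
  shows "length ms = length ps \<Longrightarrow> prod_list (map2 (\<lambda>m p. t m * f m p) ms ps) = prod_list (map t ms) * prod_list (map2 f ms ps)"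
  by (induction ms ps rule: list_induct2) (simp_all add: mult_ac)

lemma smooth_expansion:
  "(\<Sum>ps\<in>prime_square_reps N. prod_list (map (\<lambda>p. fejer_arc K a b (\<eta> * real p ^ 2)) ps)) =
   (\<Sum>ms | set ms \<subseteq> {- int K<..<int K} \<and> length ms = 5.
      prod_list (map (\<lambda>m. of_real (1 - \<bar>of_int m\<bar> / real K) * arc_coeff a b m) ms) * twisted_reps \<eta> N ms)"
proof -
  define t where "t = (\<lambda>m::int. complex_of_real (1 - \<bar>of_int m\<bar> / real K) * arc_coeff a b m)"
  define h where "h = (\<lambda>(m::int) (p::nat). ee (of_int m * \<eta> * real p ^ 2))"
  have "(\<Sum>ps\<in>prime_square_reps N. prod_list (map (\<lambda>p. fejer_arc K a b (\<eta> * real p ^ 2)) ps)) =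
      (\<Sum>ps\<in>prime_square_reps N. \<Sum>ms | set ms \<subseteq> {- int K<..<int K} \<and> length ms = 5. prod_list (map t ms) * prod_list (map2 h ms ps))"
  proof (rule sum.cong[OF refl])
    fix ps assume "ps \<in> prime_square_reps N"
    then have len: "length ps = 5" by (simp add: prime_square_reps_def)
    have "map (\<lambda>p. fejer_arc K a b (\<eta> * real p ^ 2)) ps =
        map (\<lambda>g. \<Sum>m\<in>{- int K<..<int K}. g m) (map (\<lambda>p m. t m * h m p) ps)"
      unfolding fejer_arc_def t_def h_def by (simp add: mult.assoc)
    then have "prod_list (map (\<lambda>p. fejer_arc K a b (\<eta> * real p ^ 2)) ps) =
        (\<Sum>ms | set ms \<subseteq> {- int K<..<int K} \<and> length ms = 5. prod_list (map2 (\<lambda>g m. g m) (map (\<lambda>p m. t m * h m p) ps) ms))"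
      using prod_list_sum_eq_sum_lists[of "{- int K<..<int K}" "map (\<lambda>p m. t m * h m p) ps"]
      by (simp only: length_map len finite_greaterThanLessThan_int simp_thms)
    also have "\<dots> = (\<Sum>ms | set ms \<subseteq> {- int K<..<int K} \<and> length ms = 5. prod_list (map t ms) * prod_list (map2 h ms ps))"
    proof (rule sum.cong[OF refl])
      fix ms assume "ms \<in> {ms. set ms \<subseteq> {- int K<..<int K} \<and> length ms = 5}"
      then have len': "length ms = length ps" using len by simp
      have "map2 (\<lambda>g m. g m) (map (\<lambda>p m. t m * h m p) ps) ms = map2 (\<lambda>m p. t m * h m p) ms ps"
        using len' by (induction ms ps rule: list_induct2) auto
      then show "prod_list (map2 (\<lambda>g m. g m) (map (\<lambda>p m. t m * h m p) ps) ms) = prod_list (map t ms) * prod_list (map2 h ms ps)"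
        using prod_list_mult_map2[OF len', of t h] by simp
    qed
    finally show "prod_list (map (\<lambda>p. fejer_arc K a b (\<eta> * real p ^ 2)) ps) = \<dots>" .
  qed
  also have "\<dots> = (\<Sum>ms | set ms \<subseteq> {- int K<..<int K} \<and> length ms = 5. \<Sum>ps\<in>prime_square_reps N. prod_list (map t ms) * prod_list (map2 h ms ps))"
    by (rule sum.swap)
  also have "\<dots> = (\<Sum>ms | set ms \<subseteq> {- int K<..<int K} \<and> length ms = 5. prod_list (map t ms) * twisted_reps \<eta> N ms)"
    unfolding twisted_reps_def h_def sum_distrib_left ..
  finally show ?thesis unfolding t_def .
qed

text \<open>The constant tuples are exactly the diagonal sum. Each of the at most (2 K)^5 others
  contains two distinct frequencies and has a coefficient of norm at most 1.\<close>

lemma smooth_main_term_le: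
  assumes K: "K \<ge> 1" and ab: "0 < a" "a < b" "b < 1"
    and R: "\<And>ms m m'. length ms = 5 \<Longrightarrow> set ms \<subseteq> {- int K<..<int K} \<Longrightarrow> m \<in> set ms \<Longrightarrow> m' \<in> set ms \<Longrightarrow> m \<noteq> m' \<Longrightarrow>
      norm (twisted_reps \<eta> N ms) \<le> R" and R0: "R \<ge> 0"
  shows "norm ((\<Sum>ps\<in>prime_square_reps N. prod_list (map (\<lambda>p. fejer_arc K a b (\<eta> * real p ^ 2)) ps)) -
     of_nat (I_5_2 N) * (\<Sum>m\<in>{- int K<..<int K}. (of_real (1 - \<bar>of_int m\<bar> / real K) * arc_coeff a b m) ^ 5 * ee (of_int m * \<eta> * real N)))
     \<le> 32 * real K ^ 5 * R"
proof -
  define t where "t = (\<lambda>m::int. complex_of_real (1 - \<bar>of_int m\<bar> / real K) * arc_coeff a b m)"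
  define M where "M = {- int K<..<int K}"
  define Ls where "Ls = {ms. set ms \<subseteq> M \<and> length ms = 5}"
  define Cs where "Cs = replicate 5 ` M"
  have finM: "finite M" unfolding M_def by simp
  have finL: "finite Ls" unfolding Ls_def using finite_lists_length_eq[OF finM] by simp
  have CL: "Cs \<subseteq> Ls" unfolding Cs_def Ls_def by auto
  have t1: "norm (t m) \<le> 1" if m: "m \<in> M" for m
  proof -
    have "\<bar>real_of_int m\<bar> \<le> real K" using m unfolding M_def by auto
    then have v: "0 \<le> 1 - \<bar>real_of_int m\<bar> / real K" "1 - \<bar>real_of_int m\<bar> / real K \<le> 1" using K by auto
    have "norm (arc_coeff a b m) \<le> 1"
    proof (cases "m = 0")
      case True
      then show ?thesis using ab by (simp add: arc_coeff_def del: of_real_diff)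
    next
      case False
      have "1 / \<bar>real_of_int m\<bar> \<le> 1" using False by (simp add: divide_le_eq)
      then show ?thesis using norm_arc_coeff_le[OF False, of a b] by linarith
    qed
    then show ?thesis unfolding t_def norm_mult norm_of_real using v by (intro mult_le_one) auto
  qed
  have tp: "norm (prod_list (map t ms)) \<le> 1" if "set ms \<subseteq> M" for ms
    using that by (induction ms) (auto simp: norm_mult intro!: mult_le_one t1)
  have "(\<Sum>ms\<in>Cs. prod_list (map t ms) * twisted_reps \<eta> N ms) = (\<Sum>m\<in>M. prod_list (map t (replicate 5 m)) * twisted_reps \<eta> N (replicate 5 m))"
    unfolding Cs_def by (subst sum.reindex) (auto simp: inj_on_def)
  also have "\<dots> = of_nat (I_5_2 N) * (\<Sum>m\<in>M. t m ^ 5 * ee (of_int m * \<eta> * real N))"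
    unfolding sum_distrib_left twisted_reps_const by (intro sum.cong refl) (simp add: prod_list_replicate mult_ac)
  finally have cs: "(\<Sum>ms\<in>Cs. prod_list (map t ms) * twisted_reps \<eta> N ms) = of_nat (I_5_2 N) * (\<Sum>m\<in>M. t m ^ 5 * ee (of_int m * \<eta> * real N))" .
  have "(\<Sum>ms\<in>Ls. prod_list (map t ms) * twisted_reps \<eta> N ms) - (\<Sum>ms\<in>Cs. prod_list (map t ms) * twisted_reps \<eta> N ms) =
      (\<Sum>ms\<in>Ls - Cs. prod_list (map t ms) * twisted_reps \<eta> N ms)"
    using sum_diff[OF finL CL, of "\<lambda>ms. prod_list (map t ms) * twisted_reps \<eta> N ms"] by simp
  also have "norm \<dots> \<le> (\<Sum>ms\<in>Ls - Cs. R)"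
  proof (rule sum_norm_le)
    fix ms assume ms: "ms \<in> Ls - Cs"
    then have l: "length ms = 5" "set ms \<subseteq> M" by (auto simp: Ls_def)
    then have hd: "hd ms \<in> set ms" by (intro hd_in_set) auto
    have "\<exists>m'\<in>set ms. hd ms \<noteq> m'"
    proof (rule ccontr)
      assume "\<not> (\<exists>m'\<in>set ms. hd ms \<noteq> m')"
      then have "ms = replicate 5 (hd ms)" using l by (metis replicate_eqI)
      then have "ms \<in> Cs" unfolding Cs_def using l hd by blast
      then show False using ms by simp
    qed
    then have "norm (twisted_reps \<eta> N ms) \<le> R" using R[OF l(1) _ hd] l(2) unfolding M_def by blast
    then have "norm (prod_list (map t ms)) * norm (twisted_reps \<eta> N ms) \<le> 1 * R"
      using tp[OF l(2)] by (intro mult_mono) auto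
    then show "norm (prod_list (map t ms) * twisted_reps \<eta> N ms) \<le> R" by (simp only: norm_mult mult_1_left)
  qed
  also have "\<dots> = real (card (Ls - Cs)) * R" by simp
  also have "\<dots> \<le> real ((2 * K) ^ 5) * R"
  proof (rule mult_right_mono[OF _ R0])
    have "card (Ls - Cs) \<le> card Ls" using finL by (intro card_mono) auto
    also have "\<dots> = card M ^ 5" unfolding Ls_def by (rule card_lists_length_eq[OF finM])
    also have "\<dots> \<le> (2 * K) ^ 5" unfolding M_def by (intro power_mono) auto
    finally show "real (card (Ls - Cs)) \<le> real ((2 * K) ^ 5)" by (simp only: of_nat_le_iff)
  qed
  also have "real ((2 * K) ^ 5) * R = 32 * real K ^ 5 * R" by (simp add: power_mult_distrib)
  finally show ?thesis
    unfolding cs smooth_expansion unfolding Ls_def M_def t_def .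
qed

theorem mainTheorem1:
  fixes \<eta> a b :: real
  assumes "quadratic_irrationality \<eta>"
    and "0 < a" and "a < b" and "b < 1"
  shows "(\<lambda>N. of_nat (J_5_2 \<eta> a b N) - of_nat (I_5_2 N) * sigma_series \<eta> a b N)
           \<in> O[sequentially](\<lambda>N. complex_of_real (real N powr (3/2 - 0.00002)))"
proof -
  obtain C x0 where C: "C > 0"
    "\<And>N x. N < (x + 1) ^ 2 \<Longrightarrow> real (I_5_2 N) \<le> C * real x powr 3.0001"
    "\<And>N x ms m m'. N < (x + 1) ^ 2 \<Longrightarrow> x \<ge> x0 \<Longrightarrow> length ms = 5 \<Longrightarrow> m \<in> set ms \<Longrightarrow> m' \<in> set ms \<Longrightarrow> m \<noteq> m' \<Longrightarrow>
      \<bar>of_int (m' - m)\<bar> \<le> real x powr 0.05 \<Longrightarrow> norm (twisted_reps \<eta> N ms) \<le> C * real x powr 2.9871"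
    by (rule twisted_reps_bounds[OF assms(1)]) (rule that)
  define Z where "Z = (\<Sum>\<^sub>\<infinity>m\<in>(UNIV :: int set). 1 / real (nat \<bar>m\<bar>) ^ 2)"
  have Z0: "Z \<ge> 0" unfolding Z_def by (intro infsum_nonneg) simp
  \<comment> \<open>The threshold 2^25 makes X^0.0488 at least 2^1.22, which absorbs the factor 2 in
    \<open>2 * real K \<le> X powr 0.05\<close>.\<close>
  define x1 where "x1 = max x0 (2 ^ 25)"
  \<comment> \<open>552 = 2 * 220 + 80 + 32 collects endpoints and off-diagonal frequencies, 10 = 2
    * 5 the truncated series; the factors 2 come from rounding X^0.0004 down to H.\<close>
  have bound: "norm (of_nat (J_5_2 \<eta> a b N) - of_nat (I_5_2 N) * sigma_series \<eta> a b N) \<le>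
      C * (552 + 10 * Z) * norm (complex_of_real (real N powr (3/2 - 0.00002)))" if N: "N \<ge> x1 ^ 2" for N
  proof -
    define x where "x = nat \<lfloor>sqrt (real N)\<rfloor>"
    define X where "X = real x"
    have xN: "X \<le> sqrt (real N)" unfolding X_def x_def by simp
    have "sqrt (real N) < real x + 1" unfolding x_def by linarith
    then have "sqrt (real N) ^ 2 < (real x + 1) ^ 2" by (intro power_strict_mono) auto
    then have "real N < real ((x + 1) ^ 2)" by (simp add: add.commute)
    then have Nx: "N < (x + 1) ^ 2" by (simp only: of_nat_less_iff)
    have "real (x1 ^ 2) \<le> real N" using N by (simp only: of_nat_le_iff)
    then have "real x1 \<le> sqrt (real N)" by (intro real_le_rsqrt) simp
    then have xx1: "x \<ge> x1" unfolding x_def by (simp add: le_nat_floor)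
    have x0: "x \<ge> x0" using xx1 unfolding x1_def by (rule max.boundedE)
    have x25: "2 ^ 25 \<le> x" using xx1 unfolding x1_def by (rule max.boundedE)
    then have "real (2 ^ 25) \<le> X" unfolding X_def by (simp only: of_nat_le_iff)
    moreover have "2 powr 25 = (2::real) ^ 25" by (rule powr_numeral) simp
    ultimately have X25: "2 powr 25 \<le> X" by (simp only: of_nat_power of_nat_numeral)
    have "(2::real) powr 0 \<le> 2 powr 25" by (rule powr_mono) simp_all
    then have X1: "X \<ge> 1" using X25 by simp
    have pX: "1 \<le> X powr s" if "s \<ge> 0" for s using X1 that by (intro ge_one_powr_ge_zero) auto
    have mono: "X powr s \<le> X powr t" if "s \<le> t" for s t using X1 that by (intro powr_mono) auto
    \<comment> \<open>The exponent must exceed the 0.0001 lost in the bound for I(N) by more than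
      0.00004, since 3 - 0.00004 is the target exponent in x; yet H^15 must stay below the saving of
      R.\<close>
    define H where "H = nat \<lfloor>X powr 0.0004\<rfloor>"
    have fl: "1 \<le> \<lfloor>X powr 0.0004\<rfloor>" using pX[of "0.0004"] by (simp add: le_floor_iff)
    have rH: "real H = of_int \<lfloor>X powr 0.0004\<rfloor>" unfolding H_def using fl by simp
    have "1 \<le> real H" unfolding rH using fl by linarith
    then have H1: "H \<ge> 1" by simp
    have HX: "real H \<le> X powr 0.0004" "X powr 0.0004 \<le> 2 * real H"
      using rH fl floor_correct[of "X powr 0.0004"] by linarith+
    define K where "K = H ^ 3"
    have K1: "K \<ge> 1" unfolding K_def using H1 by simp
    have KX: "real K \<le> X powr 0.0012"
    proof -
      have "real K \<le> (X powr 0.0004) ^ 3" unfolding K_def using HX(1) by (simp add: power_mono)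
      also have "\<dots> = X powr 0.0012" using X1 by (simp add: powr_powr flip: powr_numeral)
      finally show ?thesis .
    qed
    have HK: "real H \<le> real K" unfolding K_def using H1 power_increasing[of 1 3 H] by (simp add: of_nat_le_iff del: of_nat_power)
    \<comment> \<open>Differences of two frequencies are at most 2 K, and the dichotomy admits
      shifts up to X^0.05.\<close>
    have K2: "2 * real K \<le> X powr 0.05"
    proof -
      have "2 \<le> (2::real) powr 1.22" using powr_mono[of 1 "1.22" "2::real"] by simp
      also have "\<dots> = 2 powr (25 * 0.0488)" by simp
      also have "\<dots> = (2 powr 25) powr 0.0488" by (rule powr_powr[symmetric])
      also have "\<dots> \<le> X powr 0.0488" using X25 by (intro powr_mono2) auto
      finally have "2 * real K \<le> X powr 0.0488 * X powr 0.0012" using KX by (intro mult_mono) auto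
      also have "\<dots> = X powr 0.05" by (simp only: powr_add[symmetric]) simp
      finally show ?thesis .
    qed
    define R where "R = C * X powr 2.9871"
    have R0: "R \<ge> 0" unfolding R_def using C(1) by simp
    have Rms: "norm (twisted_reps \<eta> N ms) \<le> R"
      if "length ms = 5" "set ms \<subseteq> {- int K<..<int K}" "m \<in> set ms" "m' \<in> set ms" "m \<noteq> m'" for ms m m'
      unfolding R_def X_def
    proof (rule C(3)[OF Nx x0 that(1,3,4,5)])
      have "m \<in> {- int K<..<int K}" "m' \<in> {- int K<..<int K}" using that(2-4) by blast+
      then have "\<bar>m' - m\<bar> \<le> 2 * int K" unfolding greaterThanLessThan_iff by linarith
      then have "\<bar>real_of_int (m' - m)\<bar> \<le> 2 * real K" by linarith
      then show "\<bar>of_int (m' - m)\<bar> \<le> real x powr 0.05" using K2 unfolding X_def by linarith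
    qed
    have Rsingle: "norm (twisted_reps \<eta> N ((replicate 5 0)[i := m])) \<le> R" if "i < 5" "m \<noteq> 0" "\<bar>m\<bar> < int H" for i m
    proof (rule Rms)
      have HK': "int H \<le> int K" using HK by simp
      show "set ((replicate 5 0)[i := m]) \<subseteq> {- int K<..<int K}"
      proof -
        have "set ((replicate 5 0)[i := m]) \<subseteq> {m, 0}"
          using set_update_subset_insert[of "replicate 5 0" i m] by simp
        moreover have "m \<in> {- int K<..<int K}" "0 \<in> {- int K<..<int K}"
          unfolding greaterThanLessThan_iff using that(3) HK' K1 by linarith+
        ultimately show ?thesis by blast
      qed
      show "m \<in> set ((replicate 5 0)[i := m])" using that by (intro set_update_memI) simp
      show "0 \<in> set ((replicate 5 0)[i := m])"
      proof -
        define k :: nat where "k = (if i = 0 then 1 else 0)"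
        have k: "k < 5" "k \<noteq> i" unfolding k_def by auto
        then have "(replicate 5 0)[i := m] ! k = 0" by simp
        moreover have "(replicate 5 0)[i := m] ! k \<in> set ((replicate 5 0)[i := m])"
          using k by (intro nth_mem) simp
        ultimately show ?thesis by simp
      qed
      show "m \<noteq> 0" by fact
    qed simp
    define ST where "ST = (\<Sum>ps\<in>prime_square_reps N. prod_list (map (\<lambda>p. fejer_arc K a b (\<eta> * real p ^ 2)) ps))"
    define Sg where "Sg = (\<Sum>m\<in>{- int K<..<int K}. (of_real (1 - \<bar>of_int m\<bar> / real K) * arc_coeff a b m) ^ 5 * ee (of_int m * \<eta> * real N))"
    define I where "I = real (I_5_2 N)"
    have 1: "norm (ST - of_nat (J_5_2 \<eta> a b N)) \<le> 220 / real H * I + 80 * R"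
      using J_5_2_smooth_le[OF H1 assms(2-4) Rsingle R0] unfolding ST_def K_def I_def by simp
    have 2: "norm (ST - of_nat (I_5_2 N) * Sg) \<le> 32 * real K ^ 5 * R"
      unfolding ST_def Sg_def using assms Rms R0 by (intro smooth_main_term_le[OF K1]) auto
    have 3: "norm (of_nat (I_5_2 N) * Sg - of_nat (I_5_2 N) * sigma_series \<eta> a b N) \<le> I * (5 / real K * Z)"
    proof -
      have "norm (Sg - sigma_series \<eta> a b N) \<le> 5 / real K * Z"
        unfolding Sg_def Z_def by (rule sigma_series_approx[OF K1])
      then have "I * norm (Sg - sigma_series \<eta> a b N) \<le> I * (5 / real K * Z)"
        unfolding I_def by (intro mult_left_mono) auto
      then show ?thesis by (simp only: right_diff_distrib[symmetric] norm_mult norm_of_nat I_def)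
    qed
    have IX: "I / real H \<le> 2 * C * X powr 2.9997"
    proof -
      have "I / real H \<le> C * X powr 3.0001 / (X powr 0.0004 / 2)"
        using C(2)[OF Nx] HX H1 X1 C(1) unfolding I_def X_def by (intro frac_le) auto
      also have "\<dots> = 2 * C * (X powr 3.0001 / X powr 0.0004)" by simp
      also have "X powr 3.0001 / X powr 0.0004 = X powr 2.9997"
        by (simp only: powr_diff[symmetric]) simp
      finally show ?thesis .
    qed
    have IK: "I / real K \<le> I / real H"
      using HK H1 unfolding I_def by (intro divide_left_mono) auto
    have R1: "R \<le> C * X powr 2.9997"
      unfolding R_def using C(1) mono[of "2.9871" "2.9997"] by (intro mult_left_mono) auto
    \<comment> \<open>The number of tuples adds 0.006 to 2.9871, which remains well below the
      endpoint exponent 2.9997.\<close>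
    have R2: "real K ^ 5 * R \<le> C * X powr 2.9997"
    proof -
      have "real K ^ 5 \<le> (X powr 0.0012) ^ 5" using KX by (intro power_mono) auto
      also have "\<dots> = X powr 0.006" using X1 by (simp add: powr_powr flip: powr_numeral)
      finally have "real K ^ 5 * R \<le> X powr 0.006 * R" using R0 by (intro mult_right_mono) auto
      also have "\<dots> = C * (X powr 0.006 * X powr 2.9871)" unfolding R_def by simp
      also have "X powr 0.006 * X powr 2.9871 = X powr 2.9931" by (simp only: powr_add[symmetric]) simp
      also have "C * X powr 2.9931 \<le> C * X powr 2.9997"
        using C(1) mono[of "2.9931" "2.9997"] by (intro mult_left_mono) auto
      finally show ?thesis .
    qed
    have "norm (of_nat (J_5_2 \<eta> a b N) - of_nat (I_5_2 N) * sigma_series \<eta> a b N) =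
        norm ((of_nat (J_5_2 \<eta> a b N) - ST) + (ST - of_nat (I_5_2 N) * Sg) + (of_nat (I_5_2 N) * Sg - of_nat (I_5_2 N) * sigma_series \<eta> a b N))"
      by simp
    also have "\<dots> \<le> (220 / real H * I + 80 * R) + 32 * real K ^ 5 * R + I * (5 / real K * Z)"
      using 1 2 3 by (intro norm_triangle_le add_mono) (simp_all add: norm_minus_commute)
    also have "\<dots> = 220 * (I / real H) + 80 * R + 32 * (real K ^ 5 * R) + 5 * Z * (I / real K)" by simp
    also have "\<dots> \<le> 220 * (2 * C * X powr 2.9997) + 80 * (C * X powr 2.9997) + 32 * (C * X powr 2.9997) + 5 * Z * (2 * C * X powr 2.9997)"
      using IX IK R1 R2 Z0 by (intro add_mono mult_left_mono) auto
    also have "\<dots> = C * (552 + 10 * Z) * X powr 2.9997" by (simp add: algebra_simps)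
    also have "\<dots> \<le> C * (552 + 10 * Z) * real N powr (3/2 - 0.00002)"
    proof (rule mult_left_mono)
      \<comment> \<open>X is at most sqrt N, so the exponent halves to 1.49985, smaller than
        1.49998.\<close>
      have "X powr 2.9997 \<le> sqrt (real N) powr 2.9997" using xN X1 by (intro powr_mono2) auto
      also have "\<dots> = (real N powr (1 / 2)) powr 2.9997" by (simp add: powr_half_sqrt)
      also have "\<dots> = real N powr 1.49985" by (simp add: powr_powr)
      also have "\<dots> \<le> real N powr (3/2 - 0.00002)"
      proof (rule powr_mono)
        have "1 \<le> sqrt (real N)" using xN X1 by linarith
        then show "1 \<le> real N" by simp
      qed simp
      finally show "X powr 2.9997 \<le> real N powr (3/2 - 0.00002)" .
    qed (use C(1) Z0 in simp)
    finally show ?thesis by simp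
  qed
  show ?thesis
    by (rule bigoI, rule eventually_mono[OF eventually_ge_at_top[of "x1 ^ 2"]]) (rule bound)
qed

end
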